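(* Let $\mathcal{H}$ be an $n$-dimensional Hilbert space, $n>1$, and let $\omega$ be the constant sequence $\frac1n$. Let $\mathcal{C}=\{r_\xi:\xi\in\mathcal{H}\}$ and let $\mathbb{G}$ be the subgroup of $\mathrm{Aut}(H^\infty_n)$ consisting of all automorphisms of $H^\infty_n$ that map the set $\mathcal{C}$ onto itself. Then the map $$\mathcal{U}(\mathcal{H})\ni U\mapsto \widetilde{\Gamma}_U|_{H^\infty_n}\in\mathbb{G}$$ is an isomorphism of groups from the unitary group $\mathcal{U}(\mathcal{H})$ of $\mathcal{H}$ onto $\mathbb{G}$.
   Context: $\mathcal{H}$ is a complex Hilbert space with orthonormal basis $\{e_1,\dots,e_n\}$, $n>1$. $\mathcal{F}(\mathcal{H})=\bigoplus_{k\ge 0}\mathcal{H}^{\otimes k}$ is the full Fock space, with $\mathcal{H}^{\otimes 0}=\mathbb{C}\Omega$, $\Omega$ the unit vacuum vector. For $\xi\in\mathcal{H}$ the left and right creation operators are $l_\xi(\eta)=\xi\otimes\eta$ and $r_\xi(\eta)=\eta\otimes\xi$ ($\eta\in\mathcal{F}(\mathcal{H})$; $l_\xi\Omega=r_\xi\Omega=\xi$), and $l_i:=l_{e_i}$. The Markov operator is $P_\omega(x)=\frac1n\sum_{i=1}^n l_i^*xl_i$ for $x\in B(\mathcal{F}(\mathcal{H}))$. $H^\infty_n=\{x\in B(\mathcal{F}(\mathcal{H})):P_\omega(x)=x\}$. This $\sigma$-weakly closed operator system is a von Neumann algebra (abstractly) with the inherited linear structure, norm, adjoint, unit and $\sigma$-weak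 topology, and with the Choi-Effros product $x\circ y=\text{SOT-}\lim_{k\to\infty}P_\omega^k(xy)$ (this limit exists). Every $r_\xi$ belongs to $H^\infty_n$. An automorphism of $H^\infty_n$ is a $*$-algebra automorphism with respect to $\circ$; $\mathrm{Aut}(H^\infty_n)$ is the group of these. For a unitary $U$ on $\mathcal{H}$, its second quantization $\Gamma_U$ is the unitary on $\mathcal{F}(\mathcal{H})$ with $\Gamma_U\Omega=\Omega$ and $\Gamma_U|_{\mathcal{H}^{\otimes k}}=U^{\otimes k}$ for $k\ge 1$, and $\widetilde{\Gamma}_U(x)=\Gamma_Ux\Gamma_U^*$ for $x\in B(\mathcal{F}(\mathcal{H}))$. *)

theory Defs
  imports "HOL-Analysis.Analysis" "HOL-Algebra.Bij"
begin

section \<open>Complex Hilbert spaces and bounded operators\<close>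

class scaleC =
  fixes scaleC :: "complex \<Rightarrow> 'a \<Rightarrow> 'a" (infixr \<open>*\<^sub>C\<close> 75)

text \<open>The complex inner product is conjugate-linear in the first argument.\<close>

class complex_inner = real_inner + scaleC +
  fixes cinner :: "'a \<Rightarrow> 'a \<Rightarrow> complex"
  assumes scaleC_add_right: "c *\<^sub>C (x + y) = c *\<^sub>C x + c *\<^sub>C y"
    and scaleC_add_left: "(c + d) *\<^sub>C x = c *\<^sub>C x + d *\<^sub>C x"
    and scaleC_scaleC: "c *\<^sub>C d *\<^sub>C x = (c * d) *\<^sub>C x"
    and scaleR_scaleC: "scaleR r x = complex_of_real r *\<^sub>C x"
    and cinner_commute: "cinner x y = cnj (cinner y x)"
    and cinner_add_right: "cinner x (y + z) = cinner x y + cinner x z"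
    and cinner_scaleC_right: "cinner x (c *\<^sub>C y) = c * cinner x y"
    and inner_eq_Re_cinner: "inner x y = Re (cinner x y)"

class complex_hilbert = complex_inner + complete_space

lemma cinner_add_left: "cinner (x + y) (z::'a::complex_inner) = cinner x z + cinner y z"
  by (metis cinner_add_right cinner_commute complex_cnj_add)

lemma cinner_scaleC_left: "cinner (c *\<^sub>C x) (y::'a::complex_inner) = cnj c * cinner x y"
  by (metis cinner_scaleC_right cinner_commute complex_cnj_mult)

lemma cinner_zero_right [simp]: "cinner x (0::'a::complex_inner) = 0"
  using cinner_add_right[of x 0 0] by simp

lemma cinner_zero_left [simp]: "cinner (0::'a::complex_inner) x = 0"
  using cinner_add_left[of 0 0 x] by simp

lemma cinner_sum_right: "cinner x (\<Sum>i\<in>A. f i :: 'a::complex_inner) = (\<Sum>i\<in>A. cinner x (f i))"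
  by (induction A rule: infinite_finite_induct) (auto simp: cinner_add_right)

lemma cinner_sum_left: "cinner (\<Sum>i\<in>A. f i) (x :: 'a::complex_inner) = (\<Sum>i\<in>A. cinner (f i) x)"
  by (induction A rule: infinite_finite_induct) (auto simp: cinner_add_left)

lemma cinner_self: "cinner x x = complex_of_real ((norm (x::'a::complex_inner))\<^sup>2)"
proof -
  have "Im (cinner x x) = 0"
    using cinner_commute[of x x] by (simp add: complex_eq_iff)
  moreover have "Re (cinner x x) = (norm x)\<^sup>2"
    by (simp add: power2_norm_eq_inner inner_eq_Re_cinner)
  ultimately show ?thesis by (simp add: complex_eq_iff)
qed

lemma norm_scaleC: "norm (c *\<^sub>C x) = cmod c * norm (x::'a::complex_inner)"
proof -
  have "complex_of_real ((norm (c *\<^sub>C x))\<^sup>2) = c * cnj c * cinner x x"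
    unfolding cinner_self[symmetric] by (simp add: cinner_scaleC_right cinner_scaleC_left)
  also have "\<dots> = complex_of_real ((cmod c * norm x)\<^sup>2)"
    unfolding cinner_self complex_norm_square[symmetric] by (simp add: power_mult_distrib)
  finally have "(norm (c *\<^sub>C x))\<^sup>2 = (cmod c * norm x)\<^sup>2" by (simp only: of_real_eq_iff)
  then show ?thesis by simp
qed

lemma cmod_cinner_le: "cmod (cinner x y) \<le> norm x * norm (y::'a::complex_inner)"
proof (cases "cinner x y = 0")
  case False
  define c where "c = cnj (cinner x y) / cmod (cinner x y)"
  have "cmod c = 1" using False by (simp add: c_def norm_divide)
  have "cinner x (c *\<^sub>C y) = complex_of_real (cmod (cinner x y))"
    using False by (simp add: cinner_scaleC_right c_def mult.commute[of "cnj _"]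
        complex_norm_square[symmetric] power2_eq_square)
  then have "cmod (cinner x y) = inner x (c *\<^sub>C y)"
    by (simp add: inner_eq_Re_cinner)
  also have "\<dots> \<le> norm x * norm (c *\<^sub>C y)" by (rule norm_cauchy_schwarz)
  also have "norm (c *\<^sub>C y) = norm y" by (simp add: norm_scaleC \<open>cmod c = 1\<close>)
  finally show ?thesis .
qed simp

text \<open>Bounded operators are the complex-homogeneous elements of the type of bounded real-linear
  maps; sum, norm, identity and composition are those of that type.\<close>

definition bounded_ops :: "('a::complex_inner \<Rightarrow>\<^sub>L 'a) set" where
  "bounded_ops = {T. \<forall>c x. blinfun_apply T (c *\<^sub>C x) = c *\<^sub>C blinfun_apply T x}"

instantiation blinfun :: (real_normed_vector, complex_inner) scaleC
begin

lift_definition scaleC_blinfun :: "complex \<Rightarrow> 'a \<Rightarrow>\<^sub>L 'b \<Rightarrow> 'a \<Rightarrow>\<^sub>L 'b"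
  is "\<lambda>c f x. c *\<^sub>C f x"
proof -
  fix c :: complex and f :: "'a \<Rightarrow> 'b"
  assume "bounded_linear f"
  then interpret bounded_linear f .
  obtain K where K: "\<And>x. norm (f x) \<le> norm x * K" using bounded by blast
  have "cmod c * norm (f x) \<le> norm x * (cmod c * K)" for x
    using mult_left_mono[OF K[of x], of "cmod c"] by (simp add: mult_ac)
  then show "bounded_linear (\<lambda>x. c *\<^sub>C f x)"
    by (intro bounded_linear_intro[where K = "cmod c * K"])
       (auto simp: add scaleC_add_right scaleR scaleR_scaleC scaleC_scaleC norm_scaleC mult.commute)
qed

instance ..

end

text \<open>On a Hilbert space, the description below has exactly one solution for every
  complex-homogeneous \<open>T\<close>, by the Riesz representation theorem.\<close>

definition cadjoint :: "('a::complex_inner \<Rightarrow>\<^sub>L 'b::complex_inner) \<Rightarrow> ('b \<Rightarrow>\<^sub>L 'a)" where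
  "cadjoint T = (THE S. \<forall>x y. cinner (blinfun_apply S x) y = cinner x (blinfun_apply T y))"

definition unitaries :: "('a::complex_inner \<Rightarrow>\<^sub>L 'a) set" where
  "unitaries = {U \<in> bounded_ops. surj (blinfun_apply U) \<and>
     (\<forall>x y. cinner (blinfun_apply U x) (blinfun_apply U y) = cinner x y)}"

definition unitary_group :: "('a::complex_inner \<Rightarrow>\<^sub>L 'a) monoid" where
  "unitary_group = \<lparr>carrier = unitaries, mult = (o\<^sub>L), one = id_blinfun\<rparr>"

text \<open>Limit of a sequence in the strong operator topology, where it exists.\<close>

definition sot_lim :: "(nat \<Rightarrow> ('a::real_normed_vector \<Rightarrow>\<^sub>L 'b::real_normed_vector)) \<Rightarrow> ('a \<Rightarrow>\<^sub>L 'b)" where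
  "sot_lim X = (THE L. \<forall>\<eta>. (\<lambda>k. blinfun_apply (X k) \<eta>) \<longlonglongrightarrow> blinfun_apply L \<eta>)"

definition orthonormal_basis :: "('n::finite \<Rightarrow> 'h::complex_inner) \<Rightarrow> bool" where
  "orthonormal_basis e \<longleftrightarrow>
     (\<forall>i j. cinner (e i) (e j) = (if i = j then 1 else 0)) \<and>
     (\<forall>\<xi>. \<exists>c. \<xi> = (\<Sum>i\<in>UNIV. c i *\<^sub>C e i))"

lemma unitary_group_is_group: "group (unitary_group :: ('a::complex_inner \<Rightarrow>\<^sub>L 'a) monoid)"
proof (rule groupI)
  fix U :: "'a \<Rightarrow>\<^sub>L 'a" assume "U \<in> carrier unitary_group"
  then have U: "\<And>c x. blinfun_apply U (c *\<^sub>C x) = c *\<^sub>C blinfun_apply U x" "surj (blinfun_apply U)"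
    "\<And>x y. cinner (blinfun_apply U x) (blinfun_apply U y) = cinner x y"
    by (auto simp: unitary_group_def unitaries_def bounded_ops_def)
  have nU: "norm (blinfun_apply U x) = norm x" for x
    using U(3)[of x x] by (simp add: norm_eq_sqrt_inner inner_eq_Re_cinner)
  have inj: "inj (blinfun_apply U)"
  proof (rule injI)
    fix x y assume "blinfun_apply U x = blinfun_apply U y"
    then have "norm (blinfun_apply U (x - y)) = 0" by (simp add: blinfun.diff_right)
    then show "x = y" by (simp add: nU)
  qed
  define V where "V = inv_into UNIV (blinfun_apply U)"
  have UV: "blinfun_apply U (V x) = x" and VU: "V (blinfun_apply U x) = x" for x
    using U(2) inj by (auto simp: V_def surj_f_inv_f)
  have bl: "bounded_linear V"
  proof (rule bounded_linear_intro[where K = 1])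
    show "V (x + y) = V x + V y" for x y
      by (metis UV VU blinfun.add_right)
    show "V (r *\<^sub>R x) = r *\<^sub>R V x" for r x
      by (metis UV VU blinfun.scaleR_right)
    show "norm (V x) \<le> norm x * 1" for x
      using nU[of "V x"] by (simp add: UV)
  qed
  have "Blinfun V \<in> carrier unitary_group"
  proof -
    have "V (c *\<^sub>C x) = c *\<^sub>C V x" for c x by (metis U(1) UV VU)
    moreover have "surj V" by (rule surjI[of V, OF VU])
    moreover have "cinner (V x) (V y) = cinner x y" for x y
      using U(3)[of "V x" "V y"] by (simp add: UV)
    ultimately show ?thesis
      by (simp add: unitary_group_def unitaries_def bounded_ops_def bounded_linear_Blinfun_apply bl)
  qed
  moreover have "Blinfun V \<otimes>\<^bsub>unitary_group\<^esub> U = \<one>\<^bsub>unitary_group\<^esub>"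
    by (rule blinfun_eqI) (simp add: unitary_group_def bl bounded_linear_Blinfun_apply VU)
  ultimately show "\<exists>W\<in>carrier unitary_group. W \<otimes>\<^bsub>unitary_group\<^esub> U = \<one>\<^bsub>unitary_group\<^esub>"
    by blast
next
  fix U V :: "'a \<Rightarrow>\<^sub>L 'a" assume "U \<in> carrier unitary_group" "V \<in> carrier unitary_group"
  moreover from this have "surj (\<lambda>x. blinfun_apply U (blinfun_apply V x))"
    using comp_surj[of "blinfun_apply V" "blinfun_apply U"]
    by (simp add: unitary_group_def unitaries_def comp_def)
  ultimately show "U \<otimes>\<^bsub>unitary_group\<^esub> V \<in> carrier unitary_group"
    by (simp add: unitary_group_def unitaries_def bounded_ops_def)
next
  show "\<one>\<^bsub>unitary_group\<^esub> \<in> carrier (unitary_group :: ('a \<Rightarrow>\<^sub>L 'a) monoid)"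
    by (simp add: unitary_group_def unitaries_def bounded_ops_def)
next
  fix U V W :: "'a \<Rightarrow>\<^sub>L 'a"
  show "U \<otimes>\<^bsub>unitary_group\<^esub> V \<otimes>\<^bsub>unitary_group\<^esub> W = U \<otimes>\<^bsub>unitary_group\<^esub> (V \<otimes>\<^bsub>unitary_group\<^esub> W)"
    by (rule blinfun_eqI) (simp add: unitary_group_def)
  show "\<one>\<^bsub>unitary_group\<^esub> \<otimes>\<^bsub>unitary_group\<^esub> U = U"
    by (rule blinfun_eqI) (simp add: unitary_group_def)
qed

section \<open>Square-summable families\<close>

typedef 'a ell2 = "{f :: 'a \<Rightarrow> complex. (\<lambda>x. (cmod (f x))\<^sup>2) summable_on UNIV}"
  by (rule exI[of _ "\<lambda>_. 0"]) simp

setup_lifting type_definition_ell2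

lemma square_summable_iff:
  "(\<lambda>x. (cmod (f x))\<^sup>2) summable_on UNIV \<longleftrightarrow> (\<exists>B. \<forall>F. finite F \<longrightarrow> (\<Sum>x\<in>F. (cmod (f x))\<^sup>2) \<le> B)"
proof -
  have "(\<lambda>x. norm ((cmod (f x))\<^sup>2)) summable_on UNIV \<longleftrightarrow>
    (\<exists>B. \<forall>F. finite F \<longrightarrow> (\<Sum>x\<in>F. norm ((cmod (f x))\<^sup>2)) \<le> B)"
    by (subst abs_summable_iff_bdd_above) (auto simp: bdd_above_def)
  then show ?thesis by simp
qed

lemma square_summable_add:
  assumes "(\<lambda>x. (cmod (f x))\<^sup>2) summable_on UNIV" "(\<lambda>x. (cmod (g x))\<^sup>2) summable_on UNIV"
  shows "(\<lambda>x. (cmod (f x + g x))\<^sup>2) summable_on UNIV"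
proof (rule summable_on_comparison_test)
  show "(\<lambda>x. 2 * (cmod (f x))\<^sup>2 + 2 * (cmod (g x))\<^sup>2) summable_on UNIV"
    by (intro summable_on_add summable_on_cmult_right assms)
  fix x
  have "(cmod (f x + g x))\<^sup>2 \<le> (cmod (f x) + cmod (g x))\<^sup>2"
    by (intro power_mono norm_triangle_ineq) auto
  also have "\<dots> \<le> 2 * (cmod (f x))\<^sup>2 + 2 * (cmod (g x))\<^sup>2"
    using sum_squares_bound[of "cmod (f x)" "cmod (g x)"] by (simp add: power2_sum)
  finally show "(cmod (f x + g x))\<^sup>2 \<le> 2 * (cmod (f x))\<^sup>2 + 2 * (cmod (g x))\<^sup>2" .
qed auto

lemma square_summable_mult:
  assumes "(\<lambda>x. (cmod (f x))\<^sup>2) summable_on UNIV"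
  shows "(\<lambda>x. (cmod (c * f x))\<^sup>2) summable_on UNIV"
  using assms by (auto simp: norm_mult power_mult_distrib intro: summable_on_cmult_right)

lemma cinner_summable:
  assumes "(\<lambda>x. (cmod (f x))\<^sup>2) summable_on UNIV" "(\<lambda>x. (cmod (g x))\<^sup>2) summable_on UNIV"
  shows "(\<lambda>x. cnj (f x) * g x) summable_on UNIV"
  by (rule abs_summable_summable, rule abs_summable_product)
     (use assms in \<open>auto simp: norm_mult power2_eq_square\<close>)

instantiation ell2 :: (type) complex_inner
begin

lift_definition zero_ell2 :: "'a ell2" is "\<lambda>_. 0" by simp
lift_definition plus_ell2 :: "'a ell2 \<Rightarrow> 'a ell2 \<Rightarrow> 'a ell2" is "\<lambda>f g x. f x + g x"
  by (rule square_summable_add)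
lift_definition uminus_ell2 :: "'a ell2 \<Rightarrow> 'a ell2" is "\<lambda>f x. - f x" by simp
lift_definition minus_ell2 :: "'a ell2 \<Rightarrow> 'a ell2 \<Rightarrow> 'a ell2" is "\<lambda>f g x. f x - g x"
  using square_summable_add[of _ "\<lambda>x. - _ x"] by simp
lift_definition scaleC_ell2 :: "complex \<Rightarrow> 'a ell2 \<Rightarrow> 'a ell2" is "\<lambda>c f x. c * f x"
  by (rule square_summable_mult)
lift_definition cinner_ell2 :: "'a ell2 \<Rightarrow> 'a ell2 \<Rightarrow> complex"
  is "\<lambda>f g. \<Sum>\<^sub>\<infinity>x. cnj (f x) * g x" .

definition "scaleR r (x::'a ell2) = complex_of_real r *\<^sub>C x"
definition "inner x (y::'a ell2) = Re (cinner x y)"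
definition "norm (x::'a ell2) = sqrt (inner x x)"
definition "dist x (y::'a ell2) = norm (x - y)"
definition "sgn (x::'a ell2) = scaleR (inverse (norm x)) x"
definition "(uniformity :: ('a ell2 \<times> 'a ell2) filter) = (INF e\<in>{0<..}. principal {(x, y). dist x y < e})"
definition "open (U :: 'a ell2 set) \<longleftrightarrow> (\<forall>x\<in>U. eventually (\<lambda>(x', y). x' = x \<longrightarrow> y \<in> U) uniformity)"

instance
proof
  fix x y z :: "'a ell2" and c d :: complex and r s :: real
  show c1: "c *\<^sub>C (x + y) = c *\<^sub>C x + c *\<^sub>C y" for c and x y :: "'a ell2" by transfer (simp add: algebra_simps)
  show c2: "(c + d) *\<^sub>C x = c *\<^sub>C x + d *\<^sub>C x" for c d and x :: "'a ell2" by transfer (simp add: algebra_simps)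
  show c3: "c *\<^sub>C d *\<^sub>C x = (c * d) *\<^sub>C x" for c d and x :: "'a ell2" by transfer (simp add: algebra_simps)
  show "r *\<^sub>R x = complex_of_real r *\<^sub>C x" by (simp add: scaleR_ell2_def)
  show "r *\<^sub>R (x + y) = r *\<^sub>R x + r *\<^sub>R y" by (simp add: scaleR_ell2_def c1)
  show "(r + s) *\<^sub>R x = r *\<^sub>R x + s *\<^sub>R x" by (simp add: scaleR_ell2_def c2)
  show "r *\<^sub>R s *\<^sub>R x = (r * s) *\<^sub>R x" by (simp add: scaleR_ell2_def c3)
  show "1 *\<^sub>R x = x" unfolding scaleR_ell2_def by transfer simp
  show "x + y + z = x + (y + z)" by transfer (simp add: algebra_simps)
  show "x + y = y + x" by transfer (simp add: algebra_simps)
  show "0 + x = x" by transfer simp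
  show "- x + x = 0" by transfer simp
  show "x - y = x + - y" by transfer simp
  show i: "inner x y = Re (cinner x y)" by (simp add: inner_ell2_def)
  show com: "cinner x y = cnj (cinner y x)" for x y :: "'a ell2"
    unfolding cinner_ell2.rep_eq infsum_cnj[symmetric] by (simp add: mult.commute)
  show a: "cinner x (y + z) = cinner x y + cinner x z" for x y z :: "'a ell2"
    by transfer (simp add: distrib_left infsum_add cinner_summable)
  show s: "cinner x (c *\<^sub>C y) = c * cinner x y" for c and x y :: "'a ell2"
    by transfer (simp add: infsum_cmult_right'[symmetric] mult_ac)
  show ic: "inner x y = inner y x" for x y :: "'a ell2"
    by (simp add: inner_ell2_def com[of x y])
  show "inner (x + y) z = inner x z + inner y z"
    unfolding ic[of _ z] by (simp add: inner_ell2_def a)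
  show "inner (r *\<^sub>R x) y = r * inner x y"
    unfolding ic[of _ y] by (simp add: inner_ell2_def scaleR_ell2_def s)
  have sq: "inner x x = (\<Sum>\<^sub>\<infinity>i. (cmod (Rep_ell2 x i))\<^sup>2)"
  proof -
    have "cinner x x = (\<Sum>\<^sub>\<infinity>i. complex_of_real ((cmod (Rep_ell2 x i))\<^sup>2))"
      unfolding cinner_ell2.rep_eq
      by (intro infsum_cong) (simp add: complex_norm_square mult.commute del: of_real_power)
    moreover have "((\<lambda>i. complex_of_real ((cmod (Rep_ell2 x i))\<^sup>2)) has_sum
        complex_of_real (\<Sum>\<^sub>\<infinity>i. (cmod (Rep_ell2 x i))\<^sup>2)) UNIV"
      using Rep_ell2[of x] by (intro has_sum_of_real has_sum_infsum) simp
    ultimately show ?thesis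
      by (simp add: inner_ell2_def infsumI del: of_real_power)
  qed
  show "0 \<le> inner x x" unfolding sq by (rule infsum_nonneg) simp
  show "inner x x = 0 \<longleftrightarrow> x = 0"
  proof
    assume "inner x x = 0"
    then have "(cmod (Rep_ell2 x i))\<^sup>2 = 0" for i
      using nonneg_infsum_le_0D[of "\<lambda>i. (cmod (Rep_ell2 x i))\<^sup>2" UNIV i] Rep_ell2[of x]
      unfolding sq by simp
    then show "x = 0" by (simp add: Rep_ell2_inject[symmetric] zero_ell2.rep_eq fun_eq_iff)
  next
    assume "x = 0" then show "inner x x = 0" unfolding sq by (simp add: zero_ell2.rep_eq)
  qed
  show "norm x = sqrt (inner x x)" by (rule norm_ell2_def)
  show "dist x y = norm (x - y)" by (rule dist_ell2_def)
  show "sgn x = inverse (norm x) *\<^sub>R x" by (rule sgn_ell2_def)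
  show "(uniformity :: ('a ell2 \<times> 'a ell2) filter) = (INF e\<in>{0<..}. principal {(x, y). dist x y < e})"
    by (rule uniformity_ell2_def)
  show "open U \<longleftrightarrow> (\<forall>x\<in>U. eventually (\<lambda>(x', y). x' = x \<longrightarrow> y \<in> U) uniformity)" for U :: "'a ell2 set"
    by (rule open_ell2_def)
qed

end

lemma norm_ell2_squared: "(norm x)\<^sup>2 = (\<Sum>\<^sub>\<infinity>i. (cmod (Rep_ell2 x i))\<^sup>2)"
proof -
  have "cinner x x = (\<Sum>\<^sub>\<infinity>i. complex_of_real ((cmod (Rep_ell2 x i))\<^sup>2))"
    unfolding cinner_ell2.rep_eq
    by (intro infsum_cong) (simp add: complex_norm_square mult.commute del: of_real_power)
  also have "((\<lambda>i. complex_of_real ((cmod (Rep_ell2 x i))\<^sup>2)) has_sum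
      complex_of_real (\<Sum>\<^sub>\<infinity>i. (cmod (Rep_ell2 x i))\<^sup>2)) UNIV"
    using Rep_ell2[of x] by (intro has_sum_of_real has_sum_infsum) simp
  then have "(\<Sum>\<^sub>\<infinity>i. complex_of_real ((cmod (Rep_ell2 x i))\<^sup>2)) =
      complex_of_real (\<Sum>\<^sub>\<infinity>i. (cmod (Rep_ell2 x i))\<^sup>2)"
    by (rule infsumI)
  finally show ?thesis unfolding cinner_self by (simp only: of_real_eq_iff)
qed

lemma sum_le_norm_ell2_squared:
  "finite F \<Longrightarrow> (\<Sum>i\<in>F. (cmod (Rep_ell2 x i))\<^sup>2) \<le> (norm x)\<^sup>2"
  unfolding norm_ell2_squared using Rep_ell2[of x] by (intro finite_sum_le_infsum) auto

lemma norm_ell2_leI: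
  assumes "\<And>F. finite F \<Longrightarrow> (\<Sum>i\<in>F. (cmod (Rep_ell2 x i))\<^sup>2) \<le> B\<^sup>2" "0 \<le> B"
  shows "norm x \<le> B"
proof (rule power2_le_imp_le)
  show "(norm x)\<^sup>2 \<le> B\<^sup>2"
    unfolding norm_ell2_squared using assms Rep_ell2[of x] by (intro infsum_le_finite_sums) auto
qed fact

lemma cmod_Rep_ell2_le: "cmod (Rep_ell2 x i) \<le> norm x"
  by (rule power2_le_imp_le) (use sum_le_norm_ell2_squared[of "{i}" x] in simp_all)

instance ell2 :: (type) complex_hilbert
proof
  fix X :: "nat \<Rightarrow> 'a ell2" assume X: "Cauchy X"
  have "Cauchy (\<lambda>n. Rep_ell2 (X n) i)" for i
  proof (rule metric_CauchyI)
    fix d :: real assume "0 < d"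
    obtain M where M: "\<And>m n. m \<ge> M \<Longrightarrow> n \<ge> M \<Longrightarrow> dist (X m) (X n) < d"
      using metric_CauchyD[OF X \<open>0 < d\<close>] by blast
    show "\<exists>M. \<forall>m\<ge>M. \<forall>n\<ge>M. dist (Rep_ell2 (X m) i) (Rep_ell2 (X n) i) < d"
    proof (intro exI[of _ M] allI impI)
      fix m n assume "M \<le> m" "M \<le> n"
      then show "dist (Rep_ell2 (X m) i) (Rep_ell2 (X n) i) < d"
        using M[of m n] cmod_Rep_ell2_le[of "X m - X n" i]
        by (simp add: dist_norm minus_ell2.rep_eq)
    qed
  qed
  then obtain f where f: "\<And>i. (\<lambda>n. Rep_ell2 (X n) i) \<longlonglongrightarrow> f i"
    unfolding Cauchy_convergent_iff convergent_def by metis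
  have key: "\<exists>M. \<forall>n\<ge>M. \<forall>F. finite F \<longrightarrow> (\<Sum>i\<in>F. (cmod (f i - Rep_ell2 (X n) i))\<^sup>2) \<le> d\<^sup>2"
    if "0 < d" for d
  proof -
    obtain M where M: "\<And>m n. m \<ge> M \<Longrightarrow> n \<ge> M \<Longrightarrow> dist (X m) (X n) < d"
      using metric_CauchyD[OF X \<open>0 < d\<close>] by blast
    show ?thesis
    proof (intro exI[of _ M] allI impI)
      fix n and F :: "'a set" assume n: "M \<le> n" and F: "finite F"
      have "(\<lambda>m. \<Sum>i\<in>F. (cmod (Rep_ell2 (X m) i - Rep_ell2 (X n) i))\<^sup>2)
          \<longlonglongrightarrow> (\<Sum>i\<in>F. (cmod (f i - Rep_ell2 (X n) i))\<^sup>2)"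
        by (intro tendsto_intros f)
      moreover have "\<forall>\<^sub>F m in sequentially.
          (\<Sum>i\<in>F. (cmod (Rep_ell2 (X m) i - Rep_ell2 (X n) i))\<^sup>2) \<le> d\<^sup>2"
        using eventually_ge_at_top[of M]
      proof eventually_elim
        fix m assume "M \<le> m"
        then have "(norm (X m - X n))\<^sup>2 \<le> d\<^sup>2"
          using M[of m n] n by (intro power_mono) (auto simp: dist_norm)
        then show "(\<Sum>i\<in>F. (cmod (Rep_ell2 (X m) i - Rep_ell2 (X n) i))\<^sup>2) \<le> d\<^sup>2"
          using sum_le_norm_ell2_squared[OF F, of "X m - X n"] by (simp add: minus_ell2.rep_eq)
      qed
      ultimately show "(\<Sum>i\<in>F. (cmod (f i - Rep_ell2 (X n) i))\<^sup>2) \<le> d\<^sup>2"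
        by (rule tendsto_upperbound) simp
    qed
  qed
  from key[of 1] obtain M
    where "\<forall>F. finite F \<longrightarrow> (\<Sum>i\<in>F. (cmod (f i - Rep_ell2 (X M) i))\<^sup>2) \<le> 1\<^sup>2" by auto
  then have "(\<lambda>i. (cmod (f i - Rep_ell2 (X M) i))\<^sup>2) summable_on UNIV"
    by (subst square_summable_iff) blast
  from square_summable_add[OF this, of "Rep_ell2 (X M)"]
  have "(\<lambda>i. (cmod (f i))\<^sup>2) summable_on UNIV" using Rep_ell2[of "X M"] by simp
  then have Rep: "Rep_ell2 (Abs_ell2 f) = f" by (simp add: Abs_ell2_inverse)
  have "X \<longlonglongrightarrow> Abs_ell2 f"
  proof (rule metric_LIMSEQ_I)
    fix r :: real assume "0 < r"
    with key[of "r/2"] obtain M where M: "\<And>n F. n \<ge> M \<Longrightarrow> finite F \<Longrightarrow>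
        (\<Sum>i\<in>F. (cmod (f i - Rep_ell2 (X n) i))\<^sup>2) \<le> (r/2)\<^sup>2" by auto
    have "dist (X n) (Abs_ell2 f) < r" if "n \<ge> M" for n
    proof -
      have "norm (Abs_ell2 f - X n) \<le> r/2"
        using M[OF that] \<open>0 < r\<close> by (intro norm_ell2_leI) (auto simp: minus_ell2.rep_eq Rep)
      then show ?thesis using \<open>0 < r\<close> by (simp add: dist_norm norm_minus_commute)
    qed
    then show "\<exists>M. \<forall>n\<ge>M. dist (X n) (Abs_ell2 f) < r" by blast
  qed
  then show "convergent X" by (auto simp: convergent_def)
qed

lift_definition ell2_unit :: "'a \<Rightarrow> 'a ell2" is "\<lambda>a x. if x = a then 1 else 0"
proof -
  fix a :: 'a
  show "(\<lambda>x. (cmod (if x = a then 1 else 0))\<^sup>2) summable_on UNIV"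
    by (subst summable_on_cong_neutral[where T = "{a}" and g = "\<lambda>_. 1"]) auto
qed

lemma Rep_ell2_sum: "Rep_ell2 (\<Sum>i\<in>F. f i) a = (\<Sum>i\<in>F. Rep_ell2 (f i) a)"
  by (induction F rule: infinite_finite_induct) (auto simp: zero_ell2.rep_eq plus_ell2.rep_eq)

lemma ell2_approx:
  assumes "0 < d"
  shows "\<exists>F. finite F \<and> norm (x - (\<Sum>a\<in>F. Rep_ell2 x a *\<^sub>C ell2_unit a)) \<le> d"
proof -
  let ?g = "\<lambda>i. (cmod (Rep_ell2 x i))\<^sup>2"
  have "\<exists>F. finite F \<and> sum ?g F > (norm x)\<^sup>2 - d\<^sup>2"
  proof (rule ccontr)
    assume "\<not> ?thesis"
    then have "infsum ?g UNIV \<le> (norm x)\<^sup>2 - d\<^sup>2"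
      using Rep_ell2[of x] by (intro infsum_le_finite_sums) (auto simp: not_less)
    then show False using assms by (simp add: norm_ell2_squared)
  qed
  then obtain F where F: "finite F" "sum ?g F > (norm x)\<^sup>2 - d\<^sup>2" by blast
  let ?y = "x - (\<Sum>a\<in>F. Rep_ell2 x a *\<^sub>C ell2_unit a)"
  have y: "Rep_ell2 ?y i = (if i \<in> F then 0 else Rep_ell2 x i)" for i
    using F(1) by (simp add: minus_ell2.rep_eq Rep_ell2_sum scaleC_ell2.rep_eq ell2_unit.rep_eq
        if_distrib cong: if_cong)
  have "norm ?y \<le> d"
  proof (rule norm_ell2_leI)
    fix G :: "'a set" assume G: "finite G"
    have "(\<Sum>i\<in>G. (cmod (Rep_ell2 ?y i))\<^sup>2) = sum ?g (G - F)"
      unfolding y using G by (intro sum.mono_neutral_cong_right) auto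
    also have "\<dots> = sum ?g (G \<union> F) - sum ?g F"
      using G F(1) by (subst sum_diff[symmetric]) (auto intro: sum.cong)
    also have "\<dots> \<le> d\<^sup>2"
      using sum_le_norm_ell2_squared[of "G \<union> F" x] G F by simp
    finally show "(\<Sum>i\<in>G. (cmod (Rep_ell2 ?y i))\<^sup>2) \<le> d\<^sup>2" .
  qed (use assms in simp)
  with F(1) show ?thesis by blast
qed

lemma bounded_ops_eq_on_units:
  assumes T: "T \<in> bounded_ops" "T' \<in> bounded_ops"
    and eq: "\<And>a. blinfun_apply T (ell2_unit a) = blinfun_apply T' (ell2_unit a)"
  shows "T = T'"
proof (rule blinfun_eqI)
  fix x
  let ?D = "T - T'"
  have "norm (blinfun_apply ?D x) \<le> 0 + d" if "0 < d" for d
  proof -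
    obtain F where F: "norm (x - (\<Sum>a\<in>F. Rep_ell2 x a *\<^sub>C ell2_unit a)) \<le> d / (norm ?D + 1)"
      using ell2_approx[of "d / (norm ?D + 1)" x] \<open>0 < d\<close> by (auto simp: add_nonneg_pos)
    have "blinfun_apply ?D (\<Sum>a\<in>F. Rep_ell2 x a *\<^sub>C ell2_unit a) = 0"
      using T eq by (simp add: blinfun.sum_right blinfun.diff_left bounded_ops_def)
    then have "blinfun_apply ?D x = blinfun_apply ?D (x - (\<Sum>a\<in>F. Rep_ell2 x a *\<^sub>C ell2_unit a))"
      by (simp add: blinfun.diff_right)
    also have "norm \<dots> \<le> norm ?D * (d / (norm ?D + 1))"
      using F by (intro order_trans[OF norm_blinfun] mult_left_mono) auto
    also have "\<dots> \<le> d"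
      using \<open>0 < d\<close> by (simp add: divide_simps add_nonneg_pos mult_right_mono)
    finally show ?thesis by simp
  qed
  then have "norm (blinfun_apply ?D x) \<le> 0" by (rule field_le_epsilon)
  then show "blinfun_apply T x = blinfun_apply T' x" by (simp add: blinfun.diff_left)
qed

section \<open>Full Fock space\<close>

text \<open>For an orthonormal basis \<open>e\<close> of \<open>H\<close>, the simple tensors \<open>e i\<^sub>1 \<otimes> \<dots> \<otimes> e i\<^sub>k\<close>, \<open>k \<ge> 0\<close>, form an
  orthonormal basis of the full Fock space, indexed by the words \<open>[i\<^sub>1, \<dots>, i\<^sub>k]\<close>; the empty word
  is the vacuum. The full Fock space is represented by the coordinates in this basis. Lemma
  \<open>cinner_tensor\<close> is the defining inner product formula for tensor powers.\<close>

type_synonym 'n fock = "'n list ell2"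

abbreviation vacuum :: "'n fock" where
  "vacuum \<equiv> ell2_unit []"

lemma finite_words: "finite {w :: 'n::finite list. length w = k}"
  using finite_lists_length_eq[of "UNIV :: 'n set" k] by simp

lift_definition tensor :: "('n::finite \<Rightarrow> 'h::complex_inner) \<Rightarrow> 'h list \<Rightarrow> 'n fock" is
  "\<lambda>e \<xi>s w. if length w = length \<xi>s then prod_list (map2 (\<lambda>i. cinner (e i)) w \<xi>s) else 0"
proof -
  fix e :: "'n \<Rightarrow> 'h" and \<xi>s
  have "(\<lambda>w. (cmod (if length w = length \<xi>s then prod_list (map2 (\<lambda>i. cinner (e i)) w \<xi>s) else 0))\<^sup>2)
      summable_on {w. length w = length \<xi>s}"
    by (intro summable_on_finite finite_words)
  then show "(\<lambda>w. (cmod (if length w = length \<xi>s then prod_list (map2 (\<lambda>i. cinner (e i)) w \<xi>s) else 0))\<^sup>2)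
      summable_on UNIV"
    by (rule summable_on_cong_neutral[THEN iffD1, rotated -1]) auto
qed

lemma tensor_Nil: "tensor e [] = vacuum"
  by transfer auto

lemma tensor_basis:
  assumes "orthonormal_basis e"
  shows "tensor e (map e w) = ell2_unit w"
proof -
  have "length v = length w \<Longrightarrow>
      prod_list (map2 (\<lambda>i. cinner (e i)) v (map e w)) = (if v = w then 1 else 0)" for v
    by (induction v w rule: list_induct2) (use assms in \<open>auto simp: orthonormal_basis_def\<close>)
  then have "Rep_ell2 (tensor e (map e w)) v = (if v = w then 1 else 0)" for v
    by (auto simp: tensor.rep_eq)
  then show ?thesis by (simp add: Rep_ell2_inject[symmetric] ell2_unit.rep_eq fun_eq_iff)
qed

lemma parseval:
  assumes "orthonormal_basis (e :: 'n::finite \<Rightarrow> 'h::complex_inner)"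
  shows "cinner \<xi> \<eta> = (\<Sum>i\<in>UNIV. cnj (cinner (e i) \<xi>) * cinner (e i) \<eta>)"
proof -
  obtain c where c: "\<eta> = (\<Sum>i\<in>UNIV. c i *\<^sub>C e i)" using assms unfolding orthonormal_basis_def by blast
  have "cinner (e i) (\<Sum>j\<in>UNIV. c j *\<^sub>C e j) = (\<Sum>j\<in>UNIV. if j = i then c i else 0)" for i
    unfolding cinner_sum_right cinner_scaleC_right
    by (rule sum.cong) (use assms in \<open>auto simp: orthonormal_basis_def\<close>)
  then have ci: "cinner (e i) \<eta> = c i" for i by (simp add: c)
  have "cinner \<xi> \<eta> = (\<Sum>i\<in>UNIV. c i * cinner \<xi> (e i))"
    by (simp add: c cinner_sum_right cinner_scaleC_right)
  also have "\<dots> = (\<Sum>i\<in>UNIV. cnj (cinner (e i) \<xi>) * cinner (e i) \<eta>)"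
    by (rule sum.cong) (simp_all add: ci cinner_commute[of \<xi>] mult.commute)
  finally show ?thesis .
qed

lemma cinner_tensor:
  assumes e: "orthonormal_basis (e :: 'n::finite \<Rightarrow> 'h::complex_inner)"
  shows "cinner (tensor e \<xi>s) (tensor e \<eta>s) =
    (if length \<xi>s = length \<eta>s then prod_list (map2 cinner \<xi>s \<eta>s) else 0)"
proof -
  let ?p = "\<lambda>w \<xi>s. prod_list (map2 (\<lambda>i. cinner (e i)) w \<xi>s)"
  have "cinner (tensor e \<xi>s) (tensor e \<eta>s) =
      (\<Sum>\<^sub>\<infinity>w\<in>{w. length w = length \<xi>s}. cnj (Rep_ell2 (tensor e \<xi>s) w) * Rep_ell2 (tensor e \<eta>s) w)"
    unfolding cinner_ell2.rep_eq by (intro infsum_cong_neutral) (auto simp: tensor.rep_eq)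
  also have "\<dots> = (\<Sum>w | length w = length \<xi>s. cnj (Rep_ell2 (tensor e \<xi>s) w) * Rep_ell2 (tensor e \<eta>s) w)"
    by (rule infsum_finite) (rule finite_words)
  also have "\<dots> = (if length \<xi>s = length \<eta>s then
      (\<Sum>w | length w = length \<xi>s. cnj (?p w \<xi>s) * ?p w \<eta>s) else 0)"
    by (auto simp: tensor.rep_eq intro!: sum.cong sum.neutral)
  finally have *: "cinner (tensor e \<xi>s) (tensor e \<eta>s) = (if length \<xi>s = length \<eta>s then
      (\<Sum>w | length w = length \<xi>s. cnj (?p w \<xi>s) * ?p w \<eta>s) else 0)" .
  have "length \<xi>s = length \<eta>s \<Longrightarrow>
      (\<Sum>w | length w = length \<xi>s. cnj (?p w \<xi>s) * ?p w \<eta>s) = prod_list (map2 cinner \<xi>s \<eta>s)"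
  proof (induction \<xi>s \<eta>s rule: list_induct2)
    case (Cons \<xi> \<xi>s \<eta> \<eta>s)
    let ?W = "{w :: 'n list. length w = length \<xi>s}"
    have W: "{w :: 'n list. length w = length (\<xi> # \<xi>s)} = (\<lambda>(i, w). i # w) ` (UNIV \<times> ?W)"
      by (auto simp: length_Suc_conv image_iff)
    have "(\<Sum>w | length w = length (\<xi> # \<xi>s). cnj (?p w (\<xi> # \<xi>s)) * ?p w (\<eta> # \<eta>s)) =
        (\<Sum>(i, w)\<in>UNIV \<times> ?W. (cnj (cinner (e i) \<xi>) * cinner (e i) \<eta>) * (cnj (?p w \<xi>s) * ?p w \<eta>s))"
      unfolding W by (subst sum.reindex) (auto simp: inj_on_def mult_ac intro!: sum.cong)
    also have "\<dots> = (\<Sum>i\<in>UNIV. cnj (cinner (e i) \<xi>) * cinner (e i) \<eta>) *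
        (\<Sum>w\<in>?W. cnj (?p w \<xi>s) * ?p w \<eta>s)"
      by (simp add: sum.cartesian_product[symmetric] sum_product)
    also have "\<dots> = cinner \<xi> \<eta> * prod_list (map2 cinner \<xi>s \<eta>s)"
      by (simp only: Cons.IH parseval[OF e, of \<xi> \<eta>])
    finally show ?case by simp
  qed simp
  with * show ?thesis by simp
qed

lemma bounded_ops_eq_on_tensors:
  assumes "orthonormal_basis (e :: 'n::finite \<Rightarrow> 'h::complex_inner)"
    and "T \<in> bounded_ops" "T' \<in> bounded_ops"
    and "\<And>\<xi>s. blinfun_apply T (tensor e \<xi>s) = blinfun_apply T' (tensor e \<xi>s)"
  shows "T = T'"
  using assms(2,3) by (rule bounded_ops_eq_on_units) (metis assms(1,4) tensor_basis)

subsection \<open>Creation operators\<close>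

lemma creation_bound:
  fixes a :: "'n::finite \<Rightarrow> complex" and f :: "'n list \<Rightarrow> complex"
  assumes "finite F" "inj_on (\<lambda>w. (h w, k w)) F"
  shows "(\<Sum>w\<in>F. (cmod (a (h w) * f (k w)))\<^sup>2) \<le> (\<Sum>i\<in>UNIV. (cmod (a i))\<^sup>2) * (\<Sum>v\<in>k ` F. (cmod (f v))\<^sup>2)"
proof -
  have "(\<Sum>w\<in>F. (cmod (a (h w) * f (k w)))\<^sup>2) =
      (\<Sum>(i, v)\<in>(\<lambda>w. (h w, k w)) ` F. (cmod (a i))\<^sup>2 * (cmod (f v))\<^sup>2)"
    using assms(2) by (subst sum.reindex) (auto simp: norm_mult power_mult_distrib)
  also have "\<dots> \<le> (\<Sum>(i, v)\<in>UNIV \<times> k ` F. (cmod (a i))\<^sup>2 * (cmod (f v))\<^sup>2)"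
    using assms(1) by (intro sum_mono2) auto
  also have "\<dots> = (\<Sum>i\<in>UNIV. (cmod (a i))\<^sup>2) * (\<Sum>v\<in>k ` F. (cmod (f v))\<^sup>2)"
    by (simp add: sum.cartesian_product[symmetric] sum_product)
  finally show ?thesis .
qed

lemma creation_bound':
  fixes a :: "'n::finite \<Rightarrow> complex" and x :: "'n fock"
  assumes "finite F" "inj_on (\<lambda>w. (h w, k w)) (- {[]})"
  shows "(\<Sum>w\<in>F. (cmod (if w = [] then 0 else a (h w) * Rep_ell2 x (k w)))\<^sup>2) \<le>
    (\<Sum>i\<in>UNIV. (cmod (a i))\<^sup>2) * (norm x)\<^sup>2"
proof -
  have "(\<Sum>w\<in>F. (cmod (if w = [] then 0 else a (h w) * Rep_ell2 x (k w)))\<^sup>2) =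
      (\<Sum>w\<in>F - {[]}. (cmod (a (h w) * Rep_ell2 x (k w)))\<^sup>2)"
    using assms(1) by (intro sum.mono_neutral_cong_right) auto
  also have "\<dots> \<le> (\<Sum>i\<in>UNIV. (cmod (a i))\<^sup>2) * (\<Sum>v\<in>k ` (F - {[]}). (cmod (Rep_ell2 x v))\<^sup>2)"
    using assms by (intro creation_bound) (auto elim: inj_on_subset)
  also have "\<dots> \<le> (\<Sum>i\<in>UNIV. (cmod (a i))\<^sup>2) * (norm x)\<^sup>2"
    using assms(1) by (intro mult_left_mono sum_le_norm_ell2_squared sum_nonneg) auto
  finally show ?thesis .
qed

lemma inj_hd_tl: "inj_on (\<lambda>w. (hd w, tl w)) (- {[]})"
  by (auto simp: inj_on_def) (metis list.collapse)

lemma inj_last_butlast: "inj_on (\<lambda>w. (last w, butlast w)) (- {[]})"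
  by (auto simp: inj_on_def) (metis append_butlast_last_id)

lift_definition left_creation_ell2 ::
  "('n::finite \<Rightarrow> 'h::complex_inner) \<Rightarrow> 'h \<Rightarrow> 'n fock \<Rightarrow> 'n fock" is
  "\<lambda>e \<xi> f w. if w = [] then 0 else cinner (e (hd w)) \<xi> * f (tl w)"
proof -
  fix e :: "'n \<Rightarrow> 'h" and \<xi> and f :: "'n list \<Rightarrow> complex"
  assume "(\<lambda>w. (cmod (f w))\<^sup>2) summable_on UNIV"
  then have "Rep_ell2 (Abs_ell2 f) = f" by (simp add: Abs_ell2_inverse)
  note R = this
  have "(\<Sum>w\<in>F. (cmod (if w = [] then 0 else cinner (e (hd w)) \<xi> * f (tl w)))\<^sup>2)
      \<le> (\<Sum>i\<in>UNIV. (cmod (cinner (e i) \<xi>))\<^sup>2) * (norm (Abs_ell2 f))\<^sup>2" if "finite F" for F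
    using creation_bound'[OF that inj_hd_tl, of "\<lambda>i. cinner (e i) \<xi>" "Abs_ell2 f"]
    unfolding R .
  then show "(\<lambda>w. (cmod (if w = [] then 0 else cinner (e (hd w)) \<xi> * f (tl w)))\<^sup>2) summable_on UNIV"
    unfolding square_summable_iff by blast
qed

lift_definition right_creation_ell2 ::
  "('n::finite \<Rightarrow> 'h::complex_inner) \<Rightarrow> 'h \<Rightarrow> 'n fock \<Rightarrow> 'n fock" is
  "\<lambda>e \<xi> f w. if w = [] then 0 else cinner (e (last w)) \<xi> * f (butlast w)"
proof -
  fix e :: "'n \<Rightarrow> 'h" and \<xi> and f :: "'n list \<Rightarrow> complex"
  assume "(\<lambda>w. (cmod (f w))\<^sup>2) summable_on UNIV"
  then have "Rep_ell2 (Abs_ell2 f) = f" by (simp add: Abs_ell2_inverse)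
  note R = this
  have "(\<Sum>w\<in>F. (cmod (if w = [] then 0 else cinner (e (last w)) \<xi> * f (butlast w)))\<^sup>2)
      \<le> (\<Sum>i\<in>UNIV. (cmod (cinner (e i) \<xi>))\<^sup>2) * (norm (Abs_ell2 f))\<^sup>2" if "finite F" for F
    using creation_bound'[OF that inj_last_butlast, of "\<lambda>i. cinner (e i) \<xi>" "Abs_ell2 f"]
    unfolding R .
  then show "(\<lambda>w. (cmod (if w = [] then 0 else cinner (e (last w)) \<xi> * f (butlast w)))\<^sup>2) summable_on UNIV"
    unfolding square_summable_iff by blast
qed

definition left_creation :: "('n::finite \<Rightarrow> 'h::complex_inner) \<Rightarrow> 'h \<Rightarrow> 'n fock \<Rightarrow>\<^sub>L 'n fock" where
  "left_creation e \<xi> = Blinfun (left_creation_ell2 e \<xi>)"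

definition right_creation :: "('n::finite \<Rightarrow> 'h::complex_inner) \<Rightarrow> 'h \<Rightarrow> 'n fock \<Rightarrow>\<^sub>L 'n fock" where
  "right_creation e \<xi> = Blinfun (right_creation_ell2 e \<xi>)"

text \<open>Lemmas \<open>left_creation_tensor\<close> and \<open>right_creation_tensor\<close> below identify these operators with
  \<open>\<eta> \<mapsto> \<xi> \<otimes> \<eta>\<close> and \<open>\<eta> \<mapsto> \<eta> \<otimes> \<xi>\<close>.\<close>

lemma left_creation_apply: "blinfun_apply (left_creation e \<xi>) = left_creation_ell2 e \<xi>"
  unfolding left_creation_def
proof (intro bounded_linear_Blinfun_apply bounded_linear_intro)
  show "left_creation_ell2 e \<xi> (x + y) = left_creation_ell2 e \<xi> x + left_creation_ell2 e \<xi> y" for x y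
    by transfer (auto simp: algebra_simps)
  show "left_creation_ell2 e \<xi> (r *\<^sub>R x) = r *\<^sub>R left_creation_ell2 e \<xi> x" for r x
    unfolding scaleR_scaleC by transfer (auto simp: algebra_simps)
  show "norm (left_creation_ell2 e \<xi> x) \<le> norm x * sqrt (\<Sum>i\<in>UNIV. (cmod (cinner (e i) \<xi>))\<^sup>2)" for x
    using creation_bound'[OF _ inj_hd_tl, of _ "\<lambda>i. cinner (e i) \<xi>" x]
    by (intro norm_ell2_leI)
       (auto simp: left_creation_ell2.rep_eq power_mult_distrib sum_nonneg mult.commute)
qed

lemma right_creation_apply: "blinfun_apply (right_creation e \<xi>) = right_creation_ell2 e \<xi>"
  unfolding right_creation_def
proof (intro bounded_linear_Blinfun_apply bounded_linear_intro)
  show "right_creation_ell2 e \<xi> (x + y) = right_creation_ell2 e \<xi> x + right_creation_ell2 e \<xi> y" for x y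
    by transfer (auto simp: algebra_simps)
  show "right_creation_ell2 e \<xi> (r *\<^sub>R x) = r *\<^sub>R right_creation_ell2 e \<xi> x" for r x
    unfolding scaleR_scaleC by transfer (auto simp: algebra_simps)
  show "norm (right_creation_ell2 e \<xi> x) \<le> norm x * sqrt (\<Sum>i\<in>UNIV. (cmod (cinner (e i) \<xi>))\<^sup>2)" for x
    using creation_bound'[OF _ inj_last_butlast, of _ "\<lambda>i. cinner (e i) \<xi>" x]
    by (intro norm_ell2_leI)
       (auto simp: right_creation_ell2.rep_eq power_mult_distrib sum_nonneg mult.commute)
qed

lemma left_creation_bounded_ops: "left_creation e \<xi> \<in> bounded_ops"
  unfolding bounded_ops_def
  by (simp add: left_creation_apply Rep_ell2_inject[symmetric] fun_eq_iff left_creation_ell2.rep_eq scaleC_ell2.rep_eq)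

lemma right_creation_bounded_ops: "right_creation e \<xi> \<in> bounded_ops"
  unfolding bounded_ops_def
  by (simp add: right_creation_apply Rep_ell2_inject[symmetric] fun_eq_iff right_creation_ell2.rep_eq scaleC_ell2.rep_eq)

lemma left_creation_tensor: "blinfun_apply (left_creation e \<xi>) (tensor e \<xi>s) = tensor e (\<xi> # \<xi>s)"
  unfolding left_creation_apply Rep_ell2_inject[symmetric] left_creation_ell2.rep_eq tensor.rep_eq
proof
  fix w
  show "(if w = [] then 0 else cinner (e (hd w)) \<xi> * (if length (tl w) = length \<xi>s then
      prod_list (map2 (\<lambda>i. cinner (e i)) (tl w) \<xi>s) else 0)) =
    (if length w = length (\<xi> # \<xi>s) then prod_list (map2 (\<lambda>i. cinner (e i)) w (\<xi> # \<xi>s)) else 0)"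
    by (cases w) auto
qed

lemma right_creation_tensor: "blinfun_apply (right_creation e \<xi>) (tensor e \<xi>s) = tensor e (\<xi>s @ [\<xi>])"
  unfolding right_creation_apply Rep_ell2_inject[symmetric] right_creation_ell2.rep_eq tensor.rep_eq
proof
  fix w
  show "(if w = [] then 0 else cinner (e (last w)) \<xi> * (if length (butlast w) = length \<xi>s then
      prod_list (map2 (\<lambda>i. cinner (e i)) (butlast w) \<xi>s) else 0)) =
    (if length w = length (\<xi>s @ [\<xi>]) then prod_list (map2 (\<lambda>i. cinner (e i)) w (\<xi>s @ [\<xi>])) else 0)"
    by (cases w rule: rev_cases) auto
qed

subsection \<open>Second quantization\<close>

text \<open>The case \<open>\<xi>s = []\<close> says that the vacuum is fixed. For unitary \<open>U\<close>, existence and uniqueness are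
  lemma \<open>second_quantization_ex1\<close>.\<close>

definition second_quantization ::
  "('n::finite \<Rightarrow> 'h::complex_inner) \<Rightarrow> ('h \<Rightarrow>\<^sub>L 'h) \<Rightarrow> 'n fock \<Rightarrow>\<^sub>L 'n fock" where
  "second_quantization e U = (THE G. G \<in> bounded_ops \<and>
     (\<forall>\<xi>s. blinfun_apply G (tensor e \<xi>s) = tensor e (map (blinfun_apply U) \<xi>s)))"

lemma bessel:
  fixes b :: "'i \<Rightarrow> 'a::complex_inner"
  assumes "finite F" and b: "\<And>i j. cinner (b i) (b j) = (if i = j then 1 else 0)"
  shows "(\<Sum>i\<in>F. (cmod (cinner (b i) x))\<^sup>2) \<le> (norm x)\<^sup>2"
proof -
  define S where "S = (\<Sum>i\<in>F. (cmod (cinner (b i) x))\<^sup>2)"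
  define p where "p = (\<Sum>i\<in>F. cinner (b i) x *\<^sub>C b i)"
  have "0 \<le> S" by (auto simp: S_def intro: sum_nonneg)
  have px: "cinner p x = complex_of_real S"
    by (simp add: p_def S_def cinner_sum_left cinner_scaleC_left complex_norm_square mult.commute
        del: of_real_power)
  have "cinner p p = complex_of_real S"
    using assms(1) by (simp add: p_def S_def cinner_sum_left cinner_sum_right cinner_scaleC_left
        cinner_scaleC_right b complex_norm_square mult.commute if_distrib cong: if_cong
        del: of_real_power)
  then have np: "(norm p)\<^sup>2 = S" unfolding cinner_self by (simp only: of_real_eq_iff)
  have "S \<le> norm p * norm x"
    using cmod_cinner_le[of p x] \<open>0 \<le> S\<close> by (simp add: px)
  then have "norm p * norm p \<le> norm p * norm x" by (simp add: np[symmetric] power2_eq_square)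
  then have "norm p \<le> norm x" by (cases "norm p = 0") auto
  then have "(norm p)\<^sup>2 \<le> (norm x)\<^sup>2" by (intro power_mono) auto
  then show ?thesis by (simp add: np S_def[symmetric])
qed

lemma second_quantization_ex1:
  fixes e :: "'n::finite \<Rightarrow> 'h::complex_inner"
  assumes e: "orthonormal_basis e" and U: "U \<in> unitaries"
  shows "\<exists>!G. G \<in> bounded_ops \<and>
     (\<forall>\<xi>s. blinfun_apply G (tensor e \<xi>s) = tensor e (map (blinfun_apply U) \<xi>s))"
proof -
  have surj: "surj (blinfun_apply U)"
    and iso: "\<And>x y. cinner (blinfun_apply U x) (blinfun_apply U y) = cinner x y"
    using U by (auto simp: unitaries_def)
  define V where "V = inv_into UNIV (blinfun_apply U)"
  have UV: "blinfun_apply U (V x) = x" for x using surj by (simp add: V_def surj_f_inv_f)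
  have V: "cinner (V x) y = cinner x (blinfun_apply U y)" for x y
    using iso[of "V x" y] by (simp add: UV)
  define b where "b w = tensor e (map (V \<circ> e) w)" for w
  have VV: "cinner (V (e i)) (V (e j)) = (if i = j then 1 else 0)" for i j
    using e by (simp add: V UV orthonormal_basis_def)
  have b: "cinner (b w) (b v) = (if w = v then 1 else 0)" for w v
  proof -
    have "length w = length v \<Longrightarrow>
        prod_list (map2 cinner (map (V \<circ> e) w) (map (V \<circ> e) v)) = (if w = v then 1 else 0)"
      by (induction w v rule: list_induct2) (auto simp: VV)
    then show ?thesis by (auto simp: b_def cinner_tensor[OF e])
  qed
  have bessel_b: "(\<Sum>w\<in>F. (cmod (cinner (b w) x))\<^sup>2) \<le> (norm x)\<^sup>2" if "finite F" for F x
    using that b by (rule bessel)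
  define G where "G x = Abs_ell2 (\<lambda>w. cinner (b w) x)" for x
  have Rep: "Rep_ell2 (G x) w = cinner (b w) x" for x w
    unfolding G_def by (subst Abs_ell2_inverse) (use bessel_b in \<open>auto simp: square_summable_iff\<close>)
  have "bounded_linear G"
  proof (rule bounded_linear_intro[where K = 1])
    show "G (x + y) = G x + G y" for x y
      by (simp add: Rep_ell2_inject[symmetric] fun_eq_iff Rep plus_ell2.rep_eq cinner_add_right)
    show "G (r *\<^sub>R x) = r *\<^sub>R G x" for r x
      by (simp add: Rep_ell2_inject[symmetric] fun_eq_iff Rep scaleR_scaleC scaleC_ell2.rep_eq
          cinner_scaleC_right)
    show "norm (G x) \<le> norm x * 1" for x
      by (rule norm_ell2_leI) (simp_all add: Rep bessel_b)
  qed
  then have apply_G: "blinfun_apply (Blinfun G) = G" by (rule bounded_linear_Blinfun_apply)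
  have "G (tensor e \<xi>s) = tensor e (map (blinfun_apply U) \<xi>s)" for \<xi>s
  proof -
    have "length w = length \<xi>s \<Longrightarrow> prod_list (map2 cinner (map (V \<circ> e) w) \<xi>s) =
        prod_list (map2 (\<lambda>i. cinner (e i)) w (map (blinfun_apply U) \<xi>s))" for w
      by (induction w \<xi>s rule: list_induct2) (auto simp: V)
    then show ?thesis
      by (auto simp: Rep_ell2_inject[symmetric] fun_eq_iff Rep b_def cinner_tensor[OF e] tensor.rep_eq)
  qed
  moreover have "G (c *\<^sub>C x) = c *\<^sub>C G x" for c x
    by (simp add: Rep_ell2_inject[symmetric] fun_eq_iff Rep scaleC_ell2.rep_eq cinner_scaleC_right)
  ultimately have *: "Blinfun G \<in> bounded_ops \<and>
      (\<forall>\<xi>s. blinfun_apply (Blinfun G) (tensor e \<xi>s) = tensor e (map (blinfun_apply U) \<xi>s))"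
    by (simp add: bounded_ops_def apply_G)
  show ?thesis
  proof (rule ex1I, rule *)
    fix T
    assume "T \<in> bounded_ops \<and>
      (\<forall>\<xi>s. blinfun_apply T (tensor e \<xi>s) = tensor e (map (blinfun_apply U) \<xi>s))"
    with * show "T = Blinfun G" by (intro bounded_ops_eq_on_tensors[OF e]) auto
  qed
qed

section \<open>The noncommutative Poisson boundary and its automorphisms\<close>

definition markov :: "('n::finite \<Rightarrow> 'h::complex_inner) \<Rightarrow> ('n fock \<Rightarrow>\<^sub>L 'n fock) \<Rightarrow> ('n fock \<Rightarrow>\<^sub>L 'n fock)" where
  "markov e x = (1 / real CARD('n)) *\<^sub>R
     (\<Sum>i\<in>UNIV. cadjoint (left_creation e (e i)) o\<^sub>L x o\<^sub>L left_creation e (e i))"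

definition Hinf :: "('n::finite \<Rightarrow> 'h::complex_inner) \<Rightarrow> ('n fock \<Rightarrow>\<^sub>L 'n fock) set" where
  "Hinf e = {x \<in> bounded_ops. markov e x = x}"

definition choi_effros ::
  "('n::finite \<Rightarrow> 'h::complex_inner) \<Rightarrow> ('n fock \<Rightarrow>\<^sub>L 'n fock) \<Rightarrow> ('n fock \<Rightarrow>\<^sub>L 'n fock) \<Rightarrow> ('n fock \<Rightarrow>\<^sub>L 'n fock)" where
  "choi_effros e x y = sot_lim (\<lambda>k. (markov e ^^ k) (x o\<^sub>L y))"

definition Hinf_automorphisms ::
  "('n::finite \<Rightarrow> 'h::complex_inner) \<Rightarrow> (('n fock \<Rightarrow>\<^sub>L 'n fock) \<Rightarrow> ('n fock \<Rightarrow>\<^sub>L 'n fock)) set" where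
  "Hinf_automorphisms e = {\<alpha> \<in> Bij (Hinf e).
     (\<forall>x\<in>Hinf e. \<forall>y\<in>Hinf e. \<alpha> (x + y) = \<alpha> x + \<alpha> y) \<and>
     (\<forall>c. \<forall>x\<in>Hinf e. \<alpha> (c *\<^sub>C x) = c *\<^sub>C \<alpha> x) \<and>
     (\<forall>x\<in>Hinf e. \<forall>y\<in>Hinf e. \<alpha> (choi_effros e x y) = choi_effros e (\<alpha> x) (\<alpha> y)) \<and>
     (\<forall>x\<in>Hinf e. \<alpha> (cadjoint x) = cadjoint (\<alpha> x))}"

text \<open>As in \<^term>\<open>BijGroup\<close>, automorphisms are extensional: they take the value \<^term>\<open>undefined\<close>
  outside \<^term>\<open>Hinf e\<close>, and the group operation is composition.\<close>

definition Aut_Hinf ::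
  "('n::finite \<Rightarrow> 'h::complex_inner) \<Rightarrow> (('n fock \<Rightarrow>\<^sub>L 'n fock) \<Rightarrow> ('n fock \<Rightarrow>\<^sub>L 'n fock)) monoid" where
  "Aut_Hinf e = (BijGroup (Hinf e))\<lparr>carrier := Hinf_automorphisms e\<rparr>"

definition creation_stabilizer ::
  "('n::finite \<Rightarrow> 'h::complex_inner) \<Rightarrow> (('n fock \<Rightarrow>\<^sub>L 'n fock) \<Rightarrow> ('n fock \<Rightarrow>\<^sub>L 'n fock)) set" where
  "creation_stabilizer e =
     {\<alpha> \<in> Hinf_automorphisms e. \<alpha> ` range (right_creation e) = range (right_creation e)}"

definition conj_second_quantization ::
  "('n::finite \<Rightarrow> 'h::complex_inner) \<Rightarrow> ('h \<Rightarrow>\<^sub>L 'h) \<Rightarrow> ('n fock \<Rightarrow>\<^sub>L 'n fock) \<Rightarrow> ('n fock \<Rightarrow>\<^sub>L 'n fock)" where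
  "conj_second_quantization e U x =
     second_quantization e U o\<^sub>L x o\<^sub>L cadjoint (second_quantization e U)"

end

theory Submission
  imports Defs
begin

text \<open>
  Every second quantization intertwines \<open>l \<xi>\<close> with \<open>l (U \<xi>)\<close> and \<open>r \<xi>\<close> with \<open>r (U \<xi>)\<close>. Since the
  average over the left creation operators of an orthonormal basis does not depend on the basis,
  conjugation by it commutes with the Markov operator (\<open>lavg_Ad\<close>), hence is an automorphism of the
  Poisson boundary that permutes the operators \<open>r \<xi>\<close> in the way \<open>U\<close> permutes the vectors \<open>\<xi>\<close>. This
  gives an injective homomorphism into the stabilizer.

  Conversely, an automorphism \<open>\<alpha>\<close> of the stabilizer acts on the vectors \<open>\<xi>\<close> by a linear bijection,
  which is unitary because the product of the adjoint of \<open>r \<xi>\<close> with \<open>r \<eta>\<close> is the scalar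
  \<open>cinner \<xi> \<eta>\<close> (\<open>stabilizer_unitary\<close>). After composing with a second quantization it fixes all
  creation operators, and it remains to see that an automorphism \<open>\<beta>\<close> fixing them is the identity
  (\<open>fixes_all\<close>). A harmonic \<open>x\<close> is determined by the numbers \<open>\<omega> (R v\<^sup>* x R w)\<close>, where \<open>\<omega>\<close> is the vacuum
  state and \<open>R w\<close> the right shift by the word \<open>w\<close>, and \<open>\<beta>\<close> respects the operators
  \<open>R v\<^sup>* x R w\<close>; so the claim is that \<open>\<omega>\<close> is invariant under \<open>\<beta>\<close> (\<open>vacuum_state_invariant\<close>).

  Invariance rests on two facts. The first is mixing (\<open>harm_mixing\<close>): let \<open>Q\<close> be the average of
  \<open>R i\<^sup>* x R i\<close> over the letters \<open>i\<close>. It preserves harmonicity and \<open>\<omega>\<close>, commutes with \<open>\<beta>\<close>, and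
  \<open>Q\<^sup>k x\<close> converges to \<open>\<omega> x\<close> in the Hilbert norm of \<open>\<omega>\<close>. Indeed harmonic operators are approximated in
  that norm by combinations of the operators \<open>R v R w\<^sup>*\<close> (a martingale argument), on which \<open>Q\<^sup>k\<close>
  converges in operator norm by direct computation, as there are at least two letters. Thus
  \<open>y k = Q\<^sup>k x - \<omega> x\<close> is bounded, small in the Hilbert norm of \<open>\<omega>\<close>, and \<open>\<omega> (\<beta> (y k))\<close> is the constant
  \<open>\<omega> (\<beta> x) - \<omega> x\<close>.

  The second fact is normality of \<open>\<omega> \<circ> \<beta>\<close> (\<open>vacuum_state_normal\<close>), which forces that constant to
  vanish. Automorphisms are order isomorphisms, because a strictly positive harmonic operator is the
  square of a selfadjoint one for the Choi-Effros product (\<open>harm_sqrt\<close>). Bounded positive \<open>p k\<close> with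
  summable \<open>\<omega> (p k)\<close> are dominated, up to a constant, by the operators \<open>s (1 + s)\<^sup>-\<^sup>1\<close> of the tail
  sums \<open>s\<close>. These are superharmonic by a Jensen inequality for the resolvent, so iterating the Markov
  operator turns them into harmonic bounds (\<open>cutoff\<close>), and the suprema of these over the tails
  decrease to \<open>0\<close>. An order isomorphism preserves this.
\<close>

section \<open>Inner products and adjoints on square-summable families\<close>

lemma cinner_ell2_unit: "cinner (ell2_unit a) x = Rep_ell2 x a"
proof -
  have "cinner (ell2_unit a) x = (\<Sum>\<^sub>\<infinity>i\<in>{a}. Rep_ell2 x i)"
    unfolding cinner_ell2.rep_eq ell2_unit.rep_eq by (rule infsum_cong_neutral) auto
  then show ?thesis by simp
qed

lemma cinner_ell2_unit_right: "cinner x (ell2_unit a) = cnj (Rep_ell2 x a)"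
  using cinner_commute[of x "ell2_unit a"] by (simp add: cinner_ell2_unit)

lemma norm_ell2_unit [simp]: "norm (ell2_unit a) = 1"
  by (simp add: norm_eq_sqrt_inner inner_eq_Re_cinner cinner_ell2_unit ell2_unit.rep_eq)

lemma ell2_eqI: "(\<And>a. cinner (ell2_unit a) x = cinner (ell2_unit a) y) \<Longrightarrow> x = y"
  by (simp add: cinner_ell2_unit Rep_ell2_inject[symmetric] fun_eq_iff)

lemma scaleC_zero_right [simp]: "c *\<^sub>C (0 :: 'a :: complex_inner) = 0"
  using scaleC_add_right[of c 0 "0::'a"] by simp

lemma scaleC_one [simp]: "1 *\<^sub>C (x :: 'a :: complex_inner) = x"
  using scaleR_scaleC[of 1 x] by simp

lemma scaleC_zero_left [simp]: "0 *\<^sub>C (x :: 'a :: complex_inner) = 0"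
  using scaleR_scaleC[of 0 x] by simp

lemma scaleC_scaleR: "c *\<^sub>C r *\<^sub>R (x :: 'a :: complex_inner) = r *\<^sub>R c *\<^sub>C x"
  by (simp add: scaleR_scaleC scaleC_scaleC mult.commute)

lemma scaleC_sum_right: "c *\<^sub>C (\<Sum>i\<in>A. f i) = (\<Sum>i\<in>A. c *\<^sub>C (f i :: 'a :: complex_inner))"
  by (induction A rule: infinite_finite_induct) (auto simp: scaleC_add_right)

lemma scaleC_minus_right [simp]: "c *\<^sub>C (- x :: 'a :: complex_inner) = - (c *\<^sub>C x)"
  by (metis add.right_inverse add_eq_0_iff scaleC_add_right scaleC_zero_right)

lemma scaleC_diff_right: "c *\<^sub>C (x - y :: 'a :: complex_inner) = c *\<^sub>C x - c *\<^sub>C y"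
  by (metis diff_conv_add_uminus scaleC_add_right scaleC_minus_right)

lemma scaleR_cinner_right: "cinner x (r *\<^sub>R y :: 'a :: complex_inner) = r *\<^sub>R cinner x y"
  by (simp add: scaleR_scaleC cinner_scaleC_right scaleR_conv_of_real)

lemma cinner_minus_right: "cinner x (- y :: 'a :: complex_inner) = - cinner x y"
  using scaleR_cinner_right[of x "-1" y] by simp

lemma cinner_diff_right: "cinner x (y - z :: 'a :: complex_inner) = cinner x y - cinner x z"
  by (simp only: diff_conv_add_uminus cinner_add_right cinner_minus_right)

lemma bounded_linear_cinner_right: "bounded_linear (cinner (x :: 'a :: complex_inner))"
  by (rule bounded_linear_intro[where K = "norm x"])
     (simp_all add: cinner_add_right scaleR_cinner_right cmod_cinner_le mult.commute[of _ "norm x"])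

lemma bounded_linear_scaleC: "bounded_linear (\<lambda>x :: 'a :: complex_inner. c *\<^sub>C x)"
  by (rule bounded_linear_intro[where K = "cmod c"])
     (auto simp: scaleC_add_right scaleC_scaleR norm_scaleC mult.commute)

lemma ell2_dense_induct:
  assumes "closed {x. P x}" and unit: "\<And>a. P (ell2_unit a)"
    and add: "\<And>x y. P x \<Longrightarrow> P y \<Longrightarrow> P (x + y)" and scale: "\<And>c x. P x \<Longrightarrow> P (c *\<^sub>C x)"
  shows "P (x :: 'a ell2)"
proof -
  have P0: "P 0" using scale[OF unit, of 0 undefined] by simp
  have Ps: "P (\<Sum>a\<in>F. Rep_ell2 x a *\<^sub>C ell2_unit a)" for F
    by (induction F rule: infinite_finite_induct) (auto intro: P0 add scale unit)
  have "x \<in> closure {x. P x}"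
    unfolding closure_approachable
  proof (intro allI impI)
    fix d :: real assume "0 < d"
    then obtain F where "norm (x - (\<Sum>a\<in>F. Rep_ell2 x a *\<^sub>C ell2_unit a)) \<le> d / 2"
      using ell2_approx[of "d/2" x] by auto
    then show "\<exists>y\<in>{x. P x}. dist y x < d"
      using Ps[of F] \<open>0 < d\<close>
      by (intro bexI[of _ "\<Sum>a\<in>F. Rep_ell2 x a *\<^sub>C ell2_unit a"]) (simp_all add: dist_norm norm_minus_commute)
  qed
  then show ?thesis using assms(1) by simp
qed

lemma bounded_opsD: "T \<in> bounded_ops \<Longrightarrow> blinfun_apply T (c *\<^sub>C x) = c *\<^sub>C blinfun_apply T x"
  by (simp add: bounded_ops_def)

lemma scaleC_blinfun_apply: "blinfun_apply (c *\<^sub>C T) x = c *\<^sub>C blinfun_apply T x"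
  by (simp add: scaleC_blinfun.rep_eq)

lemma bounded_ops_add: "S \<in> bounded_ops \<Longrightarrow> T \<in> bounded_ops \<Longrightarrow> S + T \<in> bounded_ops"
  by (simp add: bounded_ops_def blinfun.add_left scaleC_add_right)

lemma bounded_ops_diff: "S \<in> bounded_ops \<Longrightarrow> T \<in> bounded_ops \<Longrightarrow> S - T \<in> bounded_ops"
  by (simp add: bounded_ops_def blinfun.diff_left scaleC_diff_right)

lemma bounded_ops_scaleC: "T \<in> bounded_ops \<Longrightarrow> c *\<^sub>C T \<in> bounded_ops"
  by (simp add: bounded_ops_def scaleC_blinfun_apply scaleC_scaleC mult.commute)

lemma bounded_ops_scaleR: "T \<in> bounded_ops \<Longrightarrow> r *\<^sub>R T \<in> bounded_ops"
  by (simp add: bounded_ops_def blinfun.scaleR_left scaleC_scaleR)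

lemma bounded_ops_compose: "S \<in> bounded_ops \<Longrightarrow> T \<in> bounded_ops \<Longrightarrow> S o\<^sub>L T \<in> bounded_ops"
  by (simp add: bounded_ops_def)

lemma bounded_ops_id: "id_blinfun \<in> bounded_ops"
  by (simp add: bounded_ops_def)

lemma bounded_ops_zero: "0 \<in> bounded_ops"
  by (simp add: bounded_ops_def)

lemma bounded_ops_sum: "(\<And>i. i \<in> A \<Longrightarrow> T i \<in> bounded_ops) \<Longrightarrow> (\<Sum>i\<in>A. T i) \<in> bounded_ops"
  by (induction A rule: infinite_finite_induct) (auto simp: bounded_ops_zero bounded_ops_add)

lemmas bounded_ops_intros = bounded_ops_add bounded_ops_diff bounded_ops_scaleC bounded_ops_scaleR
  bounded_ops_compose bounded_ops_id bounded_ops_zero bounded_ops_sum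

lemma bounded_ops_limit:
  assumes "\<And>k::nat. X k \<in> bounded_ops"
    and "\<And>v. (\<lambda>k. blinfun_apply (X k) v) \<longlonglongrightarrow> blinfun_apply L v"
  shows "L \<in> bounded_ops"
  unfolding bounded_ops_def
proof (safe, rule LIMSEQ_unique)
  fix c v
  show "(\<lambda>k. blinfun_apply (X k) (c *\<^sub>C v)) \<longlonglongrightarrow> blinfun_apply L (c *\<^sub>C v)" by (rule assms(2))
  show "(\<lambda>k. blinfun_apply (X k) (c *\<^sub>C v)) \<longlonglongrightarrow> c *\<^sub>C blinfun_apply L v"
    unfolding bounded_opsD[OF assms(1)]
    by (intro bounded_linear.tendsto[OF bounded_linear_scaleC] assms(2))
qed

lemma closed_bounded_ops: "closed (bounded_ops :: ('a::complex_inner \<Rightarrow>\<^sub>L 'a) set)"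
proof -
  have "L \<in> bounded_ops" if "\<forall>n. X n \<in> bounded_ops" "X \<longlonglongrightarrow> L"
    for X :: "nat \<Rightarrow> ('a \<Rightarrow>\<^sub>L 'a)" and L
    by (rule bounded_ops_limit[of X]) (use that(1) blinfun.tendsto[OF that(2) tendsto_const] in auto)
  then show ?thesis unfolding closed_sequential_limits by blast
qed

lemma cadjoint_eqI:
  assumes "\<And>x y. cinner (blinfun_apply S x) y = cinner x (blinfun_apply T y)"
  shows "cadjoint T = S"
  unfolding cadjoint_def
proof (rule the_equality, intro allI assms)
  fix S' assume S': "\<forall>x y. cinner (blinfun_apply S' x) y = cinner x (blinfun_apply T y)"
  show "S' = S"
  proof (rule blinfun_eqI)
    fix x
    have a: "inner (blinfun_apply S' x) y = inner (blinfun_apply S x) y" for y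
      unfolding inner_eq_Re_cinner assms S'[rule_format] by (rule refl)
    have "inner (blinfun_apply S' x - blinfun_apply S x) (blinfun_apply S' x - blinfun_apply S x) = 0"
      unfolding inner_diff_left a by (rule diff_self)
    then have "blinfun_apply S' x - blinfun_apply S x = 0"
      unfolding inner_eq_zero_iff .
    then show "blinfun_apply S' x = blinfun_apply S x"
      by (rule right_minus_eq[THEN iffD1])
  qed
qed

text \<open>The coordinates of the adjoint vector are prescribed, and they are square summable because
  \<open>T\<close> is bounded.\<close>

lemma cadjoint_exists:
  fixes T :: "'a ell2 \<Rightarrow>\<^sub>L 'a ell2"
  assumes T: "T \<in> bounded_ops"
  shows "\<exists>S. \<forall>x y. cinner (blinfun_apply S x) y = cinner x (blinfun_apply T y)"
proof -
  let ?c = "\<lambda>x w. cinner (blinfun_apply T (ell2_unit w)) x"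
  have bound: "(\<Sum>w\<in>F. (cmod (?c x w))\<^sup>2) \<le> (norm T * norm x)\<^sup>2" for F x
  proof -
    define y where "y = (\<Sum>w\<in>F. ?c x w *\<^sub>C ell2_unit w)"
    define s where "s = (\<Sum>w\<in>F. (cmod (?c x w))\<^sup>2)"
    have s0: "0 \<le> s" by (simp add: s_def sum_nonneg)
    have "cinner (blinfun_apply T y) x = complex_of_real s"
      by (simp add: y_def s_def blinfun.sum_right bounded_opsD[OF T] cinner_sum_left cinner_scaleC_left
          complex_norm_square mult.commute del: of_real_power)
    then have "s \<le> norm (blinfun_apply T y) * norm x"
      using cmod_cinner_le[of "blinfun_apply T y" x] s0 by simp
    also have "\<dots> \<le> norm T * norm y * norm x" by (intro mult_right_mono norm_blinfun) simp
    finally have le: "s \<le> norm y * (norm T * norm x)" by (simp add: mult_ac)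
    have ny: "(norm y)\<^sup>2 = s"
    proof (cases "finite F")
      case True
      have "cinner y y = complex_of_real s"
        using True by (simp add: y_def s_def cinner_sum_left cinner_sum_right cinner_scaleC_left
            cinner_scaleC_right cinner_ell2_unit ell2_unit.rep_eq complex_norm_square mult.commute
            if_distrib cong: if_cong del: of_real_power)
      then show ?thesis unfolding cinner_self by (simp only: of_real_eq_iff)
    qed (simp add: y_def s_def)
    have "norm y \<le> norm T * norm x"
      using le unfolding ny[symmetric] power2_eq_square by (cases "y = 0") simp_all
    then have "(norm y)\<^sup>2 \<le> (norm T * norm x)\<^sup>2" by (intro power_mono) auto
    then show ?thesis by (simp add: ny s_def)
  qed
  define S where "S x = Abs_ell2 (?c x)" for x
  have Rep: "Rep_ell2 (S x) w = ?c x w" for x w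
    unfolding S_def by (subst Abs_ell2_inverse) (use bound in \<open>auto simp: square_summable_iff\<close>)
  have "bounded_linear S"
  proof (rule bounded_linear_intro[where K = "norm T"])
    show "S (x + y) = S x + S y" for x y
      by (simp add: Rep_ell2_inject[symmetric] fun_eq_iff Rep plus_ell2.rep_eq cinner_add_right)
    show "S (r *\<^sub>R x) = r *\<^sub>R S x" for r x
      by (simp add: Rep_ell2_inject[symmetric] fun_eq_iff Rep scaleR_scaleC scaleC_ell2.rep_eq
          cinner_scaleC_right)
    show "norm (S x) \<le> norm x * norm T" for x
      by (rule norm_ell2_leI) (use bound[where x = x] in \<open>simp_all add: Rep mult.commute\<close>)
  qed
  then have apply_S: "blinfun_apply (Blinfun S) = S" by (rule bounded_linear_Blinfun_apply)
  have "cinner (S x) y = cinner x (blinfun_apply T y)" for x y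
  proof (induction y rule: ell2_dense_induct)
    show "closed {y. cinner (S x) y = cinner x (blinfun_apply T y)}"
      by (intro closed_Collect_eq bounded_linear.continuous_on[OF bounded_linear_cinner_right]
          continuous_intros)
    show "cinner (S x) (ell2_unit a) = cinner x (blinfun_apply T (ell2_unit a))" for a
      by (simp add: cinner_ell2_unit_right Rep cinner_commute[of x])
  qed (auto simp: cinner_add_right blinfun.add_right cinner_scaleC_right bounded_opsD[OF T])
  then show ?thesis by (intro exI[of _ "Blinfun S"]) (simp add: apply_S)
qed

context
  fixes T :: "'a ell2 \<Rightarrow>\<^sub>L 'a ell2"
  assumes T: "T \<in> bounded_ops"
begin

lemma cinner_cadjoint_left: "cinner (blinfun_apply (cadjoint T) x) y = cinner x (blinfun_apply T y)"
proof -
  obtain S where S: "\<And>x y. cinner (blinfun_apply S x) y = cinner x (blinfun_apply T y)"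
    using cadjoint_exists[OF T] by blast
  have "cadjoint T = S" by (rule cadjoint_eqI) (rule S)
  then show ?thesis by (simp add: S)
qed

lemma cinner_cadjoint_right: "cinner x (blinfun_apply (cadjoint T) y) = cinner (blinfun_apply T x) y"
  using cinner_cadjoint_left[of y x] cinner_commute[of x "blinfun_apply (cadjoint T) y"]
    cinner_commute[of "blinfun_apply T x" y] by simp

lemma inner_cadjoint_left: "inner (blinfun_apply (cadjoint T) x) y = inner x (blinfun_apply T y)"
  by (simp add: inner_eq_Re_cinner cinner_cadjoint_left)

lemma inner_cadjoint_right: "inner x (blinfun_apply (cadjoint T) y) = inner (blinfun_apply T x) y"
  by (simp add: inner_eq_Re_cinner cinner_cadjoint_right)

lemma cadjoint_bounded_ops: "cadjoint T \<in> bounded_ops"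
  unfolding bounded_ops_def
  by (auto intro!: ell2_eqI simp: cinner_cadjoint_right cinner_scaleC_right)

lemma norm_cadjoint_le: "norm (cadjoint T) \<le> norm T"
proof (rule norm_blinfun_bound)
  fix x
  let ?y = "blinfun_apply (cadjoint T) x"
  have "norm ?y * norm ?y = inner x (blinfun_apply T ?y)"
    by (simp add: inner_cadjoint_left[symmetric] power2_norm_eq_inner[symmetric] power2_eq_square)
  also have "\<dots> \<le> norm x * (norm T * norm ?y)"
    by (rule order_trans[OF norm_cauchy_schwarz]) (intro mult_left_mono norm_blinfun, simp)
  finally have "norm ?y * norm ?y \<le> norm ?y * (norm T * norm x)" by (simp add: mult_ac)
  then show "norm ?y \<le> norm T * norm x" by (cases "?y = 0") simp_all
qed simp

end

lemma cadjoint_cadjoint: "T \<in> bounded_ops \<Longrightarrow> cadjoint (cadjoint T) = (T :: 'a ell2 \<Rightarrow>\<^sub>L 'a ell2)"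
  by (rule cadjoint_eqI) (simp add: cinner_cadjoint_right)

lemma cadjoint_compose:
  "S \<in> bounded_ops \<Longrightarrow> T \<in> bounded_ops \<Longrightarrow>
    cadjoint (S o\<^sub>L T) = cadjoint T o\<^sub>L cadjoint (S :: 'a ell2 \<Rightarrow>\<^sub>L 'a ell2)"
  by (rule cadjoint_eqI) (simp add: cinner_cadjoint_left)

lemma cadjoint_add:
  "S \<in> bounded_ops \<Longrightarrow> T \<in> bounded_ops \<Longrightarrow> cadjoint (S + T) = cadjoint S + cadjoint (T :: 'a ell2 \<Rightarrow>\<^sub>L 'a ell2)"
  by (rule cadjoint_eqI)
     (simp add: cinner_cadjoint_left blinfun.add_left cinner_add_left cinner_add_right)

lemma cadjoint_scaleC:
  "T \<in> bounded_ops \<Longrightarrow> cadjoint (c *\<^sub>C T) = cnj c *\<^sub>C cadjoint (T :: 'a ell2 \<Rightarrow>\<^sub>L 'a ell2)"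
  by (rule cadjoint_eqI)
     (simp add: cinner_cadjoint_left scaleC_blinfun_apply cinner_scaleC_left cinner_scaleC_right)

lemma cadjoint_id [simp]: "cadjoint id_blinfun = id_blinfun"
  by (rule cadjoint_eqI) simp

section \<open>Isometries induced by injections of the index set\<close>

lift_definition push_ell2 :: "('a \<Rightarrow> 'a) \<Rightarrow> 'a ell2 \<Rightarrow> 'a ell2" is
  "\<lambda>h f v. if v \<in> range h then f (inv_into UNIV h v) else 0"
proof -
  fix h :: "'a \<Rightarrow> 'a" and f :: "'a \<Rightarrow> complex"
  assume f: "(\<lambda>x. (cmod (f x))\<^sup>2) summable_on UNIV"
  have "inj_on (inv_into UNIV h) (range h)" by (rule inj_on_inv_into) simp
  moreover have "(\<lambda>x. (cmod (f x))\<^sup>2) summable_on (inv_into UNIV h ` range h)"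
    using f by (rule summable_on_subset_banach) simp
  ultimately have "((\<lambda>x. (cmod (f x))\<^sup>2) \<circ> inv_into UNIV h) summable_on range h"
    by (simp add: summable_on_reindex)
  then show "(\<lambda>v. (cmod (if v \<in> range h then f (inv_into UNIV h v) else 0))\<^sup>2) summable_on UNIV"
    by (rule summable_on_cong_neutral[THEN iffD1, rotated -1]) auto
qed

text \<open>For injective \<open>h\<close> this is the isometry that sends the basis vector at \<open>v\<close> to the one at \<open>h v\<close>.
  Creation operators of basis vectors are the instances where \<open>h\<close> prepends or appends a letter.\<close>

definition push :: "('a \<Rightarrow> 'a) \<Rightarrow> 'a ell2 \<Rightarrow>\<^sub>L 'a ell2" where
  "push h = Blinfun (push_ell2 h)"

lemma push_apply: "blinfun_apply (push h) = push_ell2 h"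
  unfolding push_def
proof (intro bounded_linear_Blinfun_apply bounded_linear_intro)
  show "push_ell2 h (x + y) = push_ell2 h x + push_ell2 h y" for x y
    by transfer auto
  show "push_ell2 h (r *\<^sub>R x) = r *\<^sub>R push_ell2 h x" for r x
    unfolding scaleR_scaleC by transfer auto
  show "norm (push_ell2 h x) \<le> norm x * 1" for x
  proof (rule norm_ell2_leI)
    fix F :: "'a set" assume F: "finite F"
    have inj: "inj_on (inv_into UNIV h) (F \<inter> range h)"
      by (rule inj_on_subset[OF inj_on_inv_into[OF subset_refl]]) simp
    have "(\<Sum>v\<in>F. (cmod (Rep_ell2 (push_ell2 h x) v))\<^sup>2) = (\<Sum>v\<in>F \<inter> range h. (cmod (Rep_ell2 x (inv_into UNIV h v)))\<^sup>2)"
      using F by (intro sum.mono_neutral_cong_right) (auto simp: push_ell2.rep_eq)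
    also have "\<dots> = (\<Sum>v\<in>inv_into UNIV h ` (F \<inter> range h). (cmod (Rep_ell2 x v))\<^sup>2)"
      using inj by (simp add: sum.reindex)
    also have "\<dots> \<le> (norm x)\<^sup>2"
      using F by (intro sum_le_norm_ell2_squared) simp
    finally show "(\<Sum>v\<in>F. (cmod (Rep_ell2 (push_ell2 h x) v))\<^sup>2) \<le> (norm x * 1)\<^sup>2" by simp
  qed simp
qed

lemma push_bounded_ops: "push h \<in> bounded_ops"
  unfolding bounded_ops_def
  by (auto simp: push_apply Rep_ell2_inject[symmetric] fun_eq_iff push_ell2.rep_eq scaleC_ell2.rep_eq)

context
  fixes h :: "'a \<Rightarrow> 'a"
  assumes h: "inj h"
begin

lemma push_unit: "blinfun_apply (push h) (ell2_unit v) = ell2_unit (h v)"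
  using h by (auto simp: push_apply Rep_ell2_inject[symmetric] fun_eq_iff push_ell2.rep_eq
      ell2_unit.rep_eq)

lemma Rep_pull: "Rep_ell2 (blinfun_apply (cadjoint (push h)) x) v = Rep_ell2 x (h v)"
  unfolding cinner_ell2_unit[symmetric] cinner_cadjoint_right[OF push_bounded_ops] push_unit ..

lemma pull_unit: "blinfun_apply (cadjoint (push h)) (ell2_unit (h v)) = ell2_unit v"
  using h by (auto simp: Rep_ell2_inject[symmetric] fun_eq_iff Rep_pull ell2_unit.rep_eq inj_eq)

lemma pull_unit_zero: "v \<notin> range h \<Longrightarrow> blinfun_apply (cadjoint (push h)) (ell2_unit v) = 0"
  by (auto simp: Rep_ell2_inject[symmetric] fun_eq_iff Rep_pull ell2_unit.rep_eq zero_ell2.rep_eq)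

lemma pull_push: "blinfun_apply (cadjoint (push h)) (blinfun_apply (push h) x) = x"
  using h by (simp add: Rep_ell2_inject[symmetric] fun_eq_iff Rep_pull push_apply push_ell2.rep_eq)

lemma cinner_push: "cinner (blinfun_apply (push h) x) (blinfun_apply (push h) y) = cinner x y"
  using cinner_cadjoint_right[OF push_bounded_ops, of x h "blinfun_apply (push h) y"]
  by (simp add: pull_push)

lemma norm_push: "norm (blinfun_apply (push h) x) = norm x"
  by (simp add: norm_eq_sqrt_inner inner_eq_Re_cinner cinner_push)

end

lemma push_compose:
  assumes "inj h" "inj g"
  shows "push h o\<^sub>L push g = push (\<lambda>v. h (g v))"
proof (rule bounded_ops_eq_on_units)
  have "inj (\<lambda>v. h (g v))" using inj_compose[OF assms] by (simp add: comp_def)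
  then show "blinfun_apply (push h o\<^sub>L push g) (ell2_unit a) =
      blinfun_apply (push (\<lambda>v. h (g v))) (ell2_unit a)" for a
    by (simp add: push_unit assms)
qed (intro bounded_ops_compose push_bounded_ops)+

definition lshift :: "'n list \<Rightarrow> 'n fock \<Rightarrow>\<^sub>L 'n fock" where
  "lshift w = push (\<lambda>v. w @ v)"

definition rshift :: "'n list \<Rightarrow> 'n fock \<Rightarrow>\<^sub>L 'n fock" where
  "rshift w = push (\<lambda>v. v @ w)"

lemma inj_append_left: "inj (\<lambda>v. w @ v)" and inj_append_right: "inj (\<lambda>v. v @ w)"
  by (auto simp: inj_def)

lemma lshift_bounded_ops: "lshift w \<in> bounded_ops" and rshift_bounded_ops: "rshift w \<in> bounded_ops"
  by (simp_all add: lshift_def rshift_def push_bounded_ops)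

lemma lshift_unit: "blinfun_apply (lshift w) (ell2_unit v) = ell2_unit (w @ v)"
  and rshift_unit: "blinfun_apply (rshift w) (ell2_unit v) = ell2_unit (v @ w)"
  by (simp_all add: lshift_def rshift_def push_unit inj_append_left inj_append_right)

lemma norm_lshift: "norm (blinfun_apply (lshift w) x) = norm x"
  and norm_rshift: "norm (blinfun_apply (rshift w) x) = norm x"
  by (simp_all add: lshift_def rshift_def norm_push inj_append_left inj_append_right)

lemma lshift_compose: "lshift v o\<^sub>L lshift w = lshift (v @ w)"
  and rshift_compose: "rshift v o\<^sub>L rshift w = rshift (w @ v)"
  and lshift_rshift: "lshift v o\<^sub>L rshift w = rshift w o\<^sub>L lshift v"
  by (simp_all add: lshift_def rshift_def push_compose inj_append_left inj_append_right)

lemma lshift_Nil: "lshift [] = id_blinfun" and rshift_Nil: "rshift [] = id_blinfun"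
  by (rule bounded_ops_eq_on_units; simp add: bounded_ops_intros lshift_bounded_ops rshift_bounded_ops
      lshift_unit rshift_unit)+

section \<open>Averages over a family of isometries\<close>

text \<open>For the left shifts by single letters this is the Markov operator; for the right shifts it is an
  average that acts on harmonic operators and commutes with automorphisms fixing the shifts.\<close>

definition mean :: "('i::finite \<Rightarrow> 'a ell2 \<Rightarrow>\<^sub>L 'a ell2) \<Rightarrow> ('a ell2 \<Rightarrow>\<^sub>L 'a ell2) \<Rightarrow> ('a ell2 \<Rightarrow>\<^sub>L 'a ell2)" where
  "mean V T = (1 / real CARD('i)) *\<^sub>R (\<Sum>i\<in>UNIV. cadjoint (V i) o\<^sub>L T o\<^sub>L V i)"

text \<open>By \<open>2 a b \<le> a\<^sup>2 + b\<^sup>2\<close> in each summand. In the applications \<open>u\<close> is the norm of a vector whose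
  square norm is a mean of inner products involving that vector.\<close>

lemma sq_le_mean:
  fixes u c :: real
  assumes "finite W" "W \<noteq> {}" and le: "u\<^sup>2 \<le> (1 / real (card W)) * (\<Sum>w\<in>W. u * (c * b w))"
  shows "u\<^sup>2 \<le> c\<^sup>2 * ((1 / real (card W)) * (\<Sum>w\<in>W. (b w)\<^sup>2))"
proof -
  have "2 * (u * (c * b w)) \<le> u\<^sup>2 + c\<^sup>2 * (b w)\<^sup>2" for w
    using sum_squares_bound[of u "c * b w"] by (simp add: power_mult_distrib mult_ac)
  then have "(\<Sum>w\<in>W. 2 * (u * (c * b w))) \<le> (\<Sum>w\<in>W. u\<^sup>2 + c\<^sup>2 * (b w)\<^sup>2)" by (intro sum_mono)
  then have s: "2 * (\<Sum>w\<in>W. u * (c * b w)) \<le> real (card W) * u\<^sup>2 + c\<^sup>2 * (\<Sum>w\<in>W. (b w)\<^sup>2)"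
    by (simp add: sum.distrib sum_distrib_left)
  have "0 < real (card W)" using assms by (simp add: card_gt_0_iff)
  with le s show ?thesis by (simp add: field_simps)
qed

lemma blinfun_apply_mean:
  "blinfun_apply (mean V T) v = (1 / real CARD('i)) *\<^sub>R
    (\<Sum>i\<in>UNIV. blinfun_apply (cadjoint (V i)) (blinfun_apply T (blinfun_apply (V (i::'i::finite)) v)))"
  by (simp add: mean_def blinfun.scaleR_left blinfun.sum_left)

lemma mean_add: "mean V (S + T) = mean V S + mean V T"
  by (rule blinfun_eqI)
     (simp add: blinfun_apply_mean blinfun.add_left blinfun.add_right sum.distrib scaleR_add_right)

lemma mean_diff: "mean V (S - T) = mean V S - mean V T"
  by (rule blinfun_eqI)
     (simp add: blinfun_apply_mean blinfun.diff_left blinfun.diff_right sum_subtractf scaleR_diff_right)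

lemma mean_scaleR: "mean V (r *\<^sub>R T) = r *\<^sub>R mean V T"
  by (rule blinfun_eqI)
     (simp add: blinfun_apply_mean blinfun.scaleR_left blinfun.scaleR_right scaleR_sum_right mult.commute)

lemma mean_zero: "mean V 0 = 0"
  by (rule blinfun_eqI) (simp add: blinfun_apply_mean)

lemma funpow_mean_add: "(mean V ^^ k) (S + T) = (mean V ^^ k) S + (mean V ^^ k) T"
  by (induction k) (simp_all add: mean_add)

lemma funpow_mean_diff: "(mean V ^^ k) (S - T) = (mean V ^^ k) S - (mean V ^^ k) T"
  by (induction k) (simp_all add: mean_diff)

lemma funpow_mean_scaleR: "(mean V ^^ k) (r *\<^sub>R T) = r *\<^sub>R (mean V ^^ k) T"
  by (induction k) (simp_all add: mean_scaleR)

lemma mean_sot: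
  assumes "\<And>v. (\<lambda>k::nat. blinfun_apply (X k) v) \<longlonglongrightarrow> blinfun_apply L v"
  shows "(\<lambda>k. blinfun_apply (mean V (X k)) v) \<longlonglongrightarrow> blinfun_apply (mean V L) v"
  unfolding blinfun_apply_mean by (intro tendsto_intros assms)

locale isometry_family =
  fixes V :: "'i::finite \<Rightarrow> 'a ell2 \<Rightarrow>\<^sub>L 'a ell2"
  assumes V: "V i \<in> bounded_ops"
    and norm_V: "norm (blinfun_apply (V i) x) = norm x"
begin

lemma cinner_mean: "cinner u (blinfun_apply (mean V T) v) =
    (1 / real CARD('i)) *\<^sub>R (\<Sum>i\<in>UNIV. cinner (blinfun_apply (V i) u) (blinfun_apply T (blinfun_apply (V i) v)))"
  by (simp only: blinfun_apply_mean scaleR_cinner_right cinner_sum_right cinner_cadjoint_right[OF V])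

lemma inner_mean: "inner u (blinfun_apply (mean V T) v) =
    (1 / real CARD('i)) * (\<Sum>i\<in>UNIV. inner (blinfun_apply (V i) u) (blinfun_apply T (blinfun_apply (V i) v)))"
  unfolding inner_eq_Re_cinner cinner_mean by simp

lemma mean_bounded_ops: "T \<in> bounded_ops \<Longrightarrow> mean V T \<in> bounded_ops"
  unfolding mean_def by (intro bounded_ops_intros cadjoint_bounded_ops V)

lemma funpow_mean_bounded_ops: "T \<in> bounded_ops \<Longrightarrow> (mean V ^^ k) T \<in> bounded_ops"
  by (induction k) (simp_all add: mean_bounded_ops)

lemma mean_scaleC: "T \<in> bounded_ops \<Longrightarrow> mean V (c *\<^sub>C T) = c *\<^sub>C mean V T"
  by (rule blinfun_eqI)
     (simp add: blinfun_apply_mean scaleC_blinfun_apply bounded_opsD[OF cadjoint_bounded_ops[OF V]]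
       scaleC_sum_right scaleC_scaleR)

lemma funpow_mean_scaleC: "T \<in> bounded_ops \<Longrightarrow> (mean V ^^ k) (c *\<^sub>C T) = c *\<^sub>C (mean V ^^ k) T"
  by (induction k) (simp_all add: mean_scaleC funpow_mean_bounded_ops)

lemma mean_id: "mean V id_blinfun = id_blinfun"
proof (rule blinfun_eqI, rule ell2_eqI)
  have "inner (blinfun_apply (V i) u) (blinfun_apply (V i) v) = inner u v" for i u v
    by (simp add: dot_norm norm_V blinfun.add_right[symmetric])
  then have *: "inner u (blinfun_apply (mean V id_blinfun) v) = inner u v" for u v
    by (simp add: inner_mean)
  fix u v
  let ?d = "blinfun_apply (mean V id_blinfun) v - v"
  have "inner ?d ?d = inner ?d (blinfun_apply (mean V id_blinfun) v) - inner ?d v" by (rule inner_diff_right)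
  then have "?d = 0" by (simp add: *)
  then show "cinner (ell2_unit u) (blinfun_apply (mean V id_blinfun) v) = cinner (ell2_unit u) (blinfun_apply id_blinfun v)"
    by simp
qed

lemma norm_mean_sq_le:
  "(norm (blinfun_apply (mean V T) v))\<^sup>2 \<le>
    (1 / real CARD('i)) * (\<Sum>i\<in>UNIV. (norm (blinfun_apply T (blinfun_apply (V i) v)))\<^sup>2)"
proof -
  let ?y = "blinfun_apply (mean V T) v"
  have "(norm ?y)\<^sup>2 = (1 / real CARD('i)) * (\<Sum>i\<in>UNIV. inner (blinfun_apply (V i) ?y) (blinfun_apply T (blinfun_apply (V i) v)))"
    by (simp only: power2_norm_eq_inner inner_mean)
  also have "\<dots> \<le> (1 / real CARD('i)) * (\<Sum>i\<in>UNIV. norm ?y * (1 * norm (blinfun_apply T (blinfun_apply (V i) v))))"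
    by (intro mult_left_mono sum_mono order_trans[OF norm_cauchy_schwarz]) (auto simp: norm_V)
  finally show ?thesis using sq_le_mean[of "UNIV :: 'i set" "norm ?y" 1] by simp
qed

lemma norm_mean_le: "norm (mean V T) \<le> norm T"
proof (rule norm_blinfun_bound)
  fix v
  have "(norm (blinfun_apply T (blinfun_apply (V i) v)))\<^sup>2 \<le> (norm T * norm v)\<^sup>2" for i
    using norm_blinfun[of T "blinfun_apply (V i) v"] by (intro power_mono) (auto simp: norm_V)
  then have "(\<Sum>i\<in>UNIV. (norm (blinfun_apply T (blinfun_apply (V i) v)))\<^sup>2) \<le> (\<Sum>i\<in>(UNIV::'i set). (norm T * norm v)\<^sup>2)"
    by (intro sum_mono)
  then have "(1 / real CARD('i)) * (\<Sum>i\<in>UNIV. (norm (blinfun_apply T (blinfun_apply (V i) v)))\<^sup>2) \<le> (norm T * norm v)\<^sup>2"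
    by (simp add: field_simps)
  with norm_mean_sq_le[of T v] have "(norm (blinfun_apply (mean V T) v))\<^sup>2 \<le> (norm T * norm v)\<^sup>2"
    by (rule order_trans)
  then show "norm (blinfun_apply (mean V T) v) \<le> norm T * norm v"
    by (rule power2_le_imp_le) (simp add: zero_le_mult_iff)
qed simp

lemma norm_funpow_mean_le: "norm ((mean V ^^ k) T) \<le> norm T"
  by (induction k) (auto intro: order_trans[OF norm_mean_le])

lemma cadjoint_mean: "T \<in> bounded_ops \<Longrightarrow> cadjoint (mean V T) = mean V (cadjoint T)"
proof (rule cadjoint_eqI)
  fix x y assume T: "T \<in> bounded_ops"
  have "cinner (blinfun_apply (mean V (cadjoint T)) x) y = cnj (cinner y (blinfun_apply (mean V (cadjoint T)) x))"
    by (rule cinner_commute)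
  also have "\<dots> = cinner x (blinfun_apply (mean V T) y)"
    unfolding cinner_mean cinner_cadjoint_right[OF T] by (simp add: cinner_commute[symmetric])
  finally show "cinner (blinfun_apply (mean V (cadjoint T)) x) y = cinner x (blinfun_apply (mean V T) y)" .
qed

lemma cadjoint_funpow_mean:
  "T \<in> bounded_ops \<Longrightarrow> cadjoint ((mean V ^^ k) T) = (mean V ^^ k) (cadjoint T)"
  by (induction k) (simp_all add: cadjoint_mean funpow_mean_bounded_ops)

text \<open>The square norm of an averaged vector is at most the mean of the square norms, while averaging
  turns the form of \<open>Z\<close> into exactly the mean of its values.\<close>

lemma funpow_mean_dominated:
  assumes "\<And>v. (norm (blinfun_apply T v))\<^sup>2 \<le> inner v (blinfun_apply Z v)"
  shows "(norm (blinfun_apply ((mean V ^^ k) T) v))\<^sup>2 \<le> inner v (blinfun_apply ((mean V ^^ k) Z) v)"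
proof (induction k arbitrary: v)
  case (Suc k)
  show ?case
    by (simp only: funpow.simps comp_apply inner_mean,
        rule order_trans[OF norm_mean_sq_le]) (intro mult_left_mono sum_mono Suc, simp)
qed (simp add: assms)

end

interpretation lmean: isometry_family "\<lambda>i::'n::finite. lshift [i]"
  by standard (simp_all add: lshift_bounded_ops norm_lshift)

interpretation rmean: isometry_family "\<lambda>i::'n::finite. rshift [i]"
  by standard (simp_all add: rshift_bounded_ops norm_rshift)

instance ell2 :: (type) banach ..

section \<open>Positive operators\<close>

text \<open>Stated with the real inner product, for which the estimates below are shortest. On complex-linear
  operators it agrees with positivity in the complex sense.\<close>

definition psd :: "('a::real_inner \<Rightarrow>\<^sub>L 'a) \<Rightarrow> bool" where
  "psd T \<longleftrightarrow> (\<forall>u v. inner u (blinfun_apply T v) = inner (blinfun_apply T u) v) \<and>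
     (\<forall>v. 0 \<le> inner v (blinfun_apply T v))"

lemma psdD:
  assumes "psd T"
  shows psd_sym: "inner u (blinfun_apply T v) = inner (blinfun_apply T u) v"
    and psd_nonneg: "0 \<le> inner v (blinfun_apply T v)"
  using assms by (auto simp: psd_def)

lemma psd_add: "psd S \<Longrightarrow> psd T \<Longrightarrow> psd (S + T)"
  unfolding psd_def blinfun.add_left inner_add_left inner_add_right by (auto intro: add_nonneg_nonneg)

lemma psd_zero: "psd 0" and psd_id: "psd id_blinfun"
  by (simp_all add: psd_def)

lemma psd_sum: "(\<And>i. i \<in> A \<Longrightarrow> psd (T i)) \<Longrightarrow> psd (\<Sum>i\<in>A. T i)"
  by (induction A rule: infinite_finite_induct) (auto simp: psd_add psd_zero)

lemma psd_scaleR: "psd T \<Longrightarrow> 0 \<le> r \<Longrightarrow> psd (r *\<^sub>R T)"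
  unfolding psd_def blinfun.scaleR_left inner_scaleR_left inner_scaleR_right by auto

lemma psd_limit:
  assumes "\<And>k::nat. psd (X k)" "\<And>v. (\<lambda>k. blinfun_apply (X k) v) \<longlonglongrightarrow> blinfun_apply L v"
  shows "psd L"
  unfolding psd_def
proof (intro conjI allI)
  fix u v
  show "inner u (blinfun_apply L v) = inner (blinfun_apply L u) v"
  proof (rule LIMSEQ_unique)
    show "(\<lambda>k. inner u (blinfun_apply (X k) v)) \<longlonglongrightarrow> inner u (blinfun_apply L v)"
      by (intro tendsto_intros assms)
    show "(\<lambda>k. inner u (blinfun_apply (X k) v)) \<longlonglongrightarrow> inner (blinfun_apply L u) v"
      unfolding psd_sym[OF assms(1)] by (intro tendsto_intros assms)
  qed
  show "0 \<le> inner v (blinfun_apply L v)"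
  proof (rule tendsto_lowerbound)
    show "(\<lambda>k. inner v (blinfun_apply (X k) v)) \<longlonglongrightarrow> inner v (blinfun_apply L v)"
      by (intro tendsto_intros assms)
  qed (auto simp: psd_nonneg assms)
qed

lemma psd_adjoint_compose:
  "T \<in> bounded_ops \<Longrightarrow> psd (cadjoint T o\<^sub>L (T :: 'a ell2 \<Rightarrow>\<^sub>L 'a ell2))"
  by (simp add: psd_def inner_cadjoint_left inner_cadjoint_right)

lemma cadjoint_psd: 
  assumes "psd T" "T \<in> bounded_ops"
  shows "cadjoint T = (T :: 'a ell2 \<Rightarrow>\<^sub>L 'a ell2)"
proof (rule blinfun_eqI)
  fix x
  have "inner (blinfun_apply (cadjoint T) x - blinfun_apply T x) y = 0" for y
    by (simp add: inner_diff_left inner_cadjoint_left[OF assms(2)] psd_sym[OF assms(1)])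
  from this[of "blinfun_apply (cadjoint T) x - blinfun_apply T x"]
  show "blinfun_apply (cadjoint T) x = blinfun_apply T x" unfolding inner_eq_zero_iff by simp
qed

text \<open>The form of \<open>T\<close> is nonnegative at \<open>v - T v / K\<close>.\<close>

lemma psd_norm_sq_le:
  assumes T: "psd T" and K: "\<And>v. inner v (blinfun_apply T v) \<le> K * (norm v)\<^sup>2" "0 < K"
  shows "(norm (blinfun_apply T v))\<^sup>2 \<le> K * inner v (blinfun_apply T v)"
proof -
  let ?u = "blinfun_apply T v"
  have "0 \<le> inner (v - (1/K) *\<^sub>R ?u) (blinfun_apply T (v - (1/K) *\<^sub>R ?u))" by (rule psd_nonneg[OF T])
  also have "\<dots> = inner v ?u - 2 * (1/K) * (norm ?u)\<^sup>2 + (1/K)\<^sup>2 * inner ?u (blinfun_apply T ?u)"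
    using psd_sym[OF T, of v ?u]
    by (simp add: blinfun.diff_right blinfun.scaleR_right inner_diff_left inner_diff_right
        power2_norm_eq_inner) (simp add: power2_eq_square algebra_simps diff_divide_distrib)
  also have "\<dots> \<le> inner v ?u - 2 * (1/K) * (norm ?u)\<^sup>2 + (1/K)\<^sup>2 * (K * (norm ?u)\<^sup>2)"
    by (intro add_left_mono mult_left_mono K) simp
  also have "\<dots> = inner v ?u - (norm ?u)\<^sup>2 / K" using K(2) by (simp add: power2_eq_square)
  finally show ?thesis using K(2) by (simp add: field_simps)
qed

lemma norm_le_psd:
  assumes T: "psd T" and K: "\<And>v. inner v (blinfun_apply T v) \<le> K * (norm v)\<^sup>2" "0 < K"
  shows "norm T \<le> K"
proof (rule norm_blinfun_bound)
  fix v
  have "(norm (blinfun_apply T v))\<^sup>2 \<le> K * (K * (norm v)\<^sup>2)"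
    by (rule order_trans[OF psd_norm_sq_le[OF T K]]) (intro mult_left_mono K, use K in simp)
  then have "(norm (blinfun_apply T v))\<^sup>2 \<le> (K * norm v)\<^sup>2" by (simp add: power2_eq_square mult_ac)
  then show "norm (blinfun_apply T v) \<le> K * norm v" by (rule power2_le_imp_le) (use K in simp)
qed (use K in simp)

lemma psd_eq_zero:
  assumes "psd T" "\<And>v. inner v (blinfun_apply T v) \<le> 0"
  shows "T = 0"
proof -
  have "(norm (blinfun_apply T v))\<^sup>2 \<le> 1 * inner v (blinfun_apply T v)" for v
    using assms(2) by (intro psd_norm_sq_le assms(1)) (auto intro: order_trans[OF _ zero_le_power2])
  then show ?thesis using assms(2) by (intro blinfun_eqI) (smt (verit) norm_eq_zero
        power2_less_eq_zero_iff zero_blinfun.rep_eq)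
qed

lemma psd_apply_zero:
  assumes T: "psd T" and "inner v (blinfun_apply T v) = 0"
  shows "blinfun_apply T v = 0"
proof -
  have "inner w (blinfun_apply T w) \<le> (norm T + 1) * (norm w)\<^sup>2" for w
  proof -
    have "inner w (blinfun_apply T w) \<le> norm w * (norm T * norm w)"
      by (rule order_trans[OF norm_cauchy_schwarz]) (intro mult_left_mono norm_blinfun, simp)
    also have "\<dots> \<le> (norm T + 1) * (norm w)\<^sup>2" by (simp add: power2_eq_square algebra_simps)
    finally show ?thesis .
  qed
  then have "(norm (blinfun_apply T v))\<^sup>2 \<le> (norm T + 1) * inner v (blinfun_apply T v)"
    by (intro psd_norm_sq_le T) (auto intro: add_nonneg_pos)
  then show ?thesis using assms(2) by simp
qed

context isometry_family
begin

lemma psd_mean: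
  assumes "psd T"
  shows "psd (mean V T)"
  unfolding psd_def
proof (intro conjI allI)
  fix u v
  show "inner u (blinfun_apply (mean V T) v) = inner (blinfun_apply (mean V T) u) v"
  proof -
    have "inner a (blinfun_apply T b) = inner b (blinfun_apply T a)" for a b
      unfolding psd_sym[OF assms, of a b] by (rule inner_commute)
    then show ?thesis
      unfolding inner_commute[of "blinfun_apply (mean V T) u" v] inner_mean by metis
  qed
  show "0 \<le> inner v (blinfun_apply (mean V T) v)"
    unfolding inner_mean by (intro mult_nonneg_nonneg sum_nonneg psd_nonneg assms) simp
qed

lemma psd_funpow_mean: "psd T \<Longrightarrow> psd ((mean V ^^ k) T)"
  by (induction k) (simp_all add: psd_mean)

end

section \<open>Harmonic operators and the Choi-Effros product\<close>

abbreviation lavg :: "('n::finite fock \<Rightarrow>\<^sub>L 'n fock) \<Rightarrow> ('n fock \<Rightarrow>\<^sub>L 'n fock)" where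
  "lavg \<equiv> mean (\<lambda>i. lshift [i])"

abbreviation ravg :: "('n::finite fock \<Rightarrow>\<^sub>L 'n fock) \<Rightarrow> ('n fock \<Rightarrow>\<^sub>L 'n fock)" where
  "ravg \<equiv> mean (\<lambda>i. rshift [i])"

definition words :: "nat \<Rightarrow> 'n::finite list set" where
  "words k = {w. length w = k}"

lemma finite_words_set: "finite (words k :: 'n::finite list set)"
  by (simp add: words_def finite_words)

lemma words_0: "words 0 = {[]}"
  by (auto simp: words_def)

lemma words_Suc: "words (Suc k) = (\<lambda>(i, w). i # w) ` (UNIV \<times> words k)"
  by (auto simp: words_def length_Suc_conv image_iff)

lemma card_words: "card (words k :: 'n::finite list set) = CARD('n) ^ k"
  using card_lists_length_eq[of "UNIV :: 'n set" k] by (simp add: words_def)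

lemma words_nonempty: "words k \<noteq> {}"
  by (auto simp: words_def intro: Ex_list_of_length)

lemma card_words_pos: "0 < real (card (words k :: 'n::finite list set))"
  by (simp add: card_words)

lemma sum_words_Suc: "(\<Sum>w\<in>words (Suc k). f w) = (\<Sum>i\<in>UNIV. \<Sum>w\<in>words k. f (i # w))"
  by (simp add: words_Suc sum.reindex inj_on_def sum.cartesian_product split_def)

lemma blinfun_compose_eqD:
  "S o\<^sub>L T = S' o\<^sub>L T' \<Longrightarrow> blinfun_apply S (blinfun_apply T x) = blinfun_apply S' (blinfun_apply T' x)"
  by (metis blinfun_apply_blinfun_compose)

lemma lshift_Cons: "blinfun_apply (lshift (i # w)) u = blinfun_apply (lshift [i]) (blinfun_apply (lshift w) u)"
  using lshift_compose[of "[i]" w] by (metis append_Cons append_Nil blinfun_apply_blinfun_compose)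

lemma inner_funpow_lavg:
  fixes T :: "'n::finite fock \<Rightarrow>\<^sub>L 'n fock"
  shows "inner u (blinfun_apply ((lavg ^^ m) T) v) = (1 / real (card (words m :: 'n list set))) *
    (\<Sum>w\<in>words m. inner (blinfun_apply (lshift w) u) (blinfun_apply T (blinfun_apply (lshift w) v)))"
proof (induction m arbitrary: T)
  case (Suc m)
  have "inner u (blinfun_apply ((lavg ^^ Suc m) T) v) = inner u (blinfun_apply ((lavg ^^ m) (lavg T)) v)"
    by (simp add: funpow_swap1)
  also have "\<dots> = (1 / real (card (words m :: 'n list set))) * (\<Sum>w\<in>words m. (1 / real CARD('n)) *
      (\<Sum>i\<in>UNIV. inner (blinfun_apply (lshift (i # w)) u) (blinfun_apply T (blinfun_apply (lshift (i # w)) v))))"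
    by (simp only: Suc lmean.inner_mean lshift_Cons[symmetric])
  also have "\<dots> = (1 / real (card (words (Suc m) :: 'n list set))) *
    (\<Sum>w\<in>words (Suc m). inner (blinfun_apply (lshift w) u) (blinfun_apply T (blinfun_apply (lshift w) v)))"
    by (simp add: sum_words_Suc sum.swap[of _ UNIV] sum_divide_distrib[symmetric] card_words mult_ac)
  finally show ?case .
qed (simp add: words_0 lshift_Nil)

definition harmonic_ops :: "('n::finite fock \<Rightarrow>\<^sub>L 'n fock) set" where
  "harmonic_ops = {x \<in> bounded_ops. lavg x = x}"

lemma harmD: "x \<in> harmonic_ops \<Longrightarrow> x \<in> bounded_ops" "x \<in> harmonic_ops \<Longrightarrow> lavg x = x"
  by (simp_all add: harmonic_ops_def)

lemma funpow_lavg_harm: "x \<in> harmonic_ops \<Longrightarrow> (lavg ^^ k) x = x"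
  by (induction k) (simp_all add: harmD)

lemma harm_id: "id_blinfun \<in> harmonic_ops"
  by (simp add: harmonic_ops_def bounded_ops_id lmean.mean_id)

lemma harm_add: "x \<in> harmonic_ops \<Longrightarrow> y \<in> harmonic_ops \<Longrightarrow> x + y \<in> harmonic_ops"
  by (simp add: harmonic_ops_def bounded_ops_add mean_add)

lemma harm_diff: "x \<in> harmonic_ops \<Longrightarrow> y \<in> harmonic_ops \<Longrightarrow> x - y \<in> harmonic_ops"
  by (simp add: harmonic_ops_def bounded_ops_diff mean_diff)

lemma harm_scaleR: "x \<in> harmonic_ops \<Longrightarrow> r *\<^sub>R x \<in> harmonic_ops"
  by (simp add: harmonic_ops_def bounded_ops_scaleR mean_scaleR)

lemma harm_scaleC: "x \<in> harmonic_ops \<Longrightarrow> c *\<^sub>C x \<in> harmonic_ops"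
  by (simp add: harmonic_ops_def bounded_ops_scaleC lmean.mean_scaleC)

lemma harm_zero: "0 \<in> harmonic_ops"
  by (simp add: harmonic_ops_def bounded_ops_zero mean_zero)

lemma harm_sum: "(\<And>i. i \<in> A \<Longrightarrow> x i \<in> harmonic_ops) \<Longrightarrow> (\<Sum>i\<in>A. x i) \<in> harmonic_ops"
  by (induction A rule: infinite_finite_induct) (auto simp: harm_zero harm_add)

lemma harm_cadjoint: "x \<in> harmonic_ops \<Longrightarrow> cadjoint x \<in> harmonic_ops"
  using lmean.cadjoint_mean[of x] by (simp add: harmonic_ops_def cadjoint_bounded_ops)

lemma harm_limit:
  assumes "\<And>k::nat. X k \<in> harmonic_ops" "\<And>v. (\<lambda>k. blinfun_apply (X k) v) \<longlonglongrightarrow> blinfun_apply L v"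
  shows "L \<in> harmonic_ops"
proof -
  have "lavg L = L"
  proof (rule blinfun_eqI, rule LIMSEQ_unique)
    fix v
    show "(\<lambda>k. blinfun_apply (lavg (X k)) v) \<longlonglongrightarrow> blinfun_apply (lavg L) v"
      by (rule mean_sot) (rule assms)
    show "(\<lambda>k. blinfun_apply (lavg (X k)) v) \<longlonglongrightarrow> blinfun_apply L v"
      using assms by (simp add: harmD)
  qed
  moreover have "L \<in> bounded_ops"
    by (rule bounded_ops_limit[of X]) (use assms harmD in auto)
  ultimately show ?thesis by (simp add: harmonic_ops_def)
qed

lemma harm_rshift: "rshift w \<in> harmonic_ops"
proof -
  have "lavg (rshift w) = rshift w"
  proof (rule blinfun_eqI)
    fix v
    have "blinfun_apply (rshift w) (blinfun_apply (lshift [i]) v) =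
        blinfun_apply (lshift [i]) (blinfun_apply (rshift w) v)" for i
      by (rule blinfun_compose_eqD[OF lshift_rshift[symmetric]])
    moreover have "blinfun_apply (cadjoint (lshift [i])) (blinfun_apply (lshift [i]) v) = v" for i and v :: "'a fock"
      by (simp add: lshift_def pull_push inj_append_left)
    ultimately show "blinfun_apply (lavg (rshift w)) v = blinfun_apply (rshift w) v"
      by (simp add: blinfun_apply_mean scaleR_sum_right[symmetric] sum_constant_scaleR)
  qed
  then show ?thesis by (simp add: harmonic_ops_def rshift_bounded_ops)
qed

text \<open>Right shifts commute with left shifts, so compressing by them commutes with the average.\<close>

lemma harm_sandwich:
  assumes x: "x \<in> harmonic_ops"
  shows "cadjoint (rshift v) o\<^sub>L x o\<^sub>L rshift w \<in> harmonic_ops"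
proof -
  have comm: "blinfun_apply (rshift w) (blinfun_apply (lshift [i]) u) =
      blinfun_apply (lshift [i]) (blinfun_apply (rshift w) u)" for i w and u :: "'a fock"
    by (rule blinfun_compose_eqD[OF lshift_rshift[symmetric]])
  have "lavg (cadjoint (rshift v) o\<^sub>L x o\<^sub>L rshift w) = cadjoint (rshift v) o\<^sub>L lavg x o\<^sub>L rshift w"
    by (rule blinfun_eqI, rule ell2_eqI)
       (simp add: lmean.cinner_mean cinner_cadjoint_right rshift_bounded_ops comm)
  then show ?thesis using x
    by (simp add: harmonic_ops_def bounded_ops_compose cadjoint_bounded_ops rshift_bounded_ops)
qed

text \<open>Expanding the square leaves a cross term whose average is \<open>inner t (y v)\<close>, since \<open>y\<close> is
  harmonic. The case \<open>t = y v\<close> drives convergence of the Choi-Effros product, the case of a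
  truncation \<open>t\<close> of \<open>y v\<close> the approximation by finite combinations of shifts.\<close>

lemma average_commutator_sq:
  fixes y :: "'n::finite fock \<Rightarrow>\<^sub>L 'n fock"
  assumes y: "y \<in> harmonic_ops"
  shows "(1 / real (card (words m :: 'n list set))) *
      (\<Sum>w\<in>words m. (norm (blinfun_apply y (blinfun_apply (lshift w) v) - blinfun_apply (lshift w) t))\<^sup>2) =
    inner v (blinfun_apply ((lavg ^^ m) (cadjoint y o\<^sub>L y)) v) - (norm (blinfun_apply y v))\<^sup>2
      + (norm (blinfun_apply y v - t))\<^sup>2"
proof -
  define W where "W = (words m :: 'n list set)"
  have "(norm (blinfun_apply y (blinfun_apply (lshift w) v) - blinfun_apply (lshift w) t))\<^sup>2 =
      inner (blinfun_apply (lshift w) v) (blinfun_apply (cadjoint y o\<^sub>L y) (blinfun_apply (lshift w) v))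
      - 2 * inner (blinfun_apply (lshift w) t) (blinfun_apply y (blinfun_apply (lshift w) v))
      + (norm t)\<^sup>2" for w
    by (simp add: norm_lshift[of w t, symmetric] power2_norm_eq_inner
        inner_diff_left inner_diff_right inner_cadjoint_right harmD[OF y] inner_commute)
  then have "(1 / real (card W)) * (\<Sum>w\<in>W. (norm (blinfun_apply y (blinfun_apply (lshift w) v) - blinfun_apply (lshift w) t))\<^sup>2) =
      inner v (blinfun_apply ((lavg ^^ m) (cadjoint y o\<^sub>L y)) v)
      - 2 * inner t (blinfun_apply ((lavg ^^ m) y) v) + (norm t)\<^sup>2"
    using card_words_pos[of m, where 'n = 'n] unfolding inner_funpow_lavg W_def[symmetric]
    by (simp add: sum.distrib sum_subtractf sum_distrib_left[symmetric] add_divide_distrib diff_divide_distrib)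
  also have "\<dots> = inner v (blinfun_apply ((lavg ^^ m) (cadjoint y o\<^sub>L y)) v)
      - (norm (blinfun_apply y v))\<^sup>2 + (norm (blinfun_apply y v - t))\<^sup>2"
    by (simp add: funpow_lavg_harm[OF y] power2_norm_eq_inner inner_diff_left inner_diff_right inner_commute)
  finally show ?thesis by (simp only: W_def)
qed

text \<open>The averaging defect is a Gram form of the commutators \<open>y L - L y\<close>, where \<open>L\<close> runs
  through the left shifts by words of length \<open>m\<close>; the Cauchy-Schwarz inequality separates the two
  factors.\<close>

lemma defect_bound:
  fixes y :: "'n::finite fock \<Rightarrow>\<^sub>L 'n fock"
  assumes y: "y \<in> harmonic_ops"
  shows "(norm (blinfun_apply ((lavg ^^ m) (T o\<^sub>L y) - ((lavg ^^ m) T o\<^sub>L y)) v))\<^sup>2 \<le>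
    (norm T)\<^sup>2 * (inner v (blinfun_apply ((lavg ^^ m) (cadjoint y o\<^sub>L y)) v) - (norm (blinfun_apply y v))\<^sup>2)"
proof -
  define W where "W = (words m :: 'n list set)"
  define u where "u = blinfun_apply ((lavg ^^ m) (T o\<^sub>L y) - ((lavg ^^ m) T o\<^sub>L y)) v"
  define a where "a w = blinfun_apply y (blinfun_apply (lshift w) v) - blinfun_apply (lshift w) (blinfun_apply y v)" for w
  have W: "finite W" "W \<noteq> {}"
    unfolding W_def by (rule finite_words_set words_nonempty)+
  have "inner z u = (1 / real (card W)) * (\<Sum>w\<in>W. inner (blinfun_apply (lshift w) z) (blinfun_apply T (a w)))" for z
    by (simp add: u_def blinfun.diff_left blinfun.diff_right inner_diff_right inner_funpow_lavg
        W_def[symmetric] a_def sum_subtractf diff_divide_distrib)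
  then have "(norm u)\<^sup>2 = (1 / real (card W)) * (\<Sum>w\<in>W. inner (blinfun_apply (lshift w) u) (blinfun_apply T (a w)))"
    by (simp only: power2_norm_eq_inner)
  also have "\<dots> \<le> (1 / real (card W)) * (\<Sum>w\<in>W. norm u * (norm T * norm (a w)))"
    by (intro mult_left_mono sum_mono order_trans[OF norm_cauchy_schwarz])
       (auto simp: norm_lshift norm_blinfun mult_left_mono)
  finally have "(norm u)\<^sup>2 \<le> (norm T)\<^sup>2 * ((1 / real (card W)) * (\<Sum>w\<in>W. (norm (a w))\<^sup>2))"
    by (rule sq_le_mean[OF W])
  then show ?thesis
    unfolding W_def a_def average_commutator_sq[OF y] by (simp add: u_def)
qed

text \<open>The defect after \<open>m\<close> steps is dominated by that of \<open>y\<^sup>* y\<close>, and \<open>k\<close> further averages preserve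
  the domination. Hence increments for \<open>x y\<close> are controlled by those of the increasing bounded
  sequence of forms of \<open>y\<^sup>* y\<close>.\<close>

lemma product_increment_bound:
  assumes x: "x \<in> harmonic_ops" and y: "y \<in> harmonic_ops"
  shows "(norm (blinfun_apply ((lavg ^^ (k + m)) (x o\<^sub>L y) - (lavg ^^ k) (x o\<^sub>L y)) v))\<^sup>2 \<le>
    (norm x)\<^sup>2 * (inner v (blinfun_apply ((lavg ^^ (k + m)) (cadjoint y o\<^sub>L y)) v) -
      inner v (blinfun_apply ((lavg ^^ k) (cadjoint y o\<^sub>L y)) v))"
proof -
  have "(norm (blinfun_apply ((lavg ^^ k) ((lavg ^^ m) (x o\<^sub>L y) - (x o\<^sub>L y))) v))\<^sup>2 \<le>
    inner v (blinfun_apply ((lavg ^^ k) ((norm x)\<^sup>2 *\<^sub>R ((lavg ^^ m) (cadjoint y o\<^sub>L y) - (cadjoint y o\<^sub>L y)))) v)"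
  proof (rule lmean.funpow_mean_dominated)
    fix v
    show "(norm (blinfun_apply ((lavg ^^ m) (x o\<^sub>L y) - (x o\<^sub>L y)) v))\<^sup>2 \<le>
      inner v (blinfun_apply ((norm x)\<^sup>2 *\<^sub>R ((lavg ^^ m) (cadjoint y o\<^sub>L y) - (cadjoint y o\<^sub>L y))) v)"
      using defect_bound[OF y, of m x v]
      by (simp add: funpow_lavg_harm[OF x] blinfun.diff_left blinfun.scaleR_left inner_diff_right
          inner_cadjoint_right[OF harmD(1)[OF y]] power2_norm_eq_inner)
  qed
  then show ?thesis
    by (simp add: funpow_mean_diff funpow_mean_scaleR funpow_add blinfun.diff_left blinfun.scaleR_left
        inner_diff_right)
qed

lemma square_sequence_mono:
  assumes y: "y \<in> harmonic_ops"
  shows "inner v (blinfun_apply ((lavg ^^ k) (cadjoint y o\<^sub>L y)) v) \<le>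
    inner v (blinfun_apply ((lavg ^^ (k + m)) (cadjoint y o\<^sub>L y)) v)"
proof -
  have "1 \<le> norm (id_blinfun :: 'a fock \<Rightarrow>\<^sub>L 'a fock)"
    using norm_blinfun[of "id_blinfun :: 'a fock \<Rightarrow>\<^sub>L 'a fock" vacuum] by simp
  then have "0 < (norm (id_blinfun :: 'a fock \<Rightarrow>\<^sub>L 'a fock))\<^sup>2"
    by (intro zero_less_power) linarith
  moreover have "0 \<le> (norm (id_blinfun :: 'a fock \<Rightarrow>\<^sub>L 'a fock))\<^sup>2 *
      (inner v (blinfun_apply ((lavg ^^ (k + m)) (cadjoint y o\<^sub>L y)) v) -
      inner v (blinfun_apply ((lavg ^^ k) (cadjoint y o\<^sub>L y)) v))"
    by (rule order_trans[OF _ product_increment_bound[OF harm_id y]]) simp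
  ultimately show ?thesis by (simp add: zero_le_mult_iff)
qed

lemma Cauchy_of_dominated_increments:
  fixes a :: "nat \<Rightarrow> 'a::real_normed_vector" and q :: "nat \<Rightarrow> real"
  assumes a: "\<And>k m. (norm (a (k + m) - a k))\<^sup>2 \<le> C * (q (k + m) - q k)"
    and C: "0 \<le> C" and q: "Cauchy q"
  shows "Cauchy a"
proof (rule metric_CauchyI)
  fix d :: real assume d: "0 < d"
  define r where "r = d\<^sup>2 / (C + 1)"
  have "0 < r" using d C by (simp add: r_def)
  with q obtain M where M: "\<And>m n. M \<le> m \<Longrightarrow> M \<le> n \<Longrightarrow> dist (q m) (q n) < r"
    using metric_CauchyD by meson
  have less: "dist (a (k + m)) (a k) < d" if "M \<le> k" for k m
  proof (rule power2_less_imp_less)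
    have "q (k + m) - q k \<le> r" using M[of "k + m" k] that by (simp add: dist_real_def)
    then have "(norm (a (k + m) - a k))\<^sup>2 \<le> C * r"
      by (intro order_trans[OF a] mult_left_mono C)
    also have "\<dots> < (C + 1) * r" using \<open>0 < r\<close> by simp
    also have "\<dots> = d\<^sup>2" using C by (simp add: r_def)
    finally show "(dist (a (k + m)) (a k))\<^sup>2 < d\<^sup>2" by (simp add: dist_norm)
  qed (use d in simp)
  show "\<exists>M. \<forall>m\<ge>M. \<forall>n\<ge>M. dist (a m) (a n) < d"
  proof (intro exI[of _ M] allI impI)
    fix m n assume "M \<le> m" "M \<le> n"
    then show "dist (a m) (a n) < d"
      using less[of n "m - n"] less[of m "n - m"] by (cases "n \<le> m") (simp_all add: dist_commute)
  qed
qed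

lemma sot_limit_exists:
  fixes X :: "nat \<Rightarrow> ('a::real_normed_vector \<Rightarrow>\<^sub>L 'b::banach)"
  assumes X: "\<And>v. Cauchy (\<lambda>k. blinfun_apply (X k) v)" and C: "\<And>k. norm (X k) \<le> C"
  obtains L where "norm L \<le> C" "\<And>v. (\<lambda>k. blinfun_apply (X k) v) \<longlonglongrightarrow> blinfun_apply L v"
proof -
  define f where "f v = lim (\<lambda>k. blinfun_apply (X k) v)" for v
  have f: "(\<lambda>k. blinfun_apply (X k) v) \<longlonglongrightarrow> f v" for v
    unfolding f_def using X[of v] by (simp add: Cauchy_convergent_iff convergent_LIMSEQ_iff)
  have bound: "norm (f v) \<le> C * norm v" for v
  proof (rule tendsto_upperbound[OF tendsto_norm[OF f]])
    show "\<forall>\<^sub>F k in sequentially. norm (blinfun_apply (X k) v) \<le> C * norm v"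
      by (intro always_eventually allI order_trans[OF norm_blinfun] mult_right_mono C) simp
  qed simp
  have "bounded_linear f"
  proof (rule bounded_linear_intro[where K = C])
    show "f (x + y) = f x + f y" for x y
      by (rule LIMSEQ_unique[OF f]) (simp only: blinfun.add_right, intro tendsto_add f)
    show "f (r *\<^sub>R x) = r *\<^sub>R f x" for r x
      by (rule LIMSEQ_unique[OF f]) (simp only: blinfun.scaleR_right, intro tendsto_scaleR f tendsto_const)
  qed (use bound in \<open>simp add: mult.commute\<close>)
  then have app: "blinfun_apply (Blinfun f) = f" by (rule bounded_linear_Blinfun_apply)
  have "0 \<le> C" using C[of 0] norm_ge_zero[of "X 0"] by linarith
  then have "norm (Blinfun f) \<le> C" by (intro norm_blinfun_bound) (simp_all add: app bound)
  then show thesis using that[of "Blinfun f"] f by (simp add: app)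
qed

lemma sot_lim_eqI:
  assumes "\<And>v. (\<lambda>k. blinfun_apply (X k) v) \<longlonglongrightarrow> blinfun_apply L v"
  shows "sot_lim X = L"
  unfolding sot_lim_def
proof (rule the_equality)
  fix L' assume "\<forall>v. (\<lambda>k. blinfun_apply (X k) v) \<longlonglongrightarrow> blinfun_apply L' v"
  then show "L' = L" using assms by (intro blinfun_eqI) (blast intro: LIMSEQ_unique)
qed (use assms in blast)

definition cprod :: "('n::finite fock \<Rightarrow>\<^sub>L 'n fock) \<Rightarrow> ('n fock \<Rightarrow>\<^sub>L 'n fock) \<Rightarrow> ('n fock \<Rightarrow>\<^sub>L 'n fock)" where
  "cprod x y = sot_lim (\<lambda>k. (lavg ^^ k) (x o\<^sub>L y))"

context
  fixes x y :: "'n::finite fock \<Rightarrow>\<^sub>L 'n fock"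
  assumes x: "x \<in> harmonic_ops" and y: "y \<in> harmonic_ops"
begin

lemma cprod_ex:
  obtains L where "norm L \<le> norm x * norm y"
    "\<And>v. (\<lambda>k. blinfun_apply ((lavg ^^ k) (x o\<^sub>L y)) v) \<longlonglongrightarrow> blinfun_apply L v"
proof (rule sot_limit_exists)
  show "norm ((lavg ^^ k) (x o\<^sub>L y)) \<le> norm x * norm y" for k
    by (rule order_trans[OF lmean.norm_funpow_mean_le norm_blinfun_compose])
  fix v
  define q where "q k = inner v (blinfun_apply ((lavg ^^ k) (cadjoint y o\<^sub>L y)) v)" for k
  have "incseq q" unfolding incseq_def q_def
  proof (intro allI impI)
    fix j k :: nat assume "j \<le> k"
    then show "inner v (blinfun_apply ((lavg ^^ j) (cadjoint y o\<^sub>L y)) v) \<le>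
        inner v (blinfun_apply ((lavg ^^ k) (cadjoint y o\<^sub>L y)) v)"
      using square_sequence_mono[OF y, of v j "k - j"] by simp
  qed
  moreover have "q k \<le> norm v * (norm (cadjoint y o\<^sub>L y) * norm v)" for k
    unfolding q_def
    by (rule order_trans[OF norm_cauchy_schwarz])
       (intro mult_left_mono order_trans[OF norm_blinfun] mult_right_mono lmean.norm_funpow_mean_le norm_ge_zero)
  ultimately have "convergent q"
    by (metis convergentI incseq_convergent)
  then have "Cauchy q" by (rule convergent_Cauchy)
  then show "Cauchy (\<lambda>k. blinfun_apply ((lavg ^^ k) (x o\<^sub>L y)) v)"
    by (rule Cauchy_of_dominated_increments[where C = "(norm x)\<^sup>2", rotated 2])
       (use product_increment_bound[OF x y, of _ _ v] in \<open>simp_all add: q_def blinfun.diff_left\<close>)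
qed (rule that)

lemma cprod_lim: "(\<lambda>k. blinfun_apply ((lavg ^^ k) (x o\<^sub>L y)) v) \<longlonglongrightarrow> blinfun_apply (cprod x y) v"
proof -
  obtain L where L: "\<And>v. (\<lambda>k. blinfun_apply ((lavg ^^ k) (x o\<^sub>L y)) v) \<longlonglongrightarrow> blinfun_apply L v"
    using cprod_ex by blast
  have "cprod x y = L" unfolding cprod_def by (rule sot_lim_eqI) (rule L)
  then show ?thesis using L by simp
qed

lemma norm_cprod_le: "norm (cprod x y) \<le> norm x * norm y"
proof -
  obtain L where L: "norm L \<le> norm x * norm y" "\<And>v. (\<lambda>k. blinfun_apply ((lavg ^^ k) (x o\<^sub>L y)) v) \<longlonglongrightarrow> blinfun_apply L v"
    using cprod_ex by blast
  have "cprod x y = L" unfolding cprod_def by (rule sot_lim_eqI) (rule L)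
  then show ?thesis using L by simp
qed

lemma cprod_eqI:
  assumes "\<And>v. (\<lambda>k. blinfun_apply ((lavg ^^ k) (x o\<^sub>L y)) v) \<longlonglongrightarrow> blinfun_apply L v"
  shows "cprod x y = L"
  unfolding cprod_def by (rule sot_lim_eqI) (rule assms)

lemma cprod_harm: "cprod x y \<in> harmonic_ops"
proof -
  have "cprod x y \<in> bounded_ops"
    by (rule bounded_ops_limit[OF lmean.funpow_mean_bounded_ops cprod_lim])
       (intro bounded_ops_compose harmD x y)
  moreover have "lavg (cprod x y) = cprod x y"
  proof (rule blinfun_eqI, rule LIMSEQ_unique)
    fix v
    show "(\<lambda>k. blinfun_apply (lavg ((lavg ^^ k) (x o\<^sub>L y))) v) \<longlonglongrightarrow> blinfun_apply (lavg (cprod x y)) v"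
      by (rule mean_sot) (rule cprod_lim)
    show "(\<lambda>k. blinfun_apply (lavg ((lavg ^^ k) (x o\<^sub>L y))) v) \<longlonglongrightarrow> blinfun_apply (cprod x y) v"
      using LIMSEQ_Suc[OF cprod_lim[of v]] by simp
  qed
  ultimately show ?thesis by (simp add: harmonic_ops_def)
qed

lemma cprod_eq_compose: "x o\<^sub>L y \<in> harmonic_ops \<Longrightarrow> cprod x y = x o\<^sub>L y"
  by (rule cprod_eqI) (simp add: funpow_lavg_harm)

end

lemma cprod_id:
  assumes x: "x \<in> harmonic_ops"
  shows "cprod id_blinfun x = x" "cprod x id_blinfun = x"
proof -
  have "id_blinfun o\<^sub>L x = x" "x o\<^sub>L id_blinfun = x" by (rule blinfun_eqI; simp)+
  then show "cprod id_blinfun x = x" "cprod x id_blinfun = x"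
    unfolding cprod_def by (auto intro!: sot_lim_eqI simp: funpow_lavg_harm[OF x])
qed

lemma cadjoint_cprod:
  assumes x: "x \<in> harmonic_ops" and y: "y \<in> harmonic_ops"
  shows "cadjoint (cprod x y) = cprod (cadjoint y) (cadjoint x)"
proof (rule cadjoint_eqI)
  fix u v
  have xy: "x o\<^sub>L y \<in> bounded_ops" by (intro bounded_ops_compose harmD x y)
  show "cinner (blinfun_apply (cprod (cadjoint y) (cadjoint x)) u) v = cinner u (blinfun_apply (cprod x y) v)"
  proof (rule LIMSEQ_unique)
    have "(\<lambda>k. cnj (cinner v (blinfun_apply ((lavg ^^ k) (cadjoint y o\<^sub>L cadjoint x)) u))) \<longlonglongrightarrow>
        cnj (cinner v (blinfun_apply (cprod (cadjoint y) (cadjoint x)) u))"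
      by (intro tendsto_cnj bounded_linear.tendsto[OF bounded_linear_cinner_right] cprod_lim
          harm_cadjoint x y)
    then show "(\<lambda>k. cinner u (blinfun_apply ((lavg ^^ k) (x o\<^sub>L y)) v)) \<longlonglongrightarrow>
        cinner (blinfun_apply (cprod (cadjoint y) (cadjoint x)) u) v"
      unfolding cinner_commute[symmetric] cadjoint_compose[OF harmD(1)[OF x] harmD(1)[OF y], symmetric]
        lmean.cadjoint_funpow_mean[OF xy, symmetric]
        cinner_cadjoint_left[OF lmean.funpow_mean_bounded_ops[OF xy]] .
    show "(\<lambda>k. cinner u (blinfun_apply ((lavg ^^ k) (x o\<^sub>L y)) v)) \<longlonglongrightarrow> cinner u (blinfun_apply (cprod x y) v)"
      by (intro bounded_linear.tendsto[OF bounded_linear_cinner_right] cprod_lim x y)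
  qed
qed

lemma cprod_add_left:
  assumes "x \<in> harmonic_ops" "x' \<in> harmonic_ops" "y \<in> harmonic_ops"
  shows "cprod (x + x') y = cprod x y + cprod x' y"
proof (rule cprod_eqI)
  fix v
  have "(x + x') o\<^sub>L y = (x o\<^sub>L y) + (x' o\<^sub>L y)" by (rule blinfun_eqI) (simp add: blinfun.add_left)
  then show "(\<lambda>k. blinfun_apply ((lavg ^^ k) ((x + x') o\<^sub>L y)) v) \<longlonglongrightarrow> blinfun_apply (cprod x y + cprod x' y) v"
    by (simp add: funpow_mean_add blinfun.add_left) (intro tendsto_add cprod_lim assms)
qed (intro harm_add assms)+

lemma cprod_diff_left:
  assumes "x \<in> harmonic_ops" "x' \<in> harmonic_ops" "y \<in> harmonic_ops"
  shows "cprod (x - x') y = cprod x y - cprod x' y"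
  using cprod_add_left[OF harm_diff[OF assms(1,2)] assms(2,3)] by simp

lemma cprod_diff_right:
  assumes "x \<in> harmonic_ops" "y \<in> harmonic_ops" "y' \<in> harmonic_ops"
  shows "cprod x (y - y') = cprod x y - cprod x y'"
proof (rule cprod_eqI)
  fix v
  have "x o\<^sub>L (y - y') = (x o\<^sub>L y) - (x o\<^sub>L y')" by (rule blinfun_eqI) (simp add: blinfun.diff_left blinfun.diff_right)
  then show "(\<lambda>k. blinfun_apply ((lavg ^^ k) (x o\<^sub>L (y - y'))) v) \<longlonglongrightarrow> blinfun_apply (cprod x y - cprod x y') v"
    by (simp add: funpow_mean_diff blinfun.diff_left) (intro tendsto_diff cprod_lim assms)
qed (intro harm_diff assms)+

lemma psd_cprod_square:
  assumes y: "y \<in> harmonic_ops"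
  shows "psd (cprod (cadjoint y) y)"
  by (rule psd_limit[OF lmean.psd_funpow_mean[OF psd_adjoint_compose] cprod_lim])
     (intro harmD harm_cadjoint y)+

lemma norm_sq_le_cprod_square:
  assumes y: "y \<in> harmonic_ops"
  shows "(norm (blinfun_apply y v))\<^sup>2 \<le> inner v (blinfun_apply (cprod (cadjoint y) y) v)"
proof (rule tendsto_lowerbound)
  show "(\<lambda>k. inner v (blinfun_apply ((lavg ^^ k) (cadjoint y o\<^sub>L y)) v)) \<longlonglongrightarrow> inner v (blinfun_apply (cprod (cadjoint y) y) v)"
    by (intro tendsto_inner tendsto_const cprod_lim harm_cadjoint y)
  show "\<forall>\<^sub>F k in sequentially. (norm (blinfun_apply y v))\<^sup>2 \<le> inner v (blinfun_apply ((lavg ^^ k) (cadjoint y o\<^sub>L y)) v)"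
    using square_sequence_mono[OF y, of v 0]
    by (simp add: inner_cadjoint_right harmD[OF y] power2_norm_eq_inner)
qed simp

section \<open>Square roots for the Choi-Effros product\<close>

lemma scaleR_eq_scaleC_blinfun: "r *\<^sub>R T = complex_of_real r *\<^sub>C (T :: 'a::real_normed_vector \<Rightarrow>\<^sub>L 'b::complex_inner)"
  by (rule blinfun_eqI) (simp add: scaleC_blinfun_apply blinfun.scaleR_left scaleR_scaleC)

lemma cadjoint_scaleR:
  "T \<in> bounded_ops \<Longrightarrow> cadjoint (r *\<^sub>R T) = r *\<^sub>R cadjoint (T :: 'a ell2 \<Rightarrow>\<^sub>L 'a ell2)"
  by (simp add: scaleR_eq_scaleC_blinfun cadjoint_scaleC)

lemma cadjoint_diff:
  assumes "S \<in> bounded_ops" "T \<in> bounded_ops"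
  shows "cadjoint (S - T) = cadjoint S - cadjoint (T :: 'a ell2 \<Rightarrow>\<^sub>L 'a ell2)"
  using cadjoint_add[OF bounded_ops_diff[OF assms] assms(2)] by (simp add: algebra_simps)

lemma cadjoint_limit:
  assumes X: "X \<longlonglongrightarrow> L" "\<And>k::nat. X k \<in> bounded_ops" "\<And>k. cadjoint (X k) = X k"
  shows "cadjoint L = (L :: 'a ell2 \<Rightarrow>\<^sub>L 'a ell2)"
proof (rule cadjoint_eqI, rule LIMSEQ_unique)
  fix u v
  have lim: "(\<lambda>k. blinfun_apply (X k) v) \<longlonglongrightarrow> blinfun_apply L v" for v
    by (rule blinfun.tendsto[OF X(1) tendsto_const])
  show "(\<lambda>k. cinner u (blinfun_apply (X k) v)) \<longlonglongrightarrow> cinner u (blinfun_apply L v)"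
    by (rule bounded_linear.tendsto[OF bounded_linear_cinner_right lim])
  have "(\<lambda>k. cnj (cinner v (blinfun_apply (X k) u))) \<longlonglongrightarrow> cnj (cinner v (blinfun_apply L u))"
    by (rule tendsto_cnj[OF bounded_linear.tendsto[OF bounded_linear_cinner_right lim]])
  moreover have "cnj (cinner v (blinfun_apply (X k) u)) = cinner u (blinfun_apply (X k) v)" for k
    using cinner_cadjoint_left[OF X(2)[of k], of u v] by (simp add: X(3) cinner_commute[of "blinfun_apply (X k) u" v])
  ultimately show "(\<lambda>k. cinner u (blinfun_apply (X k) v)) \<longlonglongrightarrow> cinner (blinfun_apply L u) v"
    by (simp add: cinner_commute[of "blinfun_apply L u" v])
qed

lemma inner_le_norm_op: "inner v (blinfun_apply T v) \<le> norm T * (norm v)\<^sup>2"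
proof -
  have "inner v (blinfun_apply T v) \<le> norm v * (norm T * norm v)"
    by (rule order_trans[OF norm_cauchy_schwarz]) (intro mult_left_mono norm_blinfun, simp)
  then show ?thesis by (simp add: power2_eq_square mult_ac)
qed

lemma psd_diffI:
  assumes "psd S" "psd T" "\<And>v. inner v (blinfun_apply S v) \<le> inner v (blinfun_apply T v)"
  shows "psd (T - S)"
  using assms by (simp add: psd_def blinfun.diff_left inner_diff_left inner_diff_right)

lemma psd_diffD: "psd (T - S) \<Longrightarrow> inner v (blinfun_apply S v) \<le> inner v (blinfun_apply T v)"
  using psd_nonneg[of "T - S" v] by (simp add: blinfun.diff_left inner_diff_right)

text \<open>The root is \<open>1 - y\<close>, where \<open>y\<close> solves \<open>y = (t + y \<circ> y) / 2\<close> for \<open>t = 1 - x\<close>. The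
  right-hand side is a contraction of a ball of radius below one because \<open>x\<close> is bounded away
  from zero. This uses only bilinearity, the unit and submultiplicativity of the product.\<close>

lemma harm_sqrt:
  fixes x :: "'n::finite fock \<Rightarrow>\<^sub>L 'n fock"
  assumes x: "x \<in> harmonic_ops" "psd x" and d: "0 < d" "d < 1"
    and lower: "\<And>v. d * (norm v)\<^sup>2 \<le> inner v (blinfun_apply x v)"
    and upper: "\<And>v. inner v (blinfun_apply x v) \<le> (norm v)\<^sup>2"
  shows "\<exists>a\<in>harmonic_ops. cadjoint a = a \<and> cprod a a = x"
proof -
  define t where "t = id_blinfun - x"
  define r where "r = 1 - sqrt d"
  have r: "0 < r" "r < 1" using d by (simp_all add: r_def)
  have t: "t \<in> harmonic_ops" unfolding t_def by (intro harm_diff harm_id x)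
  have "psd t" unfolding t_def
    by (rule psd_diffI[OF x(2) psd_id]) (use upper in \<open>simp add: power2_norm_eq_inner\<close>)
  then have nt: "norm t \<le> 1 - d"
    by (rule norm_le_psd)
       (use lower d in \<open>simp_all add: t_def blinfun.diff_left inner_diff_right power2_norm_eq_inner left_diff_distrib\<close>)
  have ct: "cadjoint t = t" by (rule cadjoint_psd[OF \<open>psd t\<close> harmD(1)[OF t]])
  define S where "S = {y \<in> harmonic_ops :: ('n fock \<Rightarrow>\<^sub>L 'n fock) set. cadjoint y = y \<and> norm y \<le> r}"
  define f where "f y = (1/2) *\<^sub>R (t + cprod y y)" for y
  have "complete S"
    unfolding complete_eq_closed closed_sequential_limits
  proof (intro allI impI)
    fix X L assume "(\<forall>n. X n \<in> S) \<and> X \<longlonglongrightarrow> L"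
    then have XS: "\<And>n. X n \<in> S" and lim: "X \<longlonglongrightarrow> L" by auto
    have "L \<in> harmonic_ops"
      by (rule harm_limit[of X]) (use XS in \<open>auto simp: S_def intro: blinfun.tendsto[OF lim tendsto_const]\<close>)
    moreover have "cadjoint L = L"
      by (rule cadjoint_limit[OF lim]) (use XS in \<open>auto simp: S_def harmD\<close>)
    moreover have "norm L \<le> r"
      by (rule tendsto_upperbound[OF tendsto_norm[OF lim]]) (use XS in \<open>auto simp: S_def\<close>)
    ultimately show "L \<in> S" by (simp add: S_def)
  qed
  moreover have "0 \<in> S" using r by (auto simp: S_def harm_zero intro!: cadjoint_eqI)
  moreover have "f ` S \<subseteq> S"
  proof safe
    fix y assume "y \<in> S"
    then have y: "y \<in> harmonic_ops" "cadjoint y = y" "norm y \<le> r" by (auto simp: S_def)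
    have yy: "cprod y y \<in> harmonic_ops" by (rule cprod_harm[OF y(1,1)])
    have "norm (cprod y y) \<le> norm y * norm y" by (rule norm_cprod_le[OF y(1,1)])
    also have "\<dots> \<le> r * r" using y(3) r by (intro mult_mono) auto
    finally have "norm (t + cprod y y) \<le> (1 - d) + r * r"
      by (rule norm_triangle_mono[OF nt])
    also have "\<dots> = 2 * r"
      using d(1) by (simp add: r_def algebra_simps)
    finally have "norm (f y) \<le> r" by (simp add: f_def)
    moreover have "cadjoint (f y) = f y"
      unfolding f_def using cadjoint_cprod[OF y(1,1)] y(2) ct harmD(1)[OF t] harmD(1)[OF yy]
      by (simp add: cadjoint_scaleR cadjoint_add bounded_ops_add)
    ultimately show "f y \<in> S" by (simp add: S_def f_def harm_scaleR harm_add t yy)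
  qed
  moreover have "dist (f y) (f y') \<le> r * dist y y'" if "y \<in> S" "y' \<in> S" for y y'
  proof -
    have y: "y \<in> harmonic_ops" "y' \<in> harmonic_ops" "norm y \<le> r" "norm y' \<le> r" using that by (auto simp: S_def)
    have "f y - f y' = (1/2) *\<^sub>R (cprod y (y - y') + cprod (y - y') y')"
      by (simp add: f_def cprod_diff_left[OF y(1,2,2)] cprod_diff_right[OF y(1,1,2)] scaleR_diff_right[symmetric])
    moreover have "norm (cprod y (y - y')) \<le> r * norm (y - y')"
      by (rule order_trans[OF norm_cprod_le]) (auto intro!: harm_diff mult_right_mono y)
    moreover have "norm (cprod (y - y') y') \<le> r * norm (y - y')"
      unfolding mult.commute[of r]
      by (rule order_trans[OF norm_cprod_le]) (auto intro!: harm_diff mult_left_mono y)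
    ultimately have "norm (f y - f y') \<le> (1/2) * (r * norm (y - y') + r * norm (y - y'))"
      using norm_triangle_ineq[of "cprod y (y - y')" "cprod (y - y') y'"] by simp
    then show ?thesis by (simp add: dist_norm)
  qed
  ultimately have "\<exists>!y\<in>S. f y = y"
    using r by (intro Banach_fix[where c = r]) auto
  then obtain y where "y \<in> S" and fy: "f y = y" by blast
  then have y: "y \<in> harmonic_ops" "cadjoint y = y" by (auto simp: S_def)
  have "cprod y y = 2 *\<^sub>R f y - t" by (simp add: f_def)
  then have yy: "cprod y y = 2 *\<^sub>R y - t" by (simp only: fy)
  have "cprod (id_blinfun - y) (id_blinfun - y) = id_blinfun - y - (y - cprod y y)"
    using y by (simp add: cprod_diff_left cprod_diff_right harm_diff harm_id cprod_id)
  also have "\<dots> = x" by (simp add: yy t_def scaleR_2)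
  finally show ?thesis
    using y by (intro bexI[of _ "id_blinfun - y"])
      (simp_all add: harm_diff harm_id cadjoint_diff harmD bounded_ops_id)
qed

section \<open>Monotone limits\<close>

text \<open>For a difference \<open>T\<close> of members of the sequence, the square norm of \<open>T v\<close> is at most a constant
  times \<open>inner v (T v)\<close>, and these forms are differences of a convergent real sequence.\<close>

lemma decreasing_psd_limit:
  fixes X :: "nat \<Rightarrow> 'a ell2 \<Rightarrow>\<^sub>L 'a ell2"
  assumes pos: "\<And>k. psd (X k)" and dec: "\<And>k m. psd (X k - X (k + m))"
  obtains L where "\<And>v. (\<lambda>k. blinfun_apply (X k) v) \<longlonglongrightarrow> blinfun_apply L v"
    "psd L" "\<And>k. psd (X k - L)"
proof -
  define K where "K = norm (X 0) + 1"
  have K: "0 < K" by (simp add: K_def add_nonneg_pos)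
  have le: "inner v (blinfun_apply (X k) v) \<le> K * (norm v)\<^sup>2" for k v
  proof -
    have "inner v (blinfun_apply (X k) v) \<le> inner v (blinfun_apply (X 0) v)"
      using psd_diffD[OF dec[of 0 k]] by simp
    also have "\<dots> \<le> norm (X 0) * (norm v)\<^sup>2" by (rule inner_le_norm_op)
    also have "\<dots> \<le> K * (norm v)\<^sup>2" unfolding K_def by (intro mult_right_mono) auto
    finally show ?thesis .
  qed
  have "Cauchy (\<lambda>k. blinfun_apply (X k) v)" for v
  proof (rule Cauchy_of_dominated_increments)
    let ?q = "\<lambda>k. - inner v (blinfun_apply (X k) v)"
    have "incseq ?q"
      unfolding incseq_def
    proof (intro allI impI)
      fix j k :: nat assume "j \<le> k"
      then show "?q j \<le> ?q k" using psd_diffD[OF dec[of j "k - j"], of v] by simp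
    qed
    moreover have "?q k \<le> 0" for k using psd_nonneg[OF pos] by simp
    ultimately have "convergent ?q" by (metis convergentI incseq_convergent)
    then show "Cauchy ?q" by (rule convergent_Cauchy)
    fix k m
    have "(norm (blinfun_apply (X k - X (k + m)) v))\<^sup>2 \<le> K * inner v (blinfun_apply (X k - X (k + m)) v)"
    proof (rule psd_norm_sq_le[OF dec _ K])
      show "inner w (blinfun_apply (X k - X (k + m)) w) \<le> K * (norm w)\<^sup>2" for w
        using le[of w k] psd_nonneg[OF pos, of w "k + m"]
        by (simp add: blinfun.diff_left inner_diff_right)
    qed
    then show "(norm (blinfun_apply (X (k + m)) v - blinfun_apply (X k) v))\<^sup>2 \<le> K * (?q (k + m) - ?q k)"
      by (simp add: blinfun.diff_left inner_diff_right norm_minus_commute)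
  qed (use K in simp)
  moreover have "norm (X k) \<le> K" for k by (rule norm_le_psd[OF pos le K])
  ultimately obtain L where L: "\<And>v. (\<lambda>k. blinfun_apply (X k) v) \<longlonglongrightarrow> blinfun_apply L v"
    using sot_limit_exists[of X K] by blast
  have "psd L" by (rule psd_limit[OF pos L])
  moreover have "psd (X k - L)" for k
  proof (rule psd_limit)
    show "psd (X k - X (k + m))" for m by (rule dec)
    show "(\<lambda>m. blinfun_apply (X k - X (k + m)) v) \<longlonglongrightarrow> blinfun_apply (X k - L) v" for v
      unfolding blinfun.diff_left add.commute[of k]
      by (intro tendsto_diff tendsto_const LIMSEQ_ignore_initial_segment L)
  qed
  ultimately show thesis using L that by blast
qed

text \<open>By harmonicity the vacuum value is the mean of the diagonal entries over the words of any given
  length, so all diagonal entries of \<open>Z\<close> vanish.\<close>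

lemma harm_faithful:
  fixes Z :: "'n::finite fock \<Rightarrow>\<^sub>L 'n fock"
  assumes Z: "Z \<in> harmonic_ops" "psd Z" and zero: "inner vacuum (blinfun_apply Z vacuum) \<le> 0"
  shows "Z = 0"
proof (rule bounded_ops_eq_on_units[OF harmD(1)[OF Z(1)] bounded_ops_zero])
  fix w :: "'n list"
  define m where "m = length w"
  have "inner vacuum (blinfun_apply ((lavg ^^ m) Z) vacuum) \<le> 0"
    using zero by (simp add: funpow_lavg_harm[OF Z(1)])
  then have "(\<Sum>v\<in>words m. inner (ell2_unit v) (blinfun_apply Z (ell2_unit v))) \<le> 0"
    using card_words_pos[of m, where 'n = 'n]
    unfolding inner_funpow_lavg lshift_unit append_Nil2
    by (simp only: mult_le_0_iff zero_less_divide_1_iff) simp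
  then have "(\<Sum>v\<in>words m. inner (ell2_unit v) (blinfun_apply Z (ell2_unit v))) = 0"
    by (intro antisym sum_nonneg psd_nonneg Z)
  then have "inner (ell2_unit w) (blinfun_apply Z (ell2_unit w)) = 0"
    using sum_nonneg_eq_0_iff[OF finite_words_set[of m], of "\<lambda>v. inner (ell2_unit v) (blinfun_apply Z (ell2_unit v))"]
    by (simp add: psd_nonneg[OF Z(2)]) (simp add: m_def words_def)
  then show "blinfun_apply Z (ell2_unit w) = blinfun_apply 0 (ell2_unit w)"
    using psd_apply_zero[OF Z(2)] by simp
qed

section \<open>Bounded harmonic cut-offs of positive harmonic operators\<close>

text \<open>The inverse of \<open>1 + s\<close> is the fixed point of \<open>g \<mapsto> (1 + (K - s) g) / (1 + K)\<close>; positivity of \<open>s\<close>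
  gives \<open>K - s\<close> norm at most \<open>K\<close>, which makes this a contraction.\<close>

lemma resolvent_exists:
  fixes s :: "'a ell2 \<Rightarrow>\<^sub>L 'a ell2"
  assumes s: "s \<in> bounded_ops" "psd s"
  shows "\<exists>g. g \<in> bounded_ops \<and> (\<forall>v. blinfun_apply g v + blinfun_apply s (blinfun_apply g v) = v)"
proof -
  define K where "K = norm s + 1"
  have K: "0 < K" by (simp add: K_def add_nonneg_pos)
  let ?B = "K *\<^sub>R id_blinfun - s"
  have sK: "inner v (blinfun_apply s v) \<le> K * (norm v)\<^sup>2" for v
    by (rule order_trans[OF inner_le_norm_op]) (simp add: K_def mult_right_mono)
  have "psd ?B"
    by (rule psd_diffI[OF s(2) psd_scaleR[OF psd_id]])
       (use sK K in \<open>auto simp: blinfun.scaleR_left power2_norm_eq_inner\<close>)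
  then have nB: "norm ?B \<le> K"
    by (rule norm_le_psd)
       (use psd_nonneg[OF s(2)] K in \<open>auto simp: blinfun.diff_left blinfun.scaleR_left inner_diff_right power2_norm_eq_inner\<close>)
  define f where "f g = (1 / (1 + K)) *\<^sub>R (id_blinfun + (?B o\<^sub>L g))" for g
  have "\<exists>!g\<in>bounded_ops. f g = g"
  proof (rule Banach_fix[where c = "K / (1 + K)"])
    show "complete (bounded_ops :: ('a ell2 \<Rightarrow>\<^sub>L 'a ell2) set)"
      unfolding complete_eq_closed by (rule closed_bounded_ops)
    show "f ` bounded_ops \<subseteq> bounded_ops"
      unfolding f_def by (auto intro!: bounded_ops_intros s)
    show "bounded_ops \<noteq> ({} :: ('a ell2 \<Rightarrow>\<^sub>L 'a ell2) set)" using bounded_ops_zero by blast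
    show "dist (f x) (f y) \<le> K / (1 + K) * dist x y" for x y
    proof -
      have eq: "f x - f y = (1 / (1 + K)) *\<^sub>R (?B o\<^sub>L (x - y))"
        by (rule blinfun_eqI) (simp add: f_def blinfun.scaleR_left blinfun.add_left blinfun.diff_left
            blinfun.diff_right scaleR_diff_right scaleR_add_right)
      have "norm (?B o\<^sub>L (x - y)) \<le> K * norm (x - y)"
        by (rule order_trans[OF norm_blinfun_compose mult_right_mono[OF nB norm_ge_zero]])
      then show "dist (f x) (f y) \<le> K / (1 + K) * dist x y"
        using K by (simp add: dist_norm eq divide_right_mono)
    qed
  qed (use K in auto)
  then obtain g where g: "g \<in> bounded_ops" "f g = g" by blast
  have "(1 + K) *\<^sub>R g = (1 + K) *\<^sub>R f g" by (simp only: g)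
  also have "\<dots> = id_blinfun + (?B o\<^sub>L g)" using K by (simp add: f_def)
  finally have eq: "(1 + K) *\<^sub>R g = id_blinfun + (?B o\<^sub>L g)" .
  have "blinfun_apply g v + blinfun_apply s (blinfun_apply g v) = v" for v
    using arg_cong[OF eq, of "\<lambda>T. blinfun_apply T v"]
    by (simp add: blinfun.scaleR_left blinfun.add_left blinfun.diff_left scaleR_add_left algebra_simps)
  with g show ?thesis by blast
qed

definition resolvent :: "('a ell2 \<Rightarrow>\<^sub>L 'a ell2) \<Rightarrow> ('a ell2 \<Rightarrow>\<^sub>L 'a ell2)" where
  "resolvent s = (SOME g. g \<in> bounded_ops \<and> (\<forall>v. blinfun_apply g v + blinfun_apply s (blinfun_apply g v) = v))"

context
  fixes s :: "'a ell2 \<Rightarrow>\<^sub>L 'a ell2"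
  assumes s: "s \<in> bounded_ops" "psd s"
begin

lemma resolvent_bounded_ops: "resolvent s \<in> bounded_ops"
  and resolvent_eq: "blinfun_apply (resolvent s) v + blinfun_apply s (blinfun_apply (resolvent s) v) = v"
  using someI_ex[OF resolvent_exists[OF s]] unfolding resolvent_def by blast+

lemma resolvent_form:
  "inner v (blinfun_apply (resolvent s) v) = (norm (blinfun_apply (resolvent s) v))\<^sup>2 +
    inner (blinfun_apply (resolvent s) v) (blinfun_apply s (blinfun_apply (resolvent s) v))"
proof -
  let ?w = "blinfun_apply (resolvent s) v"
  have "inner v ?w = inner (?w + blinfun_apply s ?w) ?w" by (simp only: resolvent_eq)
  then show ?thesis by (simp only: inner_add_left power2_norm_eq_inner inner_commute[of "blinfun_apply s ?w"])
qed

lemma psd_resolvent: "psd (resolvent s)"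
  unfolding psd_def
proof (intro conjI allI)
  fix u v
  let ?u = "blinfun_apply (resolvent s) u" and ?v = "blinfun_apply (resolvent s) v"
  have "inner (?u + blinfun_apply s ?u) ?v = inner ?u (?v + blinfun_apply s ?v)"
    by (simp add: inner_add_left inner_add_right psd_sym[OF s(2)])
  then show "inner u ?v = inner ?u v" by (simp only: resolvent_eq)
  show "0 \<le> inner v ?v" unfolding resolvent_form by (intro add_nonneg_nonneg psd_nonneg s(2)) simp
qed

text \<open>The form of \<open>(1 + s)\<^sup>-\<^sup>1\<close> at \<open>u\<close> is the maximum over \<open>v\<close> of the left-hand side.\<close>

lemma resolvent_variational:
  "2 * inner u v - (norm v)\<^sup>2 - inner v (blinfun_apply s v) \<le> inner u (blinfun_apply (resolvent s) u)"
proof -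
  define w where "w = blinfun_apply (resolvent s) u"
  have u: "u = w + blinfun_apply s w" by (simp only: w_def resolvent_eq)
  have "0 \<le> (norm (w - v))\<^sup>2 + inner (w - v) (blinfun_apply s (w - v))"
    by (intro add_nonneg_nonneg psd_nonneg s(2)) simp
  also have "\<dots> = inner u w - (2 * inner u v - (norm v)\<^sup>2 - inner v (blinfun_apply s v))"
    using psd_sym[OF s(2), of w v]
    by (simp add: u power2_norm_eq_inner blinfun.diff_right inner_diff_left inner_diff_right
        inner_add_left inner_commute algebra_simps)
  finally show ?thesis by (simp add: w_def)
qed

lemma resolvent_lower: "(norm u)\<^sup>2 - inner u (blinfun_apply s u) \<le> inner u (blinfun_apply (resolvent s) u)"
  using resolvent_variational[of u u] by (simp add: power2_norm_eq_inner)

text \<open>With \<open>w = (1 + s)\<^sup>-\<^sup>1 u\<close> one has \<open>u - w = s w\<close>, and \<open>inner u (u - w)\<close> is the sum of the form of \<open>s\<close>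
  at \<open>w\<close>, which dominates that of \<open>p\<close>, and the square norm of \<open>u - w\<close>, which dominates the form of
  \<open>p\<close> at \<open>u - w\<close> up to the factor \<open>C\<close>. So \<open>s (1 + s)\<^sup>-\<^sup>1\<close> dominates a multiple of \<open>p\<close>.\<close>

lemma resolvent_upper:
  assumes p: "psd p" "psd (s - p)" "\<And>v. inner v (blinfun_apply p v) \<le> C * (norm v)\<^sup>2" and C: "0 \<le> C"
  shows "inner u (blinfun_apply (resolvent s) u) + (1 / (2 * (1 + C))) * inner u (blinfun_apply p u) \<le> (norm u)\<^sup>2"
proof -
  define w where "w = blinfun_apply (resolvent s) u"
  have u: "u = w + blinfun_apply s w" by (simp only: w_def resolvent_eq)
  let ?p = "\<lambda>v. inner v (blinfun_apply p v)"
  \<comment> \<open>Parallelogram inequality for the form of \<open>p\<close> at \<open>u = w + (u - w)\<close>.\<close>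
  have "0 \<le> ?p (2 *\<^sub>R w - u)" by (rule psd_nonneg[OF p(1)])
  also have "\<dots> = 2 * ?p w + 2 * ?p (u - w) - ?p u"
    using psd_sym[OF p(1), of u w]
    by (simp add: blinfun.diff_right blinfun.scaleR_right inner_diff_left inner_diff_right
        inner_commute algebra_simps)
  finally have "?p u \<le> 2 * ?p w + 2 * (C * (norm (u - w))\<^sup>2)" using p(3)[of "u - w"] by simp
  also have "\<dots> \<le> 2 * (1 + C) * ?p w + 2 * (1 + C) * (norm (u - w))\<^sup>2"
    using C psd_nonneg[OF p(1), of w] by (simp add: algebra_simps)
  also have "\<dots> = (2 * (1 + C)) * (?p w + (norm (u - w))\<^sup>2)" by (simp add: algebra_simps)
  finally have "(1 / (2 * (1 + C))) * ?p u \<le> ?p w + (norm (u - w))\<^sup>2"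
    using C by (simp add: divide_le_eq mult.commute)
  also have "?p w \<le> inner w (blinfun_apply s w)" by (rule psd_diffD[OF p(2)])
  also have "inner w (blinfun_apply s w) + (norm (u - w))\<^sup>2 = (norm u)\<^sup>2 - inner u w"
    by (simp add: u power2_norm_eq_inner inner_add_left inner_add_right inner_commute)
  finally show ?thesis by (simp add: w_def)
qed

end

lemma resolvent_antimono:
  assumes s: "s \<in> bounded_ops" "psd s" and t: "t \<in> bounded_ops" "psd t" and le: "psd (t - s)"
  shows "psd (resolvent s - resolvent t)"
proof (rule psd_diffI[OF psd_resolvent[OF t] psd_resolvent[OF s]])
  fix u
  let ?w = "blinfun_apply (resolvent t) u"
  have "u = ?w + blinfun_apply t ?w" by (simp only: resolvent_eq[OF t])
  then have "inner u ?w = 2 * inner u ?w - (norm ?w)\<^sup>2 - inner ?w (blinfun_apply t ?w)"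
    using resolvent_form[OF t, of u] by simp
  also have "\<dots> \<le> 2 * inner u ?w - (norm ?w)\<^sup>2 - inner ?w (blinfun_apply s ?w)"
    using psd_diffD[OF le, of ?w] by simp
  also have "\<dots> \<le> inner u (blinfun_apply (resolvent s) u)" by (rule resolvent_variational[OF s])
  finally show "inner u ?w \<le> inner u (blinfun_apply (resolvent s) u)" .
qed

text \<open>Inserting the vectors \<open>V v\<close> and \<open>V (1 + s)\<^sup>-\<^sup>1 v\<close> into the variational formula and averaging
  over the shifts \<open>V\<close> gives the operator Jensen inequality for the resolvent.\<close>

lemma resolvent_subharmonic:
  fixes s :: "'n::finite fock \<Rightarrow>\<^sub>L 'n fock"
  assumes s: "s \<in> harmonic_ops" "psd s"
  shows "psd (lavg (resolvent s) - resolvent s)"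
proof (rule psd_diffI)
  note s' = harmD(1)[OF s(1)] s(2)
  show "psd (resolvent s)" "psd (lavg (resolvent s))"
    by (simp_all add: psd_resolvent[OF s'] lmean.psd_mean)
  fix v
  let ?w = "blinfun_apply (resolvent s) v"
  let ?V = "\<lambda>i::'n. blinfun_apply (lshift [i])"
  have isom: "inner (?V i v) (?V i ?w) = inner v ?w" for i
    using cinner_push[OF inj_append_left[of "[i]"], of v ?w] by (simp add: lshift_def inner_eq_Re_cinner)
  have "inner v ?w = 2 * inner v ?w - (norm ?w)\<^sup>2 - inner ?w (blinfun_apply (lavg s) ?w)"
    using resolvent_form[OF s', of v] by (simp add: harmD(2)[OF s(1)])
  also have "\<dots> = (1 / real CARD('n)) * (\<Sum>i\<in>UNIV. 2 * inner (?V i v) (?V i ?w) - (norm (?V i ?w))\<^sup>2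
      - inner (?V i ?w) (blinfun_apply s (?V i ?w)))"
    unfolding lmean.inner_mean norm_lshift isom by (simp add: sum_subtractf diff_divide_distrib)
  also have "\<dots> \<le> (1 / real CARD('n)) * (\<Sum>i\<in>UNIV. inner (?V i v) (blinfun_apply (resolvent s) (?V i v)))"
    by (intro mult_left_mono sum_mono resolvent_variational[OF s']) simp
  also have "\<dots> = inner v (blinfun_apply (lavg (resolvent s)) v)"
    by (simp only: lmean.inner_mean)
  finally show "inner v ?w \<le> inner v (blinfun_apply (lavg (resolvent s)) v)" .
qed

text \<open>The operator \<open>1 - (1 + s)\<^sup>-\<^sup>1 = s (1 + s)\<^sup>-\<^sup>1\<close> is superharmonic, so its averages decrease; the limit
  is a harmonic operator below both \<open>s\<close> and \<open>1\<close>.\<close>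

definition cutoff :: "('n::finite fock \<Rightarrow>\<^sub>L 'n fock) \<Rightarrow> ('n fock \<Rightarrow>\<^sub>L 'n fock)" where
  "cutoff s = sot_lim (\<lambda>j. (lavg ^^ j) (id_blinfun - resolvent s))"

lemma psd_id_resolvent:
  assumes "s \<in> bounded_ops" "psd s"
  shows "psd (id_blinfun - resolvent s)"
proof (rule psd_diffI[OF psd_resolvent[OF assms] psd_id])
  fix v
  show "inner v (blinfun_apply (resolvent s) v) \<le> inner v (blinfun_apply id_blinfun v)"
    using resolvent_upper[OF assms psd_zero, of 0 v] assms by (simp add: power2_norm_eq_inner)
qed

context
  fixes s :: "'n::finite fock \<Rightarrow>\<^sub>L 'n fock"
  assumes s: "s \<in> harmonic_ops" "psd s"
begin

lemma cutoff_props: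
  shows cutoff_lim: "(\<lambda>j. blinfun_apply ((lavg ^^ j) (id_blinfun - resolvent s)) v) \<longlonglongrightarrow> blinfun_apply (cutoff s) v"
    and psd_cutoff: "psd (cutoff s)"
    and cutoff_le: "psd (id_blinfun - resolvent s - cutoff s)"
proof -
  note s' = harmD(1)[OF s(1)] s(2)
  let ?X = "\<lambda>j. (lavg ^^ j) (id_blinfun - resolvent s)"
  have inc: "psd ((lavg ^^ m) (resolvent s) - resolvent s)" for m
  proof (induction m)
    case (Suc m)
    have "psd ((lavg ^^ m) (lavg (resolvent s) - resolvent s) + ((lavg ^^ m) (resolvent s) - resolvent s))"
      by (intro psd_add Suc lmean.psd_funpow_mean resolvent_subharmonic s)
    then show ?case by (simp add: funpow_mean_diff funpow_swap1)
  qed (simp add: psd_zero)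
  have pos: "psd (?X j)" for j by (intro lmean.psd_funpow_mean psd_id_resolvent s')
  have dec: "psd (?X j - ?X (j + m))" for j m
  proof -
    have "psd ((lavg ^^ j) ((lavg ^^ m) (resolvent s) - resolvent s))"
      by (intro lmean.psd_funpow_mean inc)
    then show ?thesis by (simp add: funpow_mean_diff funpow_add funpow_lavg_harm[OF harm_id])
  qed
  obtain L where L: "\<And>v. (\<lambda>j. blinfun_apply (?X j) v) \<longlonglongrightarrow> blinfun_apply L v" "psd L" "\<And>j. psd (?X j - L)"
    using decreasing_psd_limit[of ?X, OF pos dec] by blast
  have eq: "cutoff s = L" unfolding cutoff_def by (rule sot_lim_eqI) (rule L(1))
  show "(\<lambda>j. blinfun_apply (?X j) v) \<longlonglongrightarrow> blinfun_apply (cutoff s) v" "psd (cutoff s)"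
    "psd (id_blinfun - resolvent s - cutoff s)"
    using L(1)[of v] L(2) L(3)[of 0] by (simp_all add: eq)
qed

lemma cutoff_harm: "cutoff s \<in> harmonic_ops"
proof -
  have "cutoff s \<in> bounded_ops"
    by (rule bounded_ops_limit[OF lmean.funpow_mean_bounded_ops cutoff_lim])
       (intro bounded_ops_diff bounded_ops_id resolvent_bounded_ops harmD s)
  moreover have "lavg (cutoff s) = cutoff s"
  proof (rule blinfun_eqI, rule LIMSEQ_unique)
    fix v
    let ?X = "\<lambda>j. (lavg ^^ j) (id_blinfun - resolvent s)"
    show "(\<lambda>j. blinfun_apply (lavg (?X j)) v) \<longlonglongrightarrow> blinfun_apply (lavg (cutoff s)) v"
      by (rule mean_sot) (rule cutoff_lim)
    show "(\<lambda>j. blinfun_apply (lavg (?X j)) v) \<longlonglongrightarrow> blinfun_apply (cutoff s) v"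
      using LIMSEQ_Suc[OF cutoff_lim[of v]] by simp
  qed
  ultimately show ?thesis by (simp add: harmonic_ops_def)
qed

lemma cutoff_le_id: "psd (id_blinfun - cutoff s)"
  using psd_add[OF cutoff_le psd_resolvent[OF harmD(1)[OF s(1)] s(2)]] by simp

lemma cutoff_le_self: "inner v (blinfun_apply (cutoff s) v) \<le> inner v (blinfun_apply s v)"
  using psd_diffD[OF cutoff_le, of v] resolvent_lower[of s v] s
  by (simp add: harmD blinfun.diff_left inner_diff_right power2_norm_eq_inner)

lemma cutoff_ge:
  assumes p: "p \<in> harmonic_ops" "psd p" "psd (s - p)" "\<And>v. inner v (blinfun_apply p v) \<le> C * (norm v)\<^sup>2" and C: "0 \<le> C"
  shows "psd (cutoff s - (1 / (2 * (1 + C))) *\<^sub>R p)"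
proof (rule psd_limit)
  let ?c = "1 / (2 * (1 + C))"
  note s' = harmD(1)[OF s(1)] s(2)
  have "psd (id_blinfun - resolvent s - ?c *\<^sub>R p)"
  proof (rule psd_diffI)
    show "psd (?c *\<^sub>R p)" using C by (intro psd_scaleR p) simp
    show "psd (id_blinfun - resolvent s)" by (rule psd_id_resolvent[OF s'])
    show "inner v (blinfun_apply (?c *\<^sub>R p) v) \<le> inner v (blinfun_apply (id_blinfun - resolvent s) v)" for v
      using resolvent_upper[OF s' p(2-4) C, of v]
      by (simp add: blinfun.diff_left blinfun.scaleR_left inner_diff_right power2_norm_eq_inner)
  qed
  then show "psd ((lavg ^^ j) (id_blinfun - resolvent s - ?c *\<^sub>R p))" for j
    by (rule lmean.psd_funpow_mean)
  show "(\<lambda>j. blinfun_apply ((lavg ^^ j) (id_blinfun - resolvent s - ?c *\<^sub>R p)) v) \<longlonglongrightarrow>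
      blinfun_apply (cutoff s - ?c *\<^sub>R p) v" for v
    unfolding funpow_mean_diff[of _ _ _ "?c *\<^sub>R p"] funpow_lavg_harm[OF harm_scaleR[OF p(1)]]
      blinfun.diff_left[of _ "?c *\<^sub>R p"]
    by (intro tendsto_diff tendsto_const cutoff_lim)
qed

end

lemma cutoff_mono:
  assumes s: "s \<in> harmonic_ops" "psd s" and t: "t \<in> harmonic_ops" "psd t" and le: "psd (t - s)"
  shows "psd (cutoff t - cutoff s)"
proof (rule psd_limit)
  show "psd ((lavg ^^ j) (resolvent s - resolvent t))" for j
    by (intro lmean.psd_funpow_mean resolvent_antimono harmD s t le)
  have "resolvent s - resolvent t = (id_blinfun - resolvent t) - (id_blinfun - resolvent s)" by simp
  then show "(\<lambda>j. blinfun_apply ((lavg ^^ j) (resolvent s - resolvent t)) v) \<longlonglongrightarrow>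
      blinfun_apply (cutoff t - cutoff s) v" for v
    by (simp only: funpow_mean_diff[of _ _ "id_blinfun - _"] blinfun.diff_left[of "(lavg ^^ _) (id_blinfun - _)"]
        blinfun.diff_left[of "cutoff _"]) (intro tendsto_diff cutoff_lim s t)
qed

section \<open>Automorphisms are positive and normal\<close>

text \<open>Only the values on harmonic operators are constrained, so that conjugations and compositions are
  instances without being restricted first.\<close>

locale harm_aut =
  fixes \<beta> :: "('n::finite fock \<Rightarrow>\<^sub>L 'n fock) \<Rightarrow> ('n fock \<Rightarrow>\<^sub>L 'n fock)"
  assumes bij: "bij_betw \<beta> harmonic_ops harmonic_ops"
    and add: "x \<in> harmonic_ops \<Longrightarrow> y \<in> harmonic_ops \<Longrightarrow> \<beta> (x + y) = \<beta> x + \<beta> y"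
    and scaleC: "x \<in> harmonic_ops \<Longrightarrow> \<beta> (c *\<^sub>C x) = c *\<^sub>C \<beta> x"
    and cprod: "x \<in> harmonic_ops \<Longrightarrow> y \<in> harmonic_ops \<Longrightarrow> \<beta> (cprod x y) = cprod (\<beta> x) (\<beta> y)"
    and cadjoint: "x \<in> harmonic_ops \<Longrightarrow> \<beta> (cadjoint x) = cadjoint (\<beta> x)"
begin

lemma closed [simp, intro]: "x \<in> harmonic_ops \<Longrightarrow> \<beta> x \<in> harmonic_ops"
  using bij by (auto simp: bij_betw_def)

lemma scaleR: "x \<in> harmonic_ops \<Longrightarrow> \<beta> (r *\<^sub>R x) = r *\<^sub>R \<beta> x"
  by (simp add: scaleR_eq_scaleC_blinfun scaleC)

lemma diff: "x \<in> harmonic_ops \<Longrightarrow> y \<in> harmonic_ops \<Longrightarrow> \<beta> (x - y) = \<beta> x - \<beta> y"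
  using add[of "x - y" y] by (simp add: harm_diff)

lemma zero: "\<beta> 0 = 0"
  using diff[OF harm_zero harm_zero] by simp

lemma sum: "(\<And>i. i \<in> A \<Longrightarrow> x i \<in> harmonic_ops) \<Longrightarrow> \<beta> (\<Sum>i\<in>A. x i) = (\<Sum>i\<in>A. \<beta> (x i))"
  by (induction A rule: infinite_finite_induct) (auto simp: zero add harm_sum)

lemma one: "\<beta> id_blinfun = id_blinfun"
proof -
  obtain z where z: "z \<in> harmonic_ops" "\<beta> z = id_blinfun"
    using bij harm_id unfolding bij_betw_def by (metis imageE)
  have "id_blinfun = \<beta> (cprod id_blinfun z)" by (simp add: cprod_id z)
  also have "\<dots> = cprod (\<beta> id_blinfun) id_blinfun" by (simp add: cprod harm_id z)
  also have "\<dots> = \<beta> id_blinfun" by (simp add: cprod_id harm_id closed)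
  finally show ?thesis by simp
qed

lemma inverse: "harm_aut (inv_into harmonic_ops \<beta>)"
proof -
  let ?g = "inv_into harmonic_ops \<beta>"
  have inj: "inj_on \<beta> harmonic_ops" and img: "\<beta> ` harmonic_ops = harmonic_ops" using bij by (auto simp: bij_betw_def)
  have g: "x \<in> harmonic_ops \<Longrightarrow> ?g x \<in> harmonic_ops" "x \<in> harmonic_ops \<Longrightarrow> \<beta> (?g x) = x" for x
    by (simp_all add: inv_into_into f_inv_into_f img)
  have eqI: "?g x = y" if "y \<in> harmonic_ops" "\<beta> y = x" for x y
    using inv_into_f_f[OF inj that(1)] that(2) by simp
  show ?thesis
  proof
    show "bij_betw ?g harmonic_ops harmonic_ops" by (rule bij_betw_inv_into[OF bij])
  qed (auto intro!: eqI simp: g harm_add harm_scaleC cprod_harm harm_cadjoint add scaleC cprod cadjoint)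
qed

text \<open>A strictly positive operator is a square of a selfadjoint one, and so is its image. The general
  case follows by adding small multiples of the identity.\<close>

lemma psd_image:
  assumes x: "x \<in> harmonic_ops" "psd x"
  shows "psd (\<beta> x)"
proof -
  define K where "K = norm x + 2"
  have K: "0 < K" "norm x + 1 \<le> K" "1 < K" using norm_ge_zero[of x] unfolding K_def by linarith+
  have shifted: "psd (\<beta> x + r *\<^sub>R id_blinfun)" if r: "0 < r" "r \<le> 1" for r
  proof -
    define z where "z = (1/K) *\<^sub>R (x + r *\<^sub>R id_blinfun)"
    have z: "z \<in> harmonic_ops" "psd z"
      unfolding z_def using K r by (auto intro!: harm_scaleR harm_add harm_id x psd_scaleR psd_add psd_id)
    have "\<exists>a\<in>harmonic_ops. cadjoint a = a \<and> cprod a a = z"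
    proof (rule harm_sqrt[OF z, of "r / K"])
      show "0 < r / K" "r / K < 1" using r K by simp_all
      fix v
      have form: "inner v (blinfun_apply z v) = (1/K) * (inner v (blinfun_apply x v) + r * (norm v)\<^sup>2)"
        by (simp add: z_def blinfun.scaleR_left blinfun.add_left inner_add_right power2_norm_eq_inner)
      show "r / K * (norm v)\<^sup>2 \<le> inner v (blinfun_apply z v)"
        unfolding form using K psd_nonneg[OF x(2), of v] by (simp add: divide_right_mono)
      have "inner v (blinfun_apply x v) + r * (norm v)\<^sup>2 \<le> norm x * (norm v)\<^sup>2 + 1 * (norm v)\<^sup>2"
        by (intro add_mono inner_le_norm_op mult_right_mono r) simp
      also have "\<dots> \<le> K * (norm v)\<^sup>2" unfolding distrib_right[symmetric] using K by (intro mult_right_mono) auto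
      finally show "inner v (blinfun_apply z v) \<le> (norm v)\<^sup>2"
        unfolding form using K by (simp add: divide_le_eq mult.commute)
    qed
    then obtain a where a: "a \<in> harmonic_ops" "cadjoint a = a" "cprod a a = z" by blast
    have "psd (cprod (cadjoint (\<beta> a)) (\<beta> a))" by (rule psd_cprod_square) (simp add: a)
    also have "cprod (cadjoint (\<beta> a)) (\<beta> a) = \<beta> z"
      using cadjoint[OF a(1)] cprod[OF a(1,1)] by (simp add: a)
    finally have "psd (K *\<^sub>R \<beta> z)" by (rule psd_scaleR) (use K in simp)
    moreover have "K *\<^sub>R \<beta> z = \<beta> x + r *\<^sub>R id_blinfun"
      using K x(1) by (simp add: z_def scaleR add harm_add harm_scaleR harm_id one)
    ultimately show ?thesis by simp
  qed
  have lim: "(\<lambda>k. blinfun_apply (\<beta> x + inverse (real (Suc k)) *\<^sub>R id_blinfun) v) \<longlonglongrightarrow> blinfun_apply (\<beta> x) v" for v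
    unfolding blinfun.add_left blinfun.scaleR_left
    using tendsto_add[OF tendsto_const tendsto_scaleR[OF LIMSEQ_inverse_real_of_nat tendsto_const]] by simp
  show ?thesis
    by (rule psd_limit[OF _ lim], rule shifted) (simp_all add: inverse_le_1_iff)
qed

end

lemma psd_sum_diff:
  "finite B \<Longrightarrow> A \<subseteq> B \<Longrightarrow> (\<And>i. i \<in> B \<Longrightarrow> psd (p i)) \<Longrightarrow> psd ((\<Sum>i\<in>B. p i) - (\<Sum>i\<in>A. p i))"
  by (subst sum_diff[symmetric]) (auto intro!: psd_sum)

lemma sum_half_powers_le: "(\<Sum>k\<in>{m..<N}. (1/2 :: real) ^ k) \<le> 2 * (1/2) ^ m"
proof (cases "m \<le> N")
  case True
  then have "(\<Sum>k\<in>{m..<N}. (1/2 :: real) ^ k) = 2 * (1/2) ^ m - 2 * (1/2) ^ N"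
    by (induction N rule: dec_induct) auto
  then show ?thesis by simp
qed simp

text \<open>Normality in a sequential form. The operators \<open>Z m\<close> are suprema of the cut-offs of
  \<open>p m + \<dots> + p (N - 1)\<close>; they decrease to zero because the vacuum state is faithful on
  harmonic operators, and so do their images, since \<open>\<beta>\<close> is an order isomorphism. As \<open>Z m\<close>
  dominates a fixed multiple of \<open>p m\<close>, the images of the \<open>p m\<close> become small as well.\<close>

lemma (in harm_aut) vacuum_state_normal:
  assumes p: "\<And>k. p k \<in> harmonic_ops" "\<And>k. psd (p k)" "\<And>k v. inner v (blinfun_apply (p k) v) \<le> C * (norm v)\<^sup>2"
    and C: "0 \<le> C" and small: "\<And>k::nat. inner vacuum (blinfun_apply (p k) vacuum) \<le> (1/2) ^ k"
    and \<delta>: "0 < \<delta>"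
  shows "\<exists>k. inner vacuum (blinfun_apply (\<beta> (p k)) vacuum) < \<delta>"
proof (rule ccontr)
  assume "\<not> ?thesis"
  then have large: "\<delta> \<le> inner vacuum (blinfun_apply (\<beta> (p k)) vacuum)" for k by (simp add: not_less)
  define c where "c = 1 / (2 * (1 + C))"
  have c: "0 < c" using C by (simp add: c_def)
  define S where "S m N = (\<Sum>k\<in>{m..<N}. p k)" for m N
  have S: "S m N \<in> harmonic_ops" "psd (S m N)" for m N
    unfolding S_def by (auto intro!: harm_sum psd_sum p)
  define H where "H m N = cutoff (S m N)" for m N
  have H: "H m N \<in> harmonic_ops" "psd (H m N)" for m N
    unfolding H_def by (auto intro!: cutoff_harm psd_cutoff S)
  have H_mono: "psd (H m' N' - H m N)" if "m' \<le> m" "N \<le> N'" for m m' N N'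
    unfolding H_def using that by (intro cutoff_mono S) (auto simp: S_def intro!: psd_sum_diff p)
  have "\<exists>L. (\<forall>v. (\<lambda>N. blinfun_apply (id_blinfun - H m N) v) \<longlonglongrightarrow> blinfun_apply L v) \<and>
      (\<forall>N. psd (id_blinfun - H m N - L))" for m
  proof -
    have "psd (id_blinfun - H m N)" for N unfolding H_def by (intro cutoff_le_id S)
    moreover have "psd (id_blinfun - H m N - (id_blinfun - H m (N + j)))" for N j
      using H_mono[of m m N "N + j"] by simp
    ultimately obtain L where "\<And>v. (\<lambda>N. blinfun_apply (id_blinfun - H m N) v) \<longlonglongrightarrow> blinfun_apply L v"
        "\<And>N. psd (id_blinfun - H m N - L)"
      using decreasing_psd_limit[of "\<lambda>N. id_blinfun - H m N"] by blast
    then show ?thesis by blast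
  qed
  then obtain L where L: "\<And>m v. (\<lambda>N. blinfun_apply (id_blinfun - H m N) v) \<longlonglongrightarrow> blinfun_apply (L m) v"
      "\<And>m N. psd (id_blinfun - H m N - L m)"
    by metis
  define Z where "Z m = id_blinfun - L m" for m
  have Z_lim: "(\<lambda>N. blinfun_apply (H m N) v) \<longlonglongrightarrow> blinfun_apply (Z m) v" for m v
    using tendsto_diff[OF tendsto_const[of v] L(1)[of m v]] by (simp add: Z_def blinfun.diff_left)
  have Z: "Z m \<in> harmonic_ops" "psd (Z m)" for m
    using harm_limit[OF H(1) Z_lim] psd_limit[OF H(2) Z_lim] by blast+
  have Z_ge: "psd (Z m - H m N)" for m N
    using L(2)[of m N] by (simp add: Z_def algebra_simps)
  have Z_dec: "psd (Z m - Z (m + j))" for m j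
  proof (rule psd_limit)
    show "psd (H m N - H (m + j) N)" for N by (rule H_mono) auto
    show "(\<lambda>N. blinfun_apply (H m N - H (m + j) N) v) \<longlonglongrightarrow> blinfun_apply (Z m - Z (m + j)) v" for v
      unfolding blinfun.diff_left by (intro tendsto_diff Z_lim)
  qed
  have Z_small: "inner vacuum (blinfun_apply (Z m) vacuum) \<le> 2 * (1/2) ^ m" for m
  proof (rule tendsto_upperbound)
    show "(\<lambda>N. inner vacuum (blinfun_apply (H m N) vacuum)) \<longlonglongrightarrow> inner vacuum (blinfun_apply (Z m) vacuum)"
      by (intro tendsto_inner tendsto_const Z_lim)
    have "inner vacuum (blinfun_apply (H m N) vacuum) \<le> 2 * (1/2) ^ m" for N
    proof -
      have "inner vacuum (blinfun_apply (H m N) vacuum) \<le> inner vacuum (blinfun_apply (S m N) vacuum)"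
        unfolding H_def by (rule cutoff_le_self[OF S])
      also have "\<dots> = (\<Sum>k\<in>{m..<N}. inner vacuum (blinfun_apply (p k) vacuum))"
        by (simp add: S_def blinfun.sum_left inner_sum_right)
      also have "\<dots> \<le> (\<Sum>k\<in>{m..<N}. (1/2) ^ k)" by (intro sum_mono small)
      also have "\<dots> \<le> 2 * (1/2) ^ m" by (rule sum_half_powers_le)
      finally show ?thesis .
    qed
    then show "\<forall>\<^sub>F N in sequentially. inner vacuum (blinfun_apply (H m N) vacuum) \<le> 2 * (1/2) ^ m"
      by (intro always_eventually allI)
  qed simp
  obtain Z' where Z': "\<And>v. (\<lambda>m. blinfun_apply (Z m) v) \<longlonglongrightarrow> blinfun_apply Z' v" "psd Z'"
      "\<And>m. psd (Z m - Z')"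
    by (rule decreasing_psd_limit[of Z, OF Z(2) Z_dec]) (rule that)
  have "Z' \<in> harmonic_ops" by (rule harm_limit[OF Z(1) Z'(1)])
  moreover have "inner vacuum (blinfun_apply Z' vacuum) \<le> 0"
  proof (rule LIMSEQ_le)
    show "(\<lambda>m. inner vacuum (blinfun_apply (Z m) vacuum)) \<longlonglongrightarrow> inner vacuum (blinfun_apply Z' vacuum)"
      by (intro tendsto_inner tendsto_const Z')
    show "(\<lambda>m. 2 * (1/2 :: real) ^ m) \<longlonglongrightarrow> 0"
      by (intro tendsto_mult_right_zero LIMSEQ_realpow_zero) auto
  qed (simp add: Z_small)
  ultimately have "Z' = 0" by (intro harm_faithful Z'(2))
  have \<beta>_dec: "psd (\<beta> (Z m) - \<beta> (Z (m + j)))" for m j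
    using psd_image[OF harm_diff[OF Z(1) Z(1)] Z_dec] by (simp add: diff Z)
  obtain Y where Y: "\<And>v. (\<lambda>m. blinfun_apply (\<beta> (Z m)) v) \<longlonglongrightarrow> blinfun_apply Y v" "psd Y"
      "\<And>m. psd (\<beta> (Z m) - Y)"
    by (rule decreasing_psd_limit[of "\<lambda>m. \<beta> (Z m)", OF psd_image[OF Z] \<beta>_dec]) (rule that)
  have Y_harm: "Y \<in> harmonic_ops" by (rule harm_limit[OF _ Y(1)]) (simp add: Z)
  interpret inv: harm_aut "inv_into harmonic_ops \<beta>" by (rule inverse)
  define y where "y = inv_into harmonic_ops \<beta> Y"
  have y: "y \<in> harmonic_ops" "\<beta> y = Y"
    using Y_harm bij by (simp_all add: y_def f_inv_into_f bij_betw_def)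
  have "psd y" unfolding y_def by (rule inv.psd_image[OF Y_harm Y(2)])
  have "inv_into harmonic_ops \<beta> (\<beta> (Z m) - Y) = Z m - y" for m
    using bij Z Y_harm by (simp add: inv.diff y_def bij_betw_def)
  then have le: "psd (Z m - y)" for m
    using inv.psd_image[OF harm_diff[OF _ Y_harm] Y(3)[of m]] Z by simp
  have "inner v (blinfun_apply y v) \<le> 0" for v
  proof (rule tendsto_lowerbound)
    show "(\<lambda>m. inner v (blinfun_apply (Z m) v)) \<longlonglongrightarrow> 0"
      using tendsto_inner[OF tendsto_const Z'(1)[of v]] by (simp add: \<open>Z' = 0\<close>)
  qed (simp_all add: psd_diffD[OF le])
  then have "y = 0" by (rule psd_eq_zero[OF \<open>psd y\<close>])
  then have "Y = 0" using y(2) zero by simp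
  then have "(\<lambda>m. inner vacuum (blinfun_apply (\<beta> (Z m)) vacuum)) \<longlonglongrightarrow> 0"
    using tendsto_inner[OF tendsto_const Y(1)[of vacuum]] by simp
  moreover have "c * \<delta> \<le> inner vacuum (blinfun_apply (\<beta> (Z m)) vacuum)" for m
  proof -
    have "psd (H m (Suc m) - c *\<^sub>R p m)"
      unfolding H_def c_def by (rule cutoff_ge[OF S p(1,2) _ p(3) C]) (simp add: S_def psd_zero)
    then have "psd (Z m - c *\<^sub>R p m)"
      using psd_add[OF Z_ge[of m "Suc m"]] by fastforce
    then have "psd (\<beta> (Z m) - c *\<^sub>R \<beta> (p m))"
      using psd_image[OF harm_diff[OF Z(1) harm_scaleR[OF p(1)]]] by (simp add: diff scaleR Z p harm_scaleR)
    then have "c * inner vacuum (blinfun_apply (\<beta> (p m)) vacuum) \<le> inner vacuum (blinfun_apply (\<beta> (Z m)) vacuum)"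
      using psd_diffD by (fastforce simp: blinfun.scaleR_left)
    with large[of m] c show ?thesis by (meson mult_left_mono order_less_imp_le order_trans)
  qed
  ultimately have "c * \<delta> \<le> 0" by (intro tendsto_lowerbound) auto
  then show False using c \<delta> by (simp add: mult_le_0_iff)
qed

section \<open>Right averages converge to the vacuum state\<close>

lemma sum_words_add:
  "(\<Sum>w\<in>words (k + l). f w) = (\<Sum>u\<in>words k. \<Sum>w\<in>words l. f (u @ w :: 'n::finite list))"
  by (induction k arbitrary: f) (simp_all add: words_0 sum_words_Suc)

lemma sum_words_snoc:
  "(\<Sum>w\<in>words (Suc k). f w) = (\<Sum>w\<in>words k. \<Sum>i\<in>UNIV. f (w @ [i :: 'n::finite]))"
  using sum_words_add[of f k 1] by (simp add: sum_words_Suc words_0)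

text \<open>A normalized Hilbert-Schmidt norm of the columns at words of length \<open>m\<close>. For harmonic \<open>x\<close> it
  increases with \<open>m\<close> to the vacuum value of the Choi-Effros product of \<open>x\<^sup>*\<close> and \<open>x\<close>, the square of the
  Hilbert norm given by the vacuum state.\<close>

definition hs_norm_sq :: "nat \<Rightarrow> ('n::finite fock \<Rightarrow>\<^sub>L 'n fock) \<Rightarrow> real" where
  "hs_norm_sq m T = (1 / real (card (words m :: 'n list set))) *
    (\<Sum>w\<in>words m. (norm (blinfun_apply T (ell2_unit w)))\<^sup>2)"

lemma hs_norm_sq_harm:
  assumes "x \<in> harmonic_ops"
  shows "hs_norm_sq m x = inner vacuum (blinfun_apply ((lavg ^^ m) (cadjoint x o\<^sub>L x)) vacuum)"
  by (simp add: hs_norm_sq_def inner_funpow_lavg lshift_unit inner_cadjoint_right harmD[OF assms]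
      power2_norm_eq_inner)

lemma hs_norm_sq_le:
  fixes T :: "'n::finite fock \<Rightarrow>\<^sub>L 'n fock"
  shows "hs_norm_sq m T \<le> (norm T)\<^sup>2"
proof -
  have "(\<Sum>w\<in>(words m :: 'n list set). (norm (blinfun_apply T (ell2_unit w)))\<^sup>2) \<le> (\<Sum>w\<in>(words m :: 'n list set). (norm T)\<^sup>2)"
    using norm_blinfun[of T "ell2_unit _"] by (intro sum_mono power_mono) simp_all
  also have "\<dots> = real (card (words m :: 'n list set)) * (norm T)\<^sup>2" by simp
  finally show ?thesis
    using card_words_pos[of m, where 'n = 'n] by (simp add: hs_norm_sq_def divide_le_eq mult.commute)
qed

lemma hs_norm_sq_add:
  fixes S T :: "'n::finite fock \<Rightarrow>\<^sub>L 'n fock"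
  shows "hs_norm_sq m (S + T) \<le> 2 * hs_norm_sq m S + 2 * hs_norm_sq m T"
proof -
  have "(norm (a + b))\<^sup>2 \<le> 2 * (norm a)\<^sup>2 + 2 * (norm b)\<^sup>2" for a b :: "'n fock"
  proof -
    have "0 \<le> (norm (a - b))\<^sup>2" by simp
    then show ?thesis
      by (simp add: power2_norm_eq_inner inner_add_left inner_add_right inner_diff_left inner_diff_right inner_commute)
  qed
  then have "hs_norm_sq m (S + T) \<le> (1 / real (card (words m :: 'n list set))) *
      (\<Sum>w\<in>words m. 2 * (norm (blinfun_apply S (ell2_unit w)))\<^sup>2 + 2 * (norm (blinfun_apply T (ell2_unit w)))\<^sup>2)"
    unfolding hs_norm_sq_def blinfun.add_left by (intro mult_left_mono sum_mono) simp_all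
  then show ?thesis
    by (simp add: hs_norm_sq_def sum.distrib sum_distrib_left[symmetric] add_divide_distrib)
qed

lemma hs_norm_sq_ravg:
  fixes T :: "'n::finite fock \<Rightarrow>\<^sub>L 'n fock"
  shows "hs_norm_sq m (ravg T) \<le> hs_norm_sq (Suc m) T"
proof -
  have "hs_norm_sq m (ravg T) \<le> (1 / real (card (words m :: 'n list set))) * (\<Sum>w\<in>words m.
      (1 / real CARD('n)) * (\<Sum>i\<in>UNIV. (norm (blinfun_apply T (ell2_unit (w @ [i]))))\<^sup>2))"
    unfolding hs_norm_sq_def rshift_unit[symmetric]
    by (intro mult_left_mono sum_mono rmean.norm_mean_sq_le) simp
  also have "\<dots> = hs_norm_sq (Suc m) T"
    by (simp add: hs_norm_sq_def sum_words_snoc card_words sum_divide_distrib[symmetric])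
  finally show ?thesis .
qed

lemma hs_norm_sq_funpow_ravg: "hs_norm_sq m ((ravg ^^ k) T) \<le> hs_norm_sq (m + k) T"
proof (induction k arbitrary: m)
  case (Suc k)
  have "hs_norm_sq m ((ravg ^^ Suc k) T) \<le> hs_norm_sq (Suc m) ((ravg ^^ k) T)"
    by (simp add: hs_norm_sq_ravg)
  also have "\<dots> \<le> hs_norm_sq (Suc m + k) T" by (rule Suc)
  finally show ?case by simp
qed simp

definition ravg_ergodic :: "('n::finite fock \<Rightarrow>\<^sub>L 'n fock) \<Rightarrow> bool" where
  "ravg_ergodic T \<longleftrightarrow> T \<in> bounded_ops \<and> (\<exists>c. (\<lambda>k. (ravg ^^ k) T) \<longlonglongrightarrow> c *\<^sub>C id_blinfun)"

lemma scaleC_add_left_blinfun: "(c + d) *\<^sub>C (T :: 'a::real_normed_vector \<Rightarrow>\<^sub>L 'b::complex_inner) = c *\<^sub>C T + d *\<^sub>C T"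
  by (rule blinfun_eqI) (simp add: scaleC_blinfun_apply blinfun.add_left scaleC_add_left)

lemma scaleC_scaleC_blinfun: "c *\<^sub>C d *\<^sub>C (T :: 'a::real_normed_vector \<Rightarrow>\<^sub>L 'b::complex_inner) = (c * d) *\<^sub>C T"
  by (rule blinfun_eqI) (simp add: scaleC_blinfun_apply scaleC_scaleC)

lemma norm_scaleC_blinfun_le: "norm (c *\<^sub>C (T :: 'a::real_normed_vector \<Rightarrow>\<^sub>L 'b::complex_inner)) \<le> cmod c * norm T"
  by (rule norm_blinfun_bound)
     (simp_all add: scaleC_blinfun_apply norm_scaleC mult.assoc mult_left_mono norm_blinfun)

lemma bounded_linear_scaleC_blinfun:
  "bounded_linear (\<lambda>T :: 'a::real_normed_vector \<Rightarrow>\<^sub>L 'b::complex_inner. c *\<^sub>C T)"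
proof (rule bounded_linear_intro[where K = "cmod c"])
  show "c *\<^sub>C (S + T) = c *\<^sub>C S + c *\<^sub>C T" for S T :: "'a \<Rightarrow>\<^sub>L 'b"
    by (rule blinfun_eqI) (simp add: scaleC_blinfun_apply blinfun.add_left scaleC_add_right)
  show "c *\<^sub>C (r *\<^sub>R T) = r *\<^sub>R (c *\<^sub>C T)" for r and T :: "'a \<Rightarrow>\<^sub>L 'b"
    by (rule blinfun_eqI) (simp add: scaleC_blinfun_apply blinfun.scaleR_left scaleC_scaleR)
  show "norm (c *\<^sub>C T) \<le> norm T * cmod c" for T :: "'a \<Rightarrow>\<^sub>L 'b"
    using norm_scaleC_blinfun_le[of c T] by (simp add: mult.commute)
qed

lemma ravg_ergodic_id: "ravg_ergodic (id_blinfun :: 'a::finite fock \<Rightarrow>\<^sub>L 'a fock)"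
proof -
  have "(ravg ^^ k) id_blinfun = (id_blinfun :: 'a fock \<Rightarrow>\<^sub>L 'a fock)" for k
    by (induction k) (simp_all add: rmean.mean_id)
  moreover have "(1::complex) *\<^sub>C (id_blinfun :: 'a fock \<Rightarrow>\<^sub>L 'a fock) = id_blinfun"
    by (rule blinfun_eqI) (simp add: scaleC_blinfun_apply)
  ultimately show ?thesis
    by (auto simp: ravg_ergodic_def bounded_ops_id intro!: exI[of _ 1])
qed

lemma ravg_ergodic_add:
  assumes "ravg_ergodic S" "ravg_ergodic T"
  shows "ravg_ergodic (S + T)"
proof -
  obtain c d where "(\<lambda>k. (ravg ^^ k) S) \<longlonglongrightarrow> c *\<^sub>C id_blinfun" "(\<lambda>k. (ravg ^^ k) T) \<longlonglongrightarrow> d *\<^sub>C id_blinfun"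
    using assms by (auto simp: ravg_ergodic_def)
  then have "(\<lambda>k. (ravg ^^ k) (S + T)) \<longlonglongrightarrow> (c + d) *\<^sub>C id_blinfun"
    unfolding funpow_mean_add scaleC_add_left_blinfun by (rule tendsto_add)
  then show ?thesis using assms by (auto simp: ravg_ergodic_def bounded_ops_add)
qed

lemma ravg_ergodic_scaleC:
  assumes "ravg_ergodic T"
  shows "ravg_ergodic (d *\<^sub>C T)"
proof -
  obtain c where c: "(\<lambda>k. (ravg ^^ k) T) \<longlonglongrightarrow> c *\<^sub>C id_blinfun" and T: "T \<in> bounded_ops"
    using assms by (auto simp: ravg_ergodic_def)
  have "(\<lambda>k. (ravg ^^ k) (d *\<^sub>C T)) \<longlonglongrightarrow> (d * c) *\<^sub>C id_blinfun"
    unfolding rmean.funpow_mean_scaleC[OF T] scaleC_scaleC_blinfun[symmetric]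
    by (rule bounded_linear.tendsto[OF bounded_linear_scaleC_blinfun c])
  then show ?thesis using T by (auto simp: ravg_ergodic_def bounded_ops_scaleC)
qed

lemma ravg_ergodic_zero: "ravg_ergodic (0 :: 'a::finite fock \<Rightarrow>\<^sub>L 'a fock)"
proof -
  have "(0::complex) *\<^sub>C (id_blinfun :: 'a fock \<Rightarrow>\<^sub>L 'a fock) = 0"
    by (rule blinfun_eqI) (simp add: scaleC_blinfun_apply)
  then show ?thesis using ravg_ergodic_scaleC[OF ravg_ergodic_id[where 'a = 'a], of 0] by simp
qed

lemma ravg_ergodic_sum: "(\<And>i. i \<in> A \<Longrightarrow> ravg_ergodic (T i)) \<Longrightarrow> ravg_ergodic (\<Sum>i\<in>A. T i)"
  by (induction A rule: infinite_finite_induct) (auto simp: ravg_ergodic_zero ravg_ergodic_add)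

lemma ravg_ergodic_cadjoint:
  assumes "ravg_ergodic T"
  shows "ravg_ergodic (cadjoint T)"
proof -
  obtain c where c: "(\<lambda>k. (ravg ^^ k) T) \<longlonglongrightarrow> c *\<^sub>C id_blinfun" and T: "T \<in> bounded_ops"
    using assms by (auto simp: ravg_ergodic_def)
  have "(\<lambda>k. (ravg ^^ k) (cadjoint T)) \<longlonglongrightarrow> cnj c *\<^sub>C id_blinfun"
  proof (rule Lim_null[THEN iffD2], rule Lim_null_comparison)
    have "(ravg ^^ k) (cadjoint T) - cnj c *\<^sub>C id_blinfun = cadjoint ((ravg ^^ k) T - c *\<^sub>C id_blinfun)" for k
      by (simp add: cadjoint_diff rmean.funpow_mean_bounded_ops T bounded_ops_scaleC bounded_ops_id
          rmean.cadjoint_funpow_mean cadjoint_scaleC)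
    then show "\<forall>\<^sub>F k in sequentially. norm ((ravg ^^ k) (cadjoint T) - cnj c *\<^sub>C id_blinfun) \<le>
        norm ((ravg ^^ k) T - c *\<^sub>C id_blinfun)"
      by (simp add: norm_cadjoint_le bounded_ops_diff rmean.funpow_mean_bounded_ops T bounded_ops_scaleC bounded_ops_id)
    show "(\<lambda>k. norm ((ravg ^^ k) T - c *\<^sub>C id_blinfun)) \<longlonglongrightarrow> 0"
      using c by (intro tendsto_norm_zero Lim_null[THEN iffD1])
  qed
  then show ?thesis using T by (auto simp: ravg_ergodic_def cadjoint_bounded_ops)
qed

lemma ravg_ergodic_ravgD:
  assumes "ravg_ergodic (ravg T)" "T \<in> bounded_ops"
  shows "ravg_ergodic T"
proof -
  obtain c where "(\<lambda>k. (ravg ^^ k) (ravg T)) \<longlonglongrightarrow> c *\<^sub>C id_blinfun"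
    using assms by (auto simp: ravg_ergodic_def)
  then have "(\<lambda>k. (ravg ^^ Suc k) T) \<longlonglongrightarrow> c *\<^sub>C id_blinfun"
    by (simp add: funpow_swap1)
  then have "(\<lambda>k. (ravg ^^ k) T) \<longlonglongrightarrow> c *\<^sub>C id_blinfun"
    by (rule LIMSEQ_imp_Suc)
  then show ?thesis using assms(2) by (auto simp: ravg_ergodic_def)
qed

lemma rshift_pull_unit:
  "blinfun_apply (cadjoint (rshift w)) (ell2_unit (v @ w)) = ell2_unit v"
  using pull_unit[OF inj_append_right, of w v] by (simp add: rshift_def)

lemma rshift_pull_unit_zero:
  assumes "length w = length w'" "w \<noteq> w'"
  shows "blinfun_apply (cadjoint (rshift w)) (ell2_unit (v @ w')) = 0"
proof -
  have "v @ w' \<notin> range (\<lambda>u. u @ w)" using assms by auto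
  then show ?thesis unfolding rshift_def by (rule pull_unit_zero[OF inj_append_right])
qed

lemma rshift_orthogonal:
  "blinfun_apply (cadjoint (rshift [i])) (blinfun_apply (rshift [j]) x) = (if i = j then x else 0)"
proof -
  have "cadjoint (rshift [i]) o\<^sub>L rshift [j] = (if i = j then id_blinfun else 0)"
    by (rule bounded_ops_eq_on_units)
       (auto simp: bounded_ops_compose cadjoint_bounded_ops rshift_bounded_ops bounded_ops_id bounded_ops_zero
         rshift_unit rshift_pull_unit rshift_pull_unit_zero)
  then show ?thesis by (metis blinfun_apply_blinfun_compose blinfun_apply_id_blinfun id_apply zero_blinfun.rep_eq)
qed

lemma rshift_snoc: "blinfun_apply (rshift (w @ [i])) x = blinfun_apply (rshift [i]) (blinfun_apply (rshift w) x)"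
  using rshift_compose[of "[i]" w] by (metis blinfun_apply_blinfun_compose)

lemma ravg_rshift:
  fixes v :: "'n::finite list"
  shows "ravg (rshift (v @ [j])) = (1 / real CARD('n)) *\<^sub>R rshift (j # v)"
proof (rule blinfun_eqI)
  fix x
  have "blinfun_apply (rshift v) (blinfun_apply (rshift [i]) x) = blinfun_apply (rshift (i # v)) x" for i
    using rshift_compose[of v "[i]"] by (metis append_Cons append_Nil blinfun_apply_blinfun_compose)
  then show "blinfun_apply (ravg (rshift (v @ [j]))) x = blinfun_apply ((1 / real CARD('n)) *\<^sub>R rshift (j # v)) x"
    by (simp add: blinfun_apply_mean rshift_snoc rshift_orthogonal blinfun.scaleR_left cong: if_cong)
qed

lemma norm_rshift_le: "norm (rshift w) \<le> 1"
  by (rule norm_blinfun_bound) (simp_all add: norm_rshift)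

lemma ravg_ergodic_rshift:
  fixes v :: "'n::finite list"
  assumes "v \<noteq> []" and n: "CARD('n) > 1"
  shows "ravg_ergodic (rshift v)"
proof -
  have rotate: "\<exists>u. u \<noteq> [] \<and> (ravg ^^ k) (rshift v) = (1 / real CARD('n)) ^ k *\<^sub>R rshift u" for k
  proof (induction k)
    case (Suc k)
    then obtain u where u: "u \<noteq> []" "(ravg ^^ k) (rshift v) = (1 / real CARD('n)) ^ k *\<^sub>R rshift u" by blast
    then obtain u' j where "u = u' @ [j]" by (metis rev_exhaust)
    with u(2) have "(ravg ^^ Suc k) (rshift v) = (1 / real CARD('n)) ^ Suc k *\<^sub>R rshift (j # u')"
      by (simp add: mean_scaleR ravg_rshift)
    then show ?case by blast
  qed (use assms in auto)
  have le: "norm ((ravg ^^ k) (rshift v)) \<le> (1 / real CARD('n)) ^ k" for k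
  proof -
    obtain u :: "'n list" where "(ravg ^^ k) (rshift v) = (1 / real CARD('n)) ^ k *\<^sub>R rshift u"
      using rotate by blast
    then show ?thesis using norm_rshift_le[of u] by (simp add: mult_left_le divide_right_mono power_one_over)
  qed
  have "(\<lambda>k. (1 / real CARD('n)) ^ k) \<longlonglongrightarrow> 0"
    using n by (intro LIMSEQ_realpow_zero) auto
  then have "(\<lambda>k. (ravg ^^ k) (rshift v)) \<longlonglongrightarrow> 0"
    by (rule Lim_null_comparison[rotated]) (simp add: le)
  moreover have "(0::complex) *\<^sub>C (id_blinfun :: 'n fock \<Rightarrow>\<^sub>L 'n fock) = 0"
    by (rule blinfun_eqI) (simp add: scaleC_blinfun_apply)
  ultimately show ?thesis by (auto simp: ravg_ergodic_def rshift_bounded_ops intro!: exI[of _ 0])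
qed

text \<open>Averaging cancels a common last letter of \<open>v\<close> and \<open>w\<close>; what remains when one word is used up
  is a shift, which averaging multiplies by \<open>1/n\<close> while rotating its word.\<close>

lemma ravg_ergodic_matrix_unit:
  fixes v w :: "'n::finite list"
  assumes n: "CARD('n) > 1"
  shows "ravg_ergodic (rshift v o\<^sub>L cadjoint (rshift w))"
proof (induction "length v" arbitrary: v w)
  case 0
  have "id_blinfun o\<^sub>L T = T" for T :: "'n fock \<Rightarrow>\<^sub>L 'n fock" by (rule blinfun_eqI) simp
  then show ?case using 0
    by (cases "w = []") (auto simp: rshift_Nil ravg_ergodic_id intro: ravg_ergodic_cadjoint ravg_ergodic_rshift[OF _ n])
next
  case (Suc k)
  then obtain v' j where v: "v = v' @ [j]" "k = length v'"
    by (metis append_butlast_last_id length_append_singleton length_0_conv nat.distinct(1) nat.inject)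
  show ?case
  proof (cases w rule: rev_cases)
    case Nil
    have "T o\<^sub>L id_blinfun = T" for T :: "'n fock \<Rightarrow>\<^sub>L 'n fock" by (rule blinfun_eqI) simp
    then show ?thesis using Nil v by (simp add: rshift_Nil ravg_ergodic_rshift[OF _ n])
  next
    case (snoc w' j')
    have w: "cadjoint (rshift w) = cadjoint (rshift w') o\<^sub>L cadjoint (rshift [j'])"
      using cadjoint_compose[of "rshift [j']" "rshift w'"]
      by (simp add: rshift_compose snoc rshift_bounded_ops)
    have "ravg (rshift v o\<^sub>L cadjoint (rshift w)) = (if j = j' then (1 / real CARD('n)) *\<^sub>R (rshift v' o\<^sub>L cadjoint (rshift w')) else 0)"
      by (rule blinfun_eqI)
         (simp add: blinfun_apply_mean v w rshift_snoc rshift_orthogonal blinfun.scaleR_left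
           if_distrib[of "blinfun_apply _"] cong: if_cong)
    also have "ravg_ergodic \<dots>"
      using ravg_ergodic_scaleC[OF Suc(1)[OF v(2), of w'], of "complex_of_real (1 / real CARD('n))"]
      by (simp add: ravg_ergodic_zero scaleR_eq_scaleC_blinfun)
    finally show ?thesis
      by (rule ravg_ergodic_ravgD) (intro bounded_ops_compose cadjoint_bounded_ops rshift_bounded_ops)
  qed
qed

text \<open>The approximant acts on \<open>e (u @ w)\<close>, with \<open>w\<close> of the fixed length \<open>l\<close>, as a truncation of
  \<open>x e w\<close> shifted by \<open>u\<close>; the error is the part of the increasing sequence \<open>hs_norm_sq m x\<close>
  beyond \<open>l\<close>, plus the truncation error.\<close>

lemma harm_approx:
  fixes x :: "'n::finite fock \<Rightarrow>\<^sub>L 'n fock"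
  assumes x: "x \<in> harmonic_ops" and d: "0 < d" and n: "CARD('n) > 1"
  shows "\<exists>a m0. ravg_ergodic a \<and> (\<forall>m\<ge>m0. hs_norm_sq m (x - a) \<le> d)"
proof -
  let ?q = "\<lambda>m. hs_norm_sq m x"
  have "Cauchy ?q"
  proof -
    have "incseq ?q"
      unfolding incseq_def
    proof (intro allI impI)
      fix j k :: nat assume "j \<le> k"
      then show "?q j \<le> ?q k"
        using square_sequence_mono[OF x, of vacuum j "k - j"] by (simp add: hs_norm_sq_harm[OF x])
    qed
    then have "convergent ?q" using hs_norm_sq_le[of _ x] by (metis convergentI incseq_convergent)
    then show ?thesis by (rule convergent_Cauchy)
  qed
  then obtain l where l: "\<And>m. l \<le> m \<Longrightarrow> dist (?q m) (?q l) < d / 2"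
    using d by (metis half_gt_zero metric_CauchyD order_refl)
  define d' where "d' = sqrt (d / 2)"
  have d': "0 < d'" "d'\<^sup>2 = d / 2" using d by (simp_all add: d'_def)
  define c where "c w v = Rep_ell2 (blinfun_apply x (ell2_unit w)) v" for w v
  have "\<exists>F. finite F \<and> norm (blinfun_apply x (ell2_unit w) - (\<Sum>v\<in>F. c w v *\<^sub>C ell2_unit v)) \<le> d'" for w
    unfolding c_def by (rule ell2_approx[OF d'(1)])
  then obtain F where F: "\<And>w. norm (blinfun_apply x (ell2_unit w) - (\<Sum>v\<in>F w. c w v *\<^sub>C ell2_unit v)) \<le> d'"
    by metis
  define t where "t w = (\<Sum>v\<in>F w. c w v *\<^sub>C (ell2_unit v :: 'n fock))" for w
  define a where "a = (\<Sum>w\<in>words l. \<Sum>v\<in>F w. c w v *\<^sub>C (rshift v o\<^sub>L cadjoint (rshift w)))"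
  have a_unit: "blinfun_apply a (ell2_unit (u @ w)) = blinfun_apply (lshift u) (t w)" if w: "w \<in> words l" for u w
  proof -
    have pull: "blinfun_apply (cadjoint (rshift w')) (ell2_unit (u @ w)) = (if w' = w then ell2_unit u else 0)"
      if "w' \<in> words l" for w'
    proof (cases "w' = w")
      case True
      then show ?thesis by (simp add: rshift_pull_unit)
    next
      case False
      then show ?thesis using w that by (simp add: words_def rshift_pull_unit_zero)
    qed
    have "blinfun_apply a (ell2_unit (u @ w)) =
        (\<Sum>w'\<in>words l. if w' = w then \<Sum>v\<in>F w'. c w' v *\<^sub>C ell2_unit (u @ v) else 0)"
      unfolding a_def blinfun.sum_left scaleC_blinfun_apply
      by (intro sum.cong refl) (simp add: pull rshift_unit)
    also have "\<dots> = (\<Sum>v\<in>F w. c w v *\<^sub>C ell2_unit (u @ v))"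
      using w by (simp add: finite_words_set)
    also have "\<dots> = blinfun_apply (lshift u) (t w)"
      by (simp add: t_def blinfun.sum_right bounded_opsD[OF lshift_bounded_ops] lshift_unit)
    finally show ?thesis .
  qed
  have "hs_norm_sq m (x - a) \<le> d" if "l \<le> m" for m
  proof -
    define k where "k = m - l"
    have m: "m = k + l" using that by (simp add: k_def)
    let ?N = "real (card (words k :: 'n list set))" and ?M = "real (card (words l :: 'n list set))"
    have "hs_norm_sq m (x - a) = (1 / ?M) * (\<Sum>w\<in>words l. (1 / ?N) * (\<Sum>u\<in>words k.
        (norm (blinfun_apply x (blinfun_apply (lshift u) (ell2_unit w)) - blinfun_apply (lshift u) (t w)))\<^sup>2))"
      unfolding hs_norm_sq_def m sum_words_add
      by (simp add: card_words power_add blinfun.diff_left a_unit lshift_unit sum_divide_distrib[symmetric])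
         (subst sum.swap, simp add: mult.commute)
    also have "\<dots> = (1 / ?M) * (\<Sum>w\<in>words l.
        inner (ell2_unit w) (blinfun_apply ((lavg ^^ k) (cadjoint x o\<^sub>L x)) (ell2_unit w))
        - (norm (blinfun_apply x (ell2_unit w)))\<^sup>2 + (norm (blinfun_apply x (ell2_unit w) - t w))\<^sup>2)"
      by (simp only: average_commutator_sq[OF x])
    also have "\<dots> = (1 / ?M) * (\<Sum>w\<in>words l. inner (ell2_unit w) (blinfun_apply ((lavg ^^ k) (cadjoint x o\<^sub>L x)) (ell2_unit w)))
        - hs_norm_sq l x + (1 / ?M) * (\<Sum>w\<in>words l. (norm (blinfun_apply x (ell2_unit w) - t w))\<^sup>2)"
      by (simp add: hs_norm_sq_def sum.distrib sum_subtractf add_divide_distrib diff_divide_distrib)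
    also have "(1 / ?M) * (\<Sum>w\<in>words l. inner (ell2_unit w) (blinfun_apply ((lavg ^^ k) (cadjoint x o\<^sub>L x)) (ell2_unit w)))
        = inner vacuum (blinfun_apply ((lavg ^^ l) ((lavg ^^ k) (cadjoint x o\<^sub>L x))) vacuum)"
      by (simp add: inner_funpow_lavg[of _ l] lshift_unit)
    also have "\<dots> = hs_norm_sq m x"
      by (simp add: hs_norm_sq_harm[OF x] m funpow_add[symmetric] add.commute flip: comp_apply[of "lavg ^^ l"])
    also have "hs_norm_sq m x - hs_norm_sq l x \<le> d / 2"
      using l[OF that] unfolding dist_real_def by linarith
    also have "(1 / ?M) * (\<Sum>w\<in>words l. (norm (blinfun_apply x (ell2_unit w) - t w))\<^sup>2) \<le> (1 / ?M) * (\<Sum>w\<in>(words l :: 'n list set). d / 2)"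
      using F unfolding d'(2)[symmetric] t_def by (intro mult_left_mono sum_mono power_mono) simp_all
    also have "\<dots> = d / 2" using card_words_pos[of l, where 'n = 'n] by simp
    finally show ?thesis by simp
  qed
  moreover have "ravg_ergodic a"
    unfolding a_def by (intro ravg_ergodic_sum ravg_ergodic_scaleC ravg_ergodic_matrix_unit[OF n])
  ultimately show ?thesis by blast
qed

definition vacuum_state :: "('n fock \<Rightarrow>\<^sub>L 'n fock) \<Rightarrow> complex" where
  "vacuum_state x = cinner vacuum (blinfun_apply x vacuum)"

lemma harm_ravg: "x \<in> harmonic_ops \<Longrightarrow> ravg x \<in> harmonic_ops"
  unfolding mean_def by (intro harm_scaleR harm_sum harm_sandwich)

lemma harm_funpow_ravg: "x \<in> harmonic_ops \<Longrightarrow> (ravg ^^ k) x \<in> harmonic_ops"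
  by (induction k) (simp_all add: harm_ravg)

lemma vacuum_state_ravg:
  assumes "x \<in> harmonic_ops"
  shows "vacuum_state (ravg x) = vacuum_state x"
proof -
  have "vacuum_state (ravg x) = vacuum_state (lavg x)"
    unfolding vacuum_state_def rmean.cinner_mean lmean.cinner_mean lshift_unit rshift_unit by simp
  then show ?thesis using assms by (simp add: harmD)
qed

lemma vacuum_state_funpow_ravg: "x \<in> harmonic_ops \<Longrightarrow> vacuum_state ((ravg ^^ k) x) = vacuum_state x"
  by (induction k) (simp_all add: vacuum_state_ravg harm_funpow_ravg)

lemma cmod_vacuum_state_le: "(cmod (vacuum_state x))\<^sup>2 \<le> (norm (blinfun_apply x vacuum))\<^sup>2"
  using cmod_cinner_le[of vacuum "blinfun_apply x vacuum"] by (simp add: vacuum_state_def power_mono)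

lemma vacuum_state_diff: "vacuum_state (x - y) = vacuum_state x - vacuum_state y"
  by (simp add: vacuum_state_def blinfun.diff_left cinner_diff_right)

lemma vacuum_state_scale_id: "vacuum_state (c *\<^sub>C id_blinfun) = c"
  by (simp add: vacuum_state_def scaleC_blinfun_apply cinner_scaleC_right cinner_self)

lemma norm_scale_id_le: "norm (c *\<^sub>C (id_blinfun :: 'a fock \<Rightarrow>\<^sub>L 'a fock)) \<le> cmod c"
  by (rule norm_blinfun_bound) (simp_all add: scaleC_blinfun_apply norm_scaleC)

text \<open>An approximant of \<open>x\<close> is averaged to some scalar \<open>c\<close>, and right averages contract the
  Hilbert-Schmidt norms at the cost of longer words. The vacuum value is unchanged by averaging,
  which identifies \<open>c\<close> up to the same error.\<close>

lemma harm_mixing: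
  fixes x :: "'n::finite fock \<Rightarrow>\<^sub>L 'n fock"
  assumes x: "x \<in> harmonic_ops" and d: "0 < d" and n: "CARD('n) > 1"
  shows "\<exists>k. \<forall>m. hs_norm_sq m ((ravg ^^ k) x - vacuum_state x *\<^sub>C id_blinfun) \<le> d"
proof -
  \<comment> \<open>Each of two nested applications of \<open>hs_norm_sq_add\<close> costs a factor of 4.\<close>
  define r where "r = d / 16"
  have r: "0 < r" using d by (simp add: r_def)
  obtain a m0 where a: "ravg_ergodic a" and approx: "\<And>m. m0 \<le> m \<Longrightarrow> hs_norm_sq m (x - a) \<le> r"
    using harm_approx[OF x r n] by blast
  obtain c where "(\<lambda>k. (ravg ^^ k) a) \<longlonglongrightarrow> c *\<^sub>C id_blinfun" using a by (auto simp: ravg_ergodic_def)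
  then have "\<forall>\<^sub>F k in sequentially. dist ((ravg ^^ k) a) (c *\<^sub>C id_blinfun) < sqrt r"
    using r by (intro tendstoD) simp_all
  then have "\<forall>\<^sub>F k in sequentially. dist ((ravg ^^ k) a) (c *\<^sub>C id_blinfun) < sqrt r \<and> m0 \<le> k"
    using eventually_ge_at_top[of m0] by eventually_elim simp
  then obtain k where k: "norm ((ravg ^^ k) a - c *\<^sub>C id_blinfun) < sqrt r" "m0 \<le> k"
    by (auto simp: dist_norm eventually_sequentially)
  have close: "hs_norm_sq m ((ravg ^^ k) x - c *\<^sub>C id_blinfun) \<le> 4 * r" for m
  proof -
    have "hs_norm_sq m ((ravg ^^ k) (x - a)) \<le> r"
      by (rule order_trans[OF hs_norm_sq_funpow_ravg approx]) (use k in simp)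
    moreover have "hs_norm_sq m ((ravg ^^ k) a - c *\<^sub>C id_blinfun) \<le> r"
    proof (rule order_trans[OF hs_norm_sq_le])
      have "(norm ((ravg ^^ k) a - c *\<^sub>C id_blinfun))\<^sup>2 \<le> (sqrt r)\<^sup>2" using k by (intro power_mono) simp_all
      then show "(norm ((ravg ^^ k) a - c *\<^sub>C id_blinfun))\<^sup>2 \<le> r" using r by simp
    qed
    moreover have "hs_norm_sq m ((ravg ^^ k) x - c *\<^sub>C id_blinfun) \<le>
        2 * hs_norm_sq m ((ravg ^^ k) (x - a)) + 2 * hs_norm_sq m ((ravg ^^ k) a - c *\<^sub>C id_blinfun)"
      using hs_norm_sq_add[of m "(ravg ^^ k) (x - a)" "(ravg ^^ k) a - c *\<^sub>C id_blinfun"]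
      by (simp add: funpow_mean_diff)
    ultimately show ?thesis by simp
  qed
  have "(cmod (vacuum_state x - c))\<^sup>2 \<le> hs_norm_sq 0 ((ravg ^^ k) x - c *\<^sub>C id_blinfun)"
    using cmod_vacuum_state_le[of "(ravg ^^ k) x - c *\<^sub>C id_blinfun"]
    by (simp add: vacuum_state_diff vacuum_state_scale_id vacuum_state_funpow_ravg[OF x] hs_norm_sq_def words_0)
  also have "\<dots> \<le> 4 * r" by (rule close)
  finally have c: "(cmod (c - vacuum_state x))\<^sup>2 \<le> 4 * r" by (simp add: norm_minus_commute)
  have "hs_norm_sq m ((ravg ^^ k) x - vacuum_state x *\<^sub>C id_blinfun) \<le> d" for m
  proof -
    have "hs_norm_sq m ((c - vacuum_state x) *\<^sub>C id_blinfun :: 'n fock \<Rightarrow>\<^sub>L 'n fock) \<le> 4 * r"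
      by (rule order_trans[OF hs_norm_sq_le order_trans[OF power_mono[OF norm_scale_id_le] c]]) simp
    moreover have eq: "(ravg ^^ k) x - vacuum_state x *\<^sub>C id_blinfun =
        ((ravg ^^ k) x - c *\<^sub>C id_blinfun) + (c - vacuum_state x) *\<^sub>C id_blinfun"
      using scaleC_add_left_blinfun[of "c - vacuum_state x" "vacuum_state x" "id_blinfun :: 'n fock \<Rightarrow>\<^sub>L 'n fock"]
      by (simp add: algebra_simps)
    ultimately show ?thesis
      using hs_norm_sq_add[of m "(ravg ^^ k) x - c *\<^sub>C id_blinfun" "(c - vacuum_state x) *\<^sub>C id_blinfun"] close[of m]
      unfolding eq by (simp add: r_def)
  qed
  then show ?thesis by blast
qed

lemma vacuum_square_le:
  assumes y: "y \<in> harmonic_ops" and le: "\<And>m. hs_norm_sq m y \<le> d"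
  shows "inner vacuum (blinfun_apply (cprod (cadjoint y) y) vacuum) \<le> d"
proof (rule tendsto_upperbound)
  show "(\<lambda>k. inner vacuum (blinfun_apply ((lavg ^^ k) (cadjoint y o\<^sub>L y)) vacuum)) \<longlonglongrightarrow>
      inner vacuum (blinfun_apply (cprod (cadjoint y) y) vacuum)"
    by (intro tendsto_inner tendsto_const cprod_lim harm_cadjoint y)
qed (simp_all add: hs_norm_sq_harm[OF y, symmetric] le)

section \<open>Automorphisms fixing the creation operators\<close>

context harm_aut
begin

context
  assumes fix_shift: "\<And>i. \<beta> (rshift [i]) = rshift [i]" and n: "CARD('n) > 1"
begin

lemma fix_rshift: "\<beta> (rshift w) = rshift w"
proof (induction w rule: rev_induct)
  case Nil
  then show ?case by (simp add: rshift_Nil one)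
next
  case (snoc i w)
  have "rshift (w @ [i]) = cprod (rshift [i]) (rshift w)"
    by (subst cprod_eq_compose) (simp_all add: rshift_compose harm_rshift)
  then show ?case by (simp add: cprod harm_rshift fix_shift snoc)
qed

text \<open>The operator products in \<open>R v\<^sup>* x R w\<close> are already harmonic, hence equal to Choi-Effros
  products, which \<open>\<beta>\<close> respects.\<close>

lemma image_sandwich:
  assumes x: "x \<in> harmonic_ops"
  shows "\<beta> (cadjoint (rshift v) o\<^sub>L x o\<^sub>L rshift w) = cadjoint (rshift v) o\<^sub>L \<beta> x o\<^sub>L rshift w"
proof -
  have eq: "cprod (cadjoint (rshift v)) (cprod z (rshift w)) = cadjoint (rshift v) o\<^sub>L z o\<^sub>L rshift w"
    and harm: "cprod z (rshift w) \<in> harmonic_ops" if z: "z \<in> harmonic_ops" for z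
  proof -
    have "id_blinfun o\<^sub>L z = z" by (rule blinfun_eqI) simp
    then have zw: "z o\<^sub>L rshift w \<in> harmonic_ops"
      using harm_sandwich[OF z, of "[]" w] by (simp add: rshift_Nil)
    then have zw': "cprod z (rshift w) = z o\<^sub>L rshift w" by (rule cprod_eq_compose[OF z harm_rshift])
    have assoc: "cadjoint (rshift v) o\<^sub>L (z o\<^sub>L rshift w) = cadjoint (rshift v) o\<^sub>L z o\<^sub>L rshift w"
      by (rule blinfun_eqI) simp
    show "cprod z (rshift w) \<in> harmonic_ops" by (simp add: zw zw')
    show "cprod (cadjoint (rshift v)) (cprod z (rshift w)) = cadjoint (rshift v) o\<^sub>L z o\<^sub>L rshift w"
      unfolding zw' assoc[symmetric]
      by (rule cprod_eq_compose[OF harm_cadjoint[OF harm_rshift] zw]) (simp add: assoc harm_sandwich[OF z])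
  qed
  have "\<beta> (cadjoint (rshift v) o\<^sub>L x o\<^sub>L rshift w) = \<beta> (cprod (cadjoint (rshift v)) (cprod x (rshift w)))"
    by (simp only: eq[OF x])
  also have "\<dots> = cprod (cadjoint (rshift v)) (cprod (\<beta> x) (rshift w))"
    by (simp add: cprod cadjoint harm_cadjoint harm_rshift harm x fix_rshift)
  also have "\<dots> = cadjoint (rshift v) o\<^sub>L \<beta> x o\<^sub>L rshift w" by (rule eq) (simp add: x)
  finally show ?thesis .
qed

lemma image_ravg: "x \<in> harmonic_ops \<Longrightarrow> \<beta> (ravg x) = ravg (\<beta> x)"
  unfolding mean_def by (simp add: scaleR sum harm_sum harm_sandwich image_sandwich)

lemma image_funpow_ravg: "x \<in> harmonic_ops \<Longrightarrow> \<beta> ((ravg ^^ k) x) = (ravg ^^ k) (\<beta> x)"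
  by (induction k) (simp_all add: image_ravg harm_funpow_ravg)

text \<open>The operators \<open>y j\<close> are small in the Hilbert norm of the vacuum state, so by normality the
  squares \<open>\<beta> (p j)\<close> take arbitrarily small vacuum values; but these are at least the square modulus of
  the vacuum value of \<open>\<beta> (y j)\<close>, a constant.\<close>

lemma vacuum_state_invariant:
  assumes x: "x \<in> harmonic_ops"
  shows "vacuum_state (\<beta> x) = vacuum_state x"
proof (rule ccontr)
  assume neq: "vacuum_state (\<beta> x) \<noteq> vacuum_state x"
  have "\<exists>k. \<forall>m. hs_norm_sq m ((ravg ^^ k) x - vacuum_state x *\<^sub>C id_blinfun) \<le> (1/2) ^ j" for j :: nat
    by (rule harm_mixing[OF x _ n]) simp
  then obtain k where k: "\<And>j m. hs_norm_sq m ((ravg ^^ (k j)) x - vacuum_state x *\<^sub>C id_blinfun) \<le> (1/2) ^ (j :: nat)"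
    by metis
  define y where "y j = (ravg ^^ (k j)) x - vacuum_state x *\<^sub>C id_blinfun" for j
  have y: "y j \<in> harmonic_ops" for j
    unfolding y_def by (intro harm_diff harm_funpow_ravg x harm_scaleC harm_id)
  have y_norm: "norm (y j) \<le> norm x + cmod (vacuum_state x)" for j
    unfolding y_def by (rule order_trans[OF norm_triangle_ineq4])
      (intro add_mono rmean.norm_funpow_mean_le norm_scale_id_le)
  define p where "p j = cprod (cadjoint (y j)) (y j)" for j
  define C where "C = (norm x + cmod (vacuum_state x))\<^sup>2"
  have "\<exists>j. inner vacuum (blinfun_apply (\<beta> (p j)) vacuum) < (cmod (vacuum_state (\<beta> x) - vacuum_state x))\<^sup>2"
  proof (rule vacuum_state_normal[where C = C])
    show "p j \<in> harmonic_ops" "psd (p j)" for j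
      unfolding p_def by (simp_all add: cprod_harm harm_cadjoint psd_cprod_square y)
    show "inner v (blinfun_apply (p j) v) \<le> C * (norm v)\<^sup>2" for j v
    proof -
      have "norm (p j) \<le> norm (cadjoint (y j)) * norm (y j)"
        unfolding p_def by (intro norm_cprod_le harm_cadjoint y)
      also have "\<dots> \<le> (norm x + cmod (vacuum_state x)) * (norm x + cmod (vacuum_state x))"
        by (intro mult_mono y_norm order_trans[OF norm_cadjoint_le y_norm] harmD y) simp_all
      finally have "norm (p j) \<le> C" by (simp add: C_def power2_eq_square)
      then show ?thesis
        by (intro order_trans[OF inner_le_norm_op] mult_right_mono) simp_all
    qed
    show "inner vacuum (blinfun_apply (p j) vacuum) \<le> (1/2) ^ j" for j
      unfolding p_def by (rule vacuum_square_le[OF y]) (simp add: y_def k)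
  qed (use neq in \<open>simp_all add: C_def\<close>)
  then obtain j where j: "inner vacuum (blinfun_apply (\<beta> (p j)) vacuum) < (cmod (vacuum_state (\<beta> x) - vacuum_state x))\<^sup>2"
    by blast
  have "\<beta> (y j) = (ravg ^^ (k j)) (\<beta> x) - vacuum_state x *\<^sub>C id_blinfun"
    by (simp add: y_def diff harm_funpow_ravg x harm_scaleC harm_id image_funpow_ravg scaleC one)
  then have "vacuum_state (\<beta> (y j)) = vacuum_state (\<beta> x) - vacuum_state x"
    by (simp add: vacuum_state_diff vacuum_state_scale_id vacuum_state_funpow_ravg x)
  then have "(cmod (vacuum_state (\<beta> x) - vacuum_state x))\<^sup>2 \<le> (norm (blinfun_apply (\<beta> (y j)) vacuum))\<^sup>2"
    using cmod_vacuum_state_le[of "\<beta> (y j)"] by simp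
  also have "\<dots> \<le> inner vacuum (blinfun_apply (cprod (cadjoint (\<beta> (y j))) (\<beta> (y j))) vacuum)"
    by (rule norm_sq_le_cprod_square) (simp add: y)
  also have "cprod (cadjoint (\<beta> (y j))) (\<beta> (y j)) = \<beta> (p j)"
    by (simp add: p_def cprod cadjoint harm_cadjoint y)
  finally show False using j by simp
qed

theorem fixes_all:
  assumes x: "x \<in> harmonic_ops"
  shows "\<beta> x = x"
proof (rule bounded_ops_eq_on_units)
  fix w
  show "blinfun_apply (\<beta> x) (ell2_unit w) = blinfun_apply x (ell2_unit w)"
  proof (rule ell2_eqI)
    fix v
    have coeff: "cinner (ell2_unit v) (blinfun_apply z (ell2_unit w)) = vacuum_state (cadjoint (rshift v) o\<^sub>L z o\<^sub>L rshift w)" for z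
      by (simp add: vacuum_state_def cinner_cadjoint_right rshift_bounded_ops rshift_unit)
    show "cinner (ell2_unit v) (blinfun_apply (\<beta> x) (ell2_unit w)) = cinner (ell2_unit v) (blinfun_apply x (ell2_unit w))"
      unfolding coeff image_sandwich[OF x, symmetric] by (rule vacuum_state_invariant[OF harm_sandwich[OF x]])
  qed
qed (simp_all add: x harmD)

end

end

section \<open>Creation operators and second quantization\<close>

lemma orthonormal_expansion:
  assumes "orthonormal_basis (e :: 'n::finite \<Rightarrow> 'h::complex_inner)"
  shows "\<xi> = (\<Sum>i\<in>UNIV. cinner (e i) \<xi> *\<^sub>C e i)"
proof -
  obtain c where c: "\<xi> = (\<Sum>i\<in>UNIV. c i *\<^sub>C e i)" using assms unfolding orthonormal_basis_def by blast
  have "cinner (e i) \<xi> = (\<Sum>j\<in>UNIV. if j = i then c i else 0)" for i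
    unfolding c cinner_sum_right cinner_scaleC_right
    by (rule sum.cong) (use assms in \<open>auto simp: orthonormal_basis_def\<close>)
  then have "cinner (e i) \<xi> = c i" for i by simp
  with c show ?thesis by simp
qed

lemma creation_add:
  "left_creation e (\<xi> + \<eta>) = left_creation e \<xi> + left_creation e \<eta>"
  "right_creation e (\<xi> + \<eta>) = right_creation e \<xi> + right_creation e \<eta>"
  by (rule blinfun_eqI; simp add: left_creation_apply right_creation_apply blinfun.add_left
      Rep_ell2_inject[symmetric] fun_eq_iff left_creation_ell2.rep_eq right_creation_ell2.rep_eq
      plus_ell2.rep_eq cinner_add_right algebra_simps)+

lemma creation_scaleC:
  "left_creation e (c *\<^sub>C \<xi>) = c *\<^sub>C left_creation e \<xi>"
  "right_creation e (c *\<^sub>C \<xi>) = c *\<^sub>C right_creation e \<xi>"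
  by (rule blinfun_eqI; simp add: left_creation_apply right_creation_apply scaleC_blinfun_apply
      Rep_ell2_inject[symmetric] fun_eq_iff left_creation_ell2.rep_eq right_creation_ell2.rep_eq
      scaleC_ell2.rep_eq cinner_scaleC_right)+

lemma creation_zero: "left_creation e 0 = 0" "right_creation e 0 = 0"
  using creation_add[of e 0 0] by simp_all

lemma creation_sum:
  "left_creation e (\<Sum>i\<in>A. f i) = (\<Sum>i\<in>A. left_creation e (f i))"
  "right_creation e (\<Sum>i\<in>A. f i) = (\<Sum>i\<in>A. right_creation e (f i))"
  by (induction A rule: infinite_finite_induct; simp add: creation_add creation_zero)+

context
  fixes e :: "'n::finite \<Rightarrow> 'h::complex_inner"
  assumes e: "orthonormal_basis e"
begin

lemma creation_basis: "left_creation e (e i) = lshift [i]" "right_creation e (e i) = rshift [i]"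
proof -
  have "blinfun_apply (left_creation e (e i)) (ell2_unit w) = ell2_unit (i # w)"
    and "blinfun_apply (right_creation e (e i)) (ell2_unit w) = ell2_unit (w @ [i])" for w
    using left_creation_tensor[of e "e i" "map e w"] right_creation_tensor[of e "e i" "map e w"]
      tensor_basis[OF e, of "i # w"] tensor_basis[OF e, of "w @ [i]"] tensor_basis[OF e, of w] by simp_all
  then show "left_creation e (e i) = lshift [i]" "right_creation e (e i) = rshift [i]"
    by (auto intro!: bounded_ops_eq_on_units left_creation_bounded_ops right_creation_bounded_ops
        lshift_bounded_ops rshift_bounded_ops simp: lshift_unit rshift_unit)
qed

lemma creation_expansion:
  "left_creation e \<xi> = (\<Sum>i\<in>UNIV. cinner (e i) \<xi> *\<^sub>C lshift [i])"
  "right_creation e \<xi> = (\<Sum>i\<in>UNIV. cinner (e i) \<xi> *\<^sub>C rshift [i])"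
  by (subst orthonormal_expansion[OF e, of \<xi>], simp add: creation_sum creation_scaleC creation_basis)+

lemma markov_eq: "markov e = lavg"
  by (simp add: fun_eq_iff markov_def mean_def creation_basis)

lemma Hinf_eq: "Hinf e = harmonic_ops"
  by (simp add: Hinf_def harmonic_ops_def markov_eq)

lemma choi_effros_eq: "choi_effros e = cprod"
  by (simp add: fun_eq_iff choi_effros_def cprod_def markov_eq)

lemma right_creation_harm: "right_creation e \<xi> \<in> harmonic_ops"
  unfolding creation_expansion by (intro harm_sum harm_scaleC harm_rshift)

lemma right_creation_inj:
  assumes "right_creation e \<xi> = right_creation e \<eta>"
  shows "\<xi> = \<eta>"
proof -
  have "tensor e [\<xi>] = tensor e [\<eta>]"
    using right_creation_tensor[of e \<xi> "[]"] right_creation_tensor[of e \<eta> "[]"] assms by simp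
  then have "Rep_ell2 (tensor e [\<xi>]) [i] = Rep_ell2 (tensor e [\<eta>]) [i]" for i by simp
  then have "cinner (e i) \<xi> = cinner (e i) \<eta>" for i by (simp add: tensor.rep_eq)
  then show ?thesis by (subst (1 2) orthonormal_expansion[OF e]) simp
qed

lemma eq_on_tensor_forms:
  assumes "S \<in> bounded_ops" "T \<in> bounded_ops"
    and eq: "\<And>\<xi>s \<eta>s. cinner (tensor e \<xi>s) (blinfun_apply S (tensor e \<eta>s)) = cinner (tensor e \<xi>s) (blinfun_apply T (tensor e \<eta>s))"
  shows "S = T"
  by (rule bounded_ops_eq_on_units[OF assms(1,2)], rule ell2_eqI)
     (unfold tensor_basis[OF e, symmetric], rule eq)

lemma right_creation_isometry:
  "cadjoint (right_creation e \<xi>) o\<^sub>L right_creation e \<eta> = cinner \<xi> \<eta> *\<^sub>C id_blinfun"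
  by (rule eq_on_tensor_forms)
     (auto simp: bounded_ops_compose cadjoint_bounded_ops right_creation_bounded_ops bounded_ops_scaleC
       bounded_ops_id cinner_cadjoint_right right_creation_tensor cinner_tensor[OF e] scaleC_blinfun_apply
       cinner_scaleC_right)

abbreviation (input) \<Gamma> :: "('h \<Rightarrow>\<^sub>L 'h) \<Rightarrow> ('n fock \<Rightarrow>\<^sub>L 'n fock)" where
  "\<Gamma> \<equiv> second_quantization e"

lemma second_quantization:
  assumes "U \<in> unitaries"
  shows second_quantization_bounded_ops: "\<Gamma> U \<in> bounded_ops"
    and second_quantization_tensor: "blinfun_apply (\<Gamma> U) (tensor e \<xi>s) = tensor e (map (blinfun_apply U) \<xi>s)"
  using theI'[OF second_quantization_ex1[OF e assms]] unfolding second_quantization_def by blast+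

lemma unitaries_compose:
  assumes "U \<in> unitaries" "V \<in> unitaries"
  shows "U o\<^sub>L V \<in> (unitaries :: ('h \<Rightarrow>\<^sub>L 'h) set)"
proof -
  interpret group "unitary_group :: ('h \<Rightarrow>\<^sub>L 'h) monoid" by (rule unitary_group_is_group)
  show ?thesis using m_closed[of U V] assms by (simp add: unitary_group_def)
qed

lemma unitaries_id: "id_blinfun \<in> (unitaries :: ('h \<Rightarrow>\<^sub>L 'h) set)"
  by (simp add: unitaries_def bounded_ops_id)

lemma unitaries_inverse:
  assumes "U \<in> unitaries"
  obtains V :: "'h \<Rightarrow>\<^sub>L 'h" where "V \<in> unitaries" "U o\<^sub>L V = id_blinfun" "V o\<^sub>L U = id_blinfun"
proof -
  interpret group "unitary_group :: ('h \<Rightarrow>\<^sub>L 'h) monoid" by (rule unitary_group_is_group)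
  show thesis
    using that[of "m_inv unitary_group U"] inv_closed[of U] r_inv[of U] l_inv[of U] assms
    by (simp add: unitary_group_def)
qed

lemma second_quantization_compose:
  assumes "U \<in> unitaries" "V \<in> unitaries"
  shows "\<Gamma> (U o\<^sub>L V) = \<Gamma> U o\<^sub>L \<Gamma> V"
proof (rule bounded_ops_eq_on_tensors[OF e])
  have "blinfun_apply (U o\<^sub>L V) = blinfun_apply U \<circ> blinfun_apply V" by auto
  then show "blinfun_apply (\<Gamma> (U o\<^sub>L V)) (tensor e \<xi>s) = blinfun_apply (\<Gamma> U o\<^sub>L \<Gamma> V) (tensor e \<xi>s)" for \<xi>s
    by (simp add: assms unitaries_compose second_quantization_tensor)
qed (simp_all add: assms unitaries_compose bounded_ops_compose second_quantization_bounded_ops)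

lemma second_quantization_id: "\<Gamma> id_blinfun = id_blinfun"
  by (rule bounded_ops_eq_on_tensors[OF e])
     (simp_all add: unitaries_id bounded_ops_id second_quantization_bounded_ops second_quantization_tensor)

lemma second_quantization_isometry:
  assumes U: "U \<in> unitaries"
  shows "cadjoint (\<Gamma> U) o\<^sub>L \<Gamma> U = id_blinfun"
proof (rule eq_on_tensor_forms)
  fix \<xi>s \<eta>s :: "'h list"
  have "map2 cinner (map (blinfun_apply U) \<xi>s) (map (blinfun_apply U) \<eta>s) = map2 cinner \<xi>s \<eta>s"
    using U by (auto simp: zip_map_map unitaries_def split_def)
  then show "cinner (tensor e \<xi>s) (blinfun_apply (cadjoint (\<Gamma> U) o\<^sub>L \<Gamma> U) (tensor e \<eta>s)) =
      cinner (tensor e \<xi>s) (blinfun_apply id_blinfun (tensor e \<eta>s))"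
    by (simp add: cinner_cadjoint_right second_quantization[OF U] cinner_tensor[OF e])
qed (intro bounded_ops_compose cadjoint_bounded_ops second_quantization_bounded_ops[OF U] bounded_ops_id)+

lemma cadjoint_second_quantization:
  assumes U: "U \<in> unitaries" and V: "V \<in> unitaries" and UV: "U o\<^sub>L V = id_blinfun"
  shows "cadjoint (\<Gamma> U) = \<Gamma> V"
proof (rule blinfun_eqI)
  fix x
  have "blinfun_apply (\<Gamma> U) (blinfun_apply (\<Gamma> V) x) = x"
    using second_quantization_compose[OF U V] by (metis UV second_quantization_id blinfun_apply_blinfun_compose blinfun_apply_id_blinfun id_apply)
  then show "blinfun_apply (cadjoint (\<Gamma> U)) x = blinfun_apply (\<Gamma> V) x"
    using second_quantization_isometry[OF U]
    by (metis blinfun_apply_blinfun_compose blinfun_apply_id_blinfun id_apply)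
qed

lemma second_quantization_creation:
  assumes U: "U \<in> unitaries"
  shows "\<Gamma> U o\<^sub>L left_creation e \<xi> = left_creation e (blinfun_apply U \<xi>) o\<^sub>L \<Gamma> U"
    and "\<Gamma> U o\<^sub>L right_creation e \<xi> = right_creation e (blinfun_apply U \<xi>) o\<^sub>L \<Gamma> U"
  by (rule bounded_ops_eq_on_tensors[OF e];
      simp add: bounded_ops_compose second_quantization[OF U] left_creation_bounded_ops
        right_creation_bounded_ops left_creation_tensor right_creation_tensor)+

abbreviation (input) Ad :: "('h \<Rightarrow>\<^sub>L 'h) \<Rightarrow> ('n fock \<Rightarrow>\<^sub>L 'n fock) \<Rightarrow> ('n fock \<Rightarrow>\<^sub>L 'n fock)" where
  "Ad \<equiv> conj_second_quantization e"

lemma Ad_apply: "blinfun_apply (Ad U x) v = blinfun_apply (\<Gamma> U) (blinfun_apply x (blinfun_apply (cadjoint (\<Gamma> U)) v))"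
  by (simp add: conj_second_quantization_def)

lemma Ad_bounded_ops: "U \<in> unitaries \<Longrightarrow> x \<in> bounded_ops \<Longrightarrow> Ad U x \<in> bounded_ops"
  unfolding conj_second_quantization_def
  by (intro bounded_ops_compose cadjoint_bounded_ops second_quantization_bounded_ops)

lemma Ad_add: "Ad U (x + y) = Ad U x + Ad U y"
  by (rule blinfun_eqI) (simp add: Ad_apply blinfun.add_left blinfun.add_right)

lemma Ad_scaleC: "U \<in> unitaries \<Longrightarrow> Ad U (c *\<^sub>C x) = c *\<^sub>C Ad U x"
  by (rule blinfun_eqI)
     (simp add: Ad_apply scaleC_blinfun_apply bounded_opsD[OF second_quantization_bounded_ops])

lemma Ad_cadjoint: "U \<in> unitaries \<Longrightarrow> x \<in> bounded_ops \<Longrightarrow> Ad U (cadjoint x) = cadjoint (Ad U x)"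
  by (rule cadjoint_eqI[symmetric])
     (simp add: Ad_apply cinner_cadjoint_right[symmetric] cinner_cadjoint_left second_quantization_bounded_ops
       cadjoint_cadjoint cadjoint_bounded_ops)

lemma Ad_mult:
  assumes U: "U \<in> unitaries"
  shows "Ad U x o\<^sub>L Ad U y = Ad U (x o\<^sub>L y)"
proof (rule blinfun_eqI)
  fix v
  have "blinfun_apply (cadjoint (\<Gamma> U)) (blinfun_apply (\<Gamma> U) w) = w" for w
    using second_quantization_isometry[OF U] by (metis blinfun_apply_blinfun_compose blinfun_apply_id_blinfun id_apply)
  then show "blinfun_apply (Ad U x o\<^sub>L Ad U y) v = blinfun_apply (Ad U (x o\<^sub>L y)) v"
    by (simp add: Ad_apply)
qed

lemma Ad_compose:
  assumes U: "U \<in> unitaries" and V: "V \<in> unitaries"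
  shows "Ad (U o\<^sub>L V) x = Ad U (Ad V x)"
  by (rule blinfun_eqI)
     (simp add: Ad_apply second_quantization_compose[OF U V] cadjoint_compose second_quantization_bounded_ops U V)

lemma Ad_id: "Ad id_blinfun x = x"
  by (rule blinfun_eqI) (simp add: Ad_apply second_quantization_id)

lemma Ad_right_creation:
  assumes U: "U \<in> unitaries"
  shows "Ad U (right_creation e \<xi>) = right_creation e (blinfun_apply U \<xi>)"
proof (rule blinfun_eqI)
  fix v
  obtain V where V: "V \<in> unitaries" "U o\<^sub>L V = id_blinfun" "V o\<^sub>L U = id_blinfun"
    using unitaries_inverse[OF U] .
  have "blinfun_apply (\<Gamma> U) (blinfun_apply (\<Gamma> V) v) = v"
    using second_quantization_compose[OF U V(1)] V(2)
    by (metis second_quantization_id blinfun_apply_blinfun_compose blinfun_apply_id_blinfun id_apply)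
  then show "blinfun_apply (Ad U (right_creation e \<xi>)) v = blinfun_apply (right_creation e (blinfun_apply U \<xi>)) v"
    using blinfun_compose_eqD[OF second_quantization_creation(2)[OF U], of \<xi> "blinfun_apply (\<Gamma> V) v"]
    by (simp add: Ad_apply cadjoint_second_quantization[OF U V(1,2)])
qed

lemma sum_cinner_unitary_change:
  fixes A B :: "'n \<Rightarrow> 'b::complex_inner"
  assumes c: "\<And>j k. (\<Sum>i\<in>UNIV. cnj (c i j) * c i k) = (if j = k then 1 else 0)"
  shows "(\<Sum>i\<in>(UNIV::'n set). cinner (\<Sum>j\<in>UNIV. c i j *\<^sub>C A j) (\<Sum>k\<in>UNIV. c i k *\<^sub>C B k)) = (\<Sum>j\<in>UNIV. cinner (A j) (B j))"
proof -
  have "(\<Sum>i\<in>(UNIV::'n set). cinner (\<Sum>j\<in>UNIV. c i j *\<^sub>C A j) (\<Sum>k\<in>UNIV. c i k *\<^sub>C B k)) =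
      (\<Sum>i\<in>UNIV. \<Sum>j\<in>UNIV. \<Sum>k\<in>UNIV. (cnj (c i j) * c i k) * cinner (A j) (B k))"
    unfolding cinner_sum_left unfolding cinner_sum_right
    by (simp add: cinner_scaleC_left cinner_scaleC_right mult_ac)
  also have "\<dots> = (\<Sum>j\<in>UNIV. \<Sum>i\<in>UNIV. \<Sum>k\<in>UNIV. (cnj (c i j) * c i k) * cinner (A j) (B k))"
    by (rule sum.swap)
  also have "\<dots> = (\<Sum>j\<in>UNIV. \<Sum>k\<in>UNIV. (\<Sum>i\<in>UNIV. cnj (c i j) * c i k) * cinner (A j) (B k))"
    unfolding sum_distrib_right by (intro sum.cong refl sum.swap)
  also have "\<dots> = (\<Sum>j\<in>UNIV. cinner (A j) (B j))"
    by (simp add: c if_distrib[of "\<lambda>z. z * _"] cong: if_cong)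
  finally show ?thesis .
qed

text \<open>Moving the second quantization past the left shifts replaces the basis \<open>e\<close> by its image under the
  inverse unitary, and the average is the same for both bases.\<close>

lemma lavg_Ad:
  assumes U: "U \<in> unitaries" and x: "x \<in> bounded_ops"
  shows "lavg (Ad U x) = Ad U (lavg x)"
proof (rule blinfun_eqI, rule ell2_eqI)
  fix v and w :: "'n list"
  define u where "u = (ell2_unit w :: 'n fock)"
  obtain V where V: "V \<in> unitaries" "U o\<^sub>L V = id_blinfun" "V o\<^sub>L U = id_blinfun"
    using unitaries_inverse[OF U] .
  define G where "G = \<Gamma> V"
  have adj: "cadjoint (\<Gamma> U) = G" unfolding G_def by (rule cadjoint_second_quantization[OF U V(1,2)])
  define c where "c i j = cinner (e j) (blinfun_apply V (e i))" for i j
  have iso: "cinner (blinfun_apply U \<xi>) (blinfun_apply U \<eta>) = cinner \<xi> \<eta>" for \<xi> \<eta>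
    using U by (simp add: unitaries_def)
  have UV: "blinfun_apply U (blinfun_apply V \<xi>) = \<xi>" for \<xi>
    using arg_cong[OF V(2), of "\<lambda>T. blinfun_apply T \<xi>"] by simp
  have "cinner (blinfun_apply U (e j)) (e i) = cinner (e j) (blinfun_apply V (e i))" for i j
    using iso[of "e j" "blinfun_apply V (e i)"] by (simp add: UV)
  then have c': "cinner (e i) (blinfun_apply U (e j)) = cnj (c i j)" for i j
    using cinner_commute[of "e i" "blinfun_apply U (e j)"] by (simp add: c_def)
  have c: "(\<Sum>i\<in>UNIV. cnj (c i j) * c i k) = (if j = k then 1 else 0)" for j k
  proof -
    have "(\<Sum>i\<in>UNIV. cnj (c i j) * c i k) = cinner (blinfun_apply U (e k)) (blinfun_apply U (e j))"
      by (subst parseval[OF e]) (simp add: c' mult.commute)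
    also have "\<dots> = (if j = k then 1 else 0)"
      using U e by (auto simp: unitaries_def orthonormal_basis_def)
    finally show ?thesis .
  qed
  have shift: "blinfun_apply G (blinfun_apply (lshift [i]) z) =
      (\<Sum>j\<in>UNIV. c i j *\<^sub>C blinfun_apply (lshift [j]) (blinfun_apply G z))" for i z
  proof -
    have "blinfun_apply G (blinfun_apply (lshift [i]) z) = blinfun_apply (left_creation e (blinfun_apply V (e i))) (blinfun_apply G z)"
      using blinfun_compose_eqD[OF second_quantization_creation(1)[OF V(1)], of "e i" z]
      by (simp add: creation_basis G_def)
    then show ?thesis
      by (simp add: creation_expansion blinfun.sum_left scaleC_blinfun_apply c_def)
  qed
  have "cinner u (blinfun_apply (lavg (Ad U x)) v) = (1 / real CARD('n)) *\<^sub>R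
      (\<Sum>i\<in>UNIV. cinner (blinfun_apply G (blinfun_apply (lshift [i]) u)) (blinfun_apply x (blinfun_apply G (blinfun_apply (lshift [i]) v))))"
    unfolding lmean.cinner_mean Ad_apply adj[symmetric]
    by (simp only: cinner_cadjoint_left[OF second_quantization_bounded_ops[OF U]])
  also have "\<dots> = (1 / real CARD('n)) *\<^sub>R
      (\<Sum>i\<in>UNIV. cinner (\<Sum>j\<in>UNIV. c i j *\<^sub>C blinfun_apply (lshift [j]) (blinfun_apply G u))
        (\<Sum>j\<in>UNIV. c i j *\<^sub>C blinfun_apply x (blinfun_apply (lshift [j]) (blinfun_apply G v))))"
    by (simp only: shift blinfun.sum_right bounded_opsD[OF x])
  also have "\<dots> = cinner (blinfun_apply G u) (blinfun_apply (lavg x) (blinfun_apply G v))"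
    unfolding lmean.cinner_mean sum_cinner_unitary_change[OF c] ..
  also have "\<dots> = cinner u (blinfun_apply (Ad U (lavg x)) v)"
    unfolding Ad_apply adj[symmetric] by (simp only: cinner_cadjoint_left[OF second_quantization_bounded_ops[OF U]])
  finally show "cinner (ell2_unit w) (blinfun_apply (lavg (Ad U x)) v) = cinner (ell2_unit w) (blinfun_apply (Ad U (lavg x)) v)"
    by (simp only: u_def)
qed

lemma Ad_harm: "U \<in> unitaries \<Longrightarrow> x \<in> harmonic_ops \<Longrightarrow> Ad U x \<in> harmonic_ops"
  by (simp add: harmonic_ops_def Ad_bounded_ops lavg_Ad)

lemma funpow_lavg_Ad:
  "U \<in> unitaries \<Longrightarrow> x \<in> bounded_ops \<Longrightarrow> (lavg ^^ k) (Ad U x) = Ad U ((lavg ^^ k) x)"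
  by (induction k) (simp_all add: lavg_Ad lmean.funpow_mean_bounded_ops)

lemma Ad_inverse:
  assumes "U \<in> unitaries" "V \<in> unitaries" "U o\<^sub>L V = id_blinfun"
  shows "Ad U (Ad V x) = x"
  using Ad_compose[OF assms(1,2), of x] by (simp add: assms(3) Ad_id)

lemma Ad_aut:
  assumes U: "U \<in> unitaries"
  shows "harm_aut (Ad U)"
proof
  obtain V where V: "V \<in> unitaries" "U o\<^sub>L V = id_blinfun" "V o\<^sub>L U = id_blinfun"
    using unitaries_inverse[OF U] .
  show "bij_betw (Ad U) harmonic_ops harmonic_ops"
    by (rule bij_betwI[where g = "Ad V"])
       (auto simp: Ad_harm U V Ad_inverse[OF U V(1,2)] Ad_inverse[OF V(1) U V(3)])
  show "Ad U (cprod x y) = cprod (Ad U x) (Ad U y)" if x: "x \<in> harmonic_ops" and y: "y \<in> harmonic_ops" for x y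
  proof (rule cprod_eqI[symmetric])
    fix v
    have xy: "x o\<^sub>L y \<in> bounded_ops" by (intro bounded_ops_compose harmD x y)
    show "(\<lambda>k. blinfun_apply ((lavg ^^ k) (Ad U x o\<^sub>L Ad U y)) v) \<longlonglongrightarrow> blinfun_apply (Ad U (cprod x y)) v"
      unfolding Ad_mult[OF U] funpow_lavg_Ad[OF U xy] Ad_apply
      by (intro blinfun.tendsto tendsto_const cprod_lim x y)
  qed (simp_all add: Ad_harm U x y)
qed (simp_all add: Ad_add Ad_scaleC Ad_cadjoint U harmD)

end

section \<open>The automorphism group and the stabilizer of the creation operators\<close>

lemma harm_aut_compose:
  assumes "harm_aut f" "harm_aut g"
  shows "harm_aut (\<lambda>x. f (g x))"
proof -
  interpret f: harm_aut f by fact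
  interpret g: harm_aut g by fact
  show ?thesis
    using bij_betw_trans[OF g.bij f.bij]
    by unfold_locales (simp_all add: comp_def f.add g.add f.scaleC g.scaleC f.cprod g.cprod f.cadjoint g.cadjoint)
qed

lemma harm_aut_id: "harm_aut (\<lambda>x. x)"
  using bij_betw_id by (simp add: harm_aut_def id_def)

lemma harm_aut_cong:
  assumes f: "harm_aut f" and eq: "\<And>x. x \<in> harmonic_ops \<Longrightarrow> g x = f x"
  shows "harm_aut g"
proof -
  interpret f: harm_aut f by fact
  show ?thesis
    using bij_betw_cong[of harmonic_ops g f harmonic_ops] f.bij
    by unfold_locales
       (simp_all add: eq harm_add harm_scaleC cprod_harm harm_cadjoint f.add f.scaleC f.cprod f.cadjoint)
qed

context
  fixes e :: "'n::finite \<Rightarrow> 'h::complex_inner"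
  assumes e: "orthonormal_basis e"
begin

lemma Hinf_automorphisms_iff:
  "\<alpha> \<in> Hinf_automorphisms e \<longleftrightarrow> \<alpha> \<in> extensional harmonic_ops \<and> harm_aut \<alpha>"
  unfolding Hinf_automorphisms_def Hinf_eq[OF e] choi_effros_eq[OF e] Bij_def harm_aut_def by auto

lemma restrict_id_aut: "restrict (\<lambda>x. x) harmonic_ops \<in> Hinf_automorphisms e"
  unfolding Hinf_automorphisms_iff
  by (intro conjI restrict_extensional, rule harm_aut_cong[OF harm_aut_id]) simp

lemma inv_BijGroup_aut:
  "\<alpha> \<in> Hinf_automorphisms e \<Longrightarrow>
    m_inv (BijGroup (Hinf e)) \<alpha> = restrict (inv_into harmonic_ops \<alpha>) harmonic_ops"
  using inv_BijGroup[of \<alpha> "Hinf e"] by (simp add: Hinf_automorphisms_def Hinf_eq[OF e])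

lemma mult_BijGroup_aut:
  "\<alpha> \<in> Hinf_automorphisms e \<Longrightarrow> \<beta> \<in> Hinf_automorphisms e \<Longrightarrow>
    \<alpha> \<otimes>\<^bsub>BijGroup (Hinf e)\<^esub> \<beta> = compose harmonic_ops \<alpha> \<beta>"
  by (simp add: BijGroup_def Hinf_automorphisms_def Hinf_eq[OF e])

lemma subgroup_Hinf_automorphisms: "subgroup (Hinf_automorphisms e) (BijGroup (Hinf e))"
proof (rule group.subgroupI[OF group_BijGroup])
  show "Hinf_automorphisms e \<subseteq> carrier (BijGroup (Hinf e))"
    by (auto simp: Hinf_automorphisms_def BijGroup_def)
  show "Hinf_automorphisms e \<noteq> {}" using restrict_id_aut by blast
  fix \<alpha> assume \<alpha>: "\<alpha> \<in> Hinf_automorphisms e"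
  then have "harm_aut \<alpha>" by (simp add: Hinf_automorphisms_iff)
  then have "harm_aut (inv_into harmonic_ops \<alpha>)" by (rule harm_aut.inverse)
  then have "harm_aut (restrict (inv_into harmonic_ops \<alpha>) harmonic_ops)" by (rule harm_aut_cong) simp
  then show "m_inv (BijGroup (Hinf e)) \<alpha> \<in> Hinf_automorphisms e"
    by (simp add: inv_BijGroup_aut[OF \<alpha>] Hinf_automorphisms_iff)
  fix \<beta> assume \<beta>: "\<beta> \<in> Hinf_automorphisms e"
  have "harm_aut (\<lambda>x. \<alpha> (\<beta> x))"
    by (rule harm_aut_compose) (use \<alpha> \<beta> in \<open>simp_all add: Hinf_automorphisms_iff\<close>)
  then have "harm_aut (compose harmonic_ops \<alpha> \<beta>)" by (rule harm_aut_cong) (simp add: compose_eq)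
  then show "\<alpha> \<otimes>\<^bsub>BijGroup (Hinf e)\<^esub> \<beta> \<in> Hinf_automorphisms e"
    by (simp add: mult_BijGroup_aut[OF \<alpha> \<beta>] Hinf_automorphisms_iff compose_extensional)
qed

lemma group_Aut_Hinf: "group (Aut_Hinf e)"
  unfolding Aut_Hinf_def
  by (rule group.subgroup_imp_group[OF group_BijGroup subgroup_Hinf_automorphisms])

lemma subgroup_creation_stabilizer: "subgroup (creation_stabilizer e) (Aut_Hinf e)"
proof (rule group.subgroupI[OF group_Aut_Hinf])
  let ?C = "range (right_creation e)"
  have C: "?C \<subseteq> harmonic_ops" using right_creation_harm[OF e] by auto
  show "creation_stabilizer e \<subseteq> carrier (Aut_Hinf e)"
    by (auto simp: creation_stabilizer_def Aut_Hinf_def)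
  have "restrict (\<lambda>x. x) harmonic_ops ` ?C = ?C" using C by (force simp: image_iff)
  then have "restrict (\<lambda>x. x) harmonic_ops \<in> creation_stabilizer e"
    unfolding creation_stabilizer_def by (intro CollectI conjI restrict_id_aut)
  then show "creation_stabilizer e \<noteq> {}" by blast
  fix \<alpha> assume "\<alpha> \<in> creation_stabilizer e"
  then have \<alpha>: "\<alpha> \<in> Hinf_automorphisms e" "\<alpha> ` ?C = ?C" by (auto simp: creation_stabilizer_def)
  then interpret \<alpha>: harm_aut \<alpha> by (simp add: Hinf_automorphisms_iff)
  have inv: "m_inv (Aut_Hinf e) \<alpha> = restrict (inv_into harmonic_ops \<alpha>) harmonic_ops"
    unfolding Aut_Hinf_def
    using group.m_inv_consistent[OF group_BijGroup subgroup_Hinf_automorphisms \<alpha>(1)]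
    by (simp add: inv_BijGroup_aut[OF \<alpha>(1)])
  have "inv_into harmonic_ops \<alpha> ` ?C = inv_into harmonic_ops \<alpha> ` (\<alpha> ` ?C)" by (simp only: \<alpha>(2))
  also have "\<dots> = ?C"
    using \<alpha>.bij C by (simp add: inv_into_image_cancel bij_betw_def)
  finally have "restrict (inv_into harmonic_ops \<alpha>) harmonic_ops ` ?C = ?C"
    using C by (metis restrict_apply' image_cong subsetD)
  moreover have "m_inv (Aut_Hinf e) \<alpha> \<in> Hinf_automorphisms e"
    using group.inv_closed[OF group_Aut_Hinf, of \<alpha>] \<alpha>(1) by (simp add: Aut_Hinf_def)
  ultimately show "m_inv (Aut_Hinf e) \<alpha> \<in> creation_stabilizer e"
    by (simp add: creation_stabilizer_def inv)
  fix \<beta> assume "\<beta> \<in> creation_stabilizer e"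
  then have \<beta>: "\<beta> \<in> Hinf_automorphisms e" "\<beta> ` ?C = ?C" by (auto simp: creation_stabilizer_def)
  have mult: "\<alpha> \<otimes>\<^bsub>Aut_Hinf e\<^esub> \<beta> = compose harmonic_ops \<alpha> \<beta>"
    using mult_BijGroup_aut[OF \<alpha>(1) \<beta>(1)] by (simp add: Aut_Hinf_def)
  have "compose harmonic_ops \<alpha> \<beta> ` ?C = (\<lambda>x. \<alpha> (\<beta> x)) ` ?C"
    by (rule image_cong[OF refl]) (meson C compose_eq subsetD)
  also have "\<dots> = \<alpha> ` (\<beta> ` ?C)" by (simp only: image_image)
  finally have "compose harmonic_ops \<alpha> \<beta> ` ?C = ?C" by (simp only: \<alpha>(2) \<beta>(2))
  moreover have "\<alpha> \<otimes>\<^bsub>Aut_Hinf e\<^esub> \<beta> \<in> Hinf_automorphisms e"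
    using monoid.m_closed[OF group.is_monoid[OF group_Aut_Hinf], of \<alpha> \<beta>] \<alpha>(1) \<beta>(1) by (simp add: Aut_Hinf_def)
  ultimately show "\<alpha> \<otimes>\<^bsub>Aut_Hinf e\<^esub> \<beta> \<in> creation_stabilizer e"
    by (simp add: creation_stabilizer_def mult)
qed

lemma restrict_Ad_stabilizer:
  assumes U: "U \<in> unitaries"
  shows "restrict (conj_second_quantization e U) (Hinf e) \<in> creation_stabilizer e"
proof -
  have "harm_aut (restrict (conj_second_quantization e U) harmonic_ops)"
    by (rule harm_aut_cong[OF Ad_aut[OF e U]]) simp
  moreover have "restrict (conj_second_quantization e U) harmonic_ops ` range (right_creation e) = range (right_creation e)"
  proof -
    have "restrict (conj_second_quantization e U) harmonic_ops ` range (right_creation e) =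
        right_creation e ` range (blinfun_apply U)"
      unfolding image_image
      by (rule image_cong[OF refl]) (simp add: right_creation_harm[OF e] Ad_right_creation[OF e U])
    also have "range (blinfun_apply U) = UNIV" using U by (simp add: unitaries_def)
    finally show ?thesis .
  qed
  ultimately show ?thesis
    by (simp add: creation_stabilizer_def Hinf_automorphisms_iff Hinf_eq[OF e])
qed

text \<open>The action on creation operators defines \<open>U\<close>; it preserves inner products because
  \<open>cadjoint r \<xi> \<circ> r \<eta>\<close> is the scalar \<open>cinner \<xi> \<eta>\<close>.\<close>

lemma stabilizer_unitary:
  assumes \<alpha>: "\<alpha> \<in> creation_stabilizer e"
  obtains U where "U \<in> unitaries" "\<And>\<xi>. \<alpha> (right_creation e \<xi>) = right_creation e (blinfun_apply U \<xi>)"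
proof -
  have \<alpha>': "harm_aut \<alpha>" "\<alpha> ` range (right_creation e) = range (right_creation e)"
    using \<alpha> by (auto simp: creation_stabilizer_def Hinf_automorphisms_iff)
  interpret harm_aut \<alpha> by fact
  note inj = right_creation_inj[OF e] and harm = right_creation_harm[OF e]
  have "\<exists>\<zeta>. \<alpha> (right_creation e \<xi>) = right_creation e \<zeta>" for \<xi> using \<alpha>'(2) by blast
  then obtain u where u: "\<And>\<xi>. \<alpha> (right_creation e \<xi>) = right_creation e (u \<xi>)" by metis
  have u_add: "u (\<xi> + \<eta>) = u \<xi> + u \<eta>" for \<xi> \<eta>
    by (rule inj) (simp add: u[symmetric] creation_add add harm)
  have u_scaleC: "u (c *\<^sub>C \<xi>) = c *\<^sub>C u \<xi>" for c \<xi>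
    by (rule inj) (simp add: u[symmetric] creation_scaleC scaleC harm)
  have product: "cprod (cadjoint (right_creation e \<xi>)) (right_creation e \<eta>) = cinner \<xi> \<eta> *\<^sub>C id_blinfun" for \<xi> \<eta>
    unfolding right_creation_isometry[OF e, symmetric]
    by (rule cprod_eq_compose) (simp_all add: harm harm_cadjoint right_creation_isometry[OF e] harm_scaleC harm_id)
  have u_cinner: "cinner (u \<xi>) (u \<eta>) = cinner \<xi> \<eta>" for \<xi> \<eta>
  proof -
    have "\<alpha> (cinner \<xi> \<eta> *\<^sub>C id_blinfun) = cinner (u \<xi>) (u \<eta>) *\<^sub>C id_blinfun"
      unfolding product[symmetric] u[symmetric] by (simp add: cprod cadjoint harm harm_cadjoint)
    then have "cinner \<xi> \<eta> *\<^sub>C (id_blinfun :: 'n fock \<Rightarrow>\<^sub>L 'n fock) = cinner (u \<xi>) (u \<eta>) *\<^sub>C id_blinfun"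
      by (simp add: scaleC harm_id one)
    then have "vacuum_state (cinner \<xi> \<eta> *\<^sub>C (id_blinfun :: 'n fock \<Rightarrow>\<^sub>L 'n fock)) = vacuum_state (cinner (u \<xi>) (u \<eta>) *\<^sub>C (id_blinfun :: 'n fock \<Rightarrow>\<^sub>L 'n fock))"
      by (rule arg_cong)
    then show ?thesis by (simp add: vacuum_state_scale_id)
  qed
  have "norm (u \<xi>) = norm \<xi>" for \<xi>
    by (simp add: norm_eq_sqrt_inner inner_eq_Re_cinner u_cinner)
  then have "bounded_linear u"
    by (intro bounded_linear_intro[where K = 1]) (simp_all add: u_add scaleR_scaleC u_scaleC)
  then have app: "blinfun_apply (Blinfun u) = u" by (rule bounded_linear_Blinfun_apply)
  have "surj u"
  proof (rule surjI)
    fix \<eta>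
    have "right_creation e \<eta> \<in> \<alpha> ` range (right_creation e)" by (simp add: \<alpha>'(2))
    then have "\<exists>\<xi>. right_creation e \<eta> = right_creation e (u \<xi>)" by (auto simp: u)
    then have "\<exists>\<xi>. u \<xi> = \<eta>" using inj by metis
    then show "u (SOME \<xi>. u \<xi> = \<eta>) = \<eta>" by (rule someI_ex)
  qed
  then have "Blinfun u \<in> unitaries"
    by (simp add: unitaries_def bounded_ops_def app u_scaleC u_cinner)
  then show thesis using that[of "Blinfun u"] by (simp add: app u)
qed

text \<open>Conjugating back by the inverse unitary gives an automorphism that fixes the creation operators
  of the basis vectors.\<close>

lemma stabilizer_eq_Ad:
  assumes n: "CARD('n) > 1" and \<alpha>: "\<alpha> \<in> creation_stabilizer e"
  obtains U where "U \<in> unitaries" "\<alpha> = restrict (conj_second_quantization e U) (Hinf e)"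
proof -
  have \<alpha>': "harm_aut \<alpha>" "\<alpha> \<in> extensional harmonic_ops"
    using \<alpha> by (auto simp: creation_stabilizer_def Hinf_automorphisms_iff)
  obtain U where U: "U \<in> unitaries" "\<And>\<xi>. \<alpha> (right_creation e \<xi>) = right_creation e (blinfun_apply U \<xi>)"
    by (rule stabilizer_unitary[OF \<alpha>]) (rule that)
  obtain V where V: "V \<in> unitaries" "U o\<^sub>L V = id_blinfun" "V o\<^sub>L U = id_blinfun"
    using unitaries_inverse[OF e U(1)] .
  have "harm_aut (\<lambda>x. conj_second_quantization e V (\<alpha> x))"
    by (rule harm_aut_compose[OF Ad_aut[OF e V(1)] \<alpha>'(1)])
  moreover have "conj_second_quantization e V (\<alpha> (rshift [i])) = rshift [i]" for i
  proof -
    have "blinfun_apply V (blinfun_apply U (e i)) = e i"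
      using V(3) by (metis blinfun_apply_blinfun_compose blinfun_apply_id_blinfun id_apply)
    then show ?thesis
      unfolding creation_basis(2)[OF e, symmetric] by (simp add: U(2) Ad_right_creation[OF e V(1)])
  qed
  ultimately have "conj_second_quantization e V (\<alpha> x) = x" if "x \<in> harmonic_ops" for x
    using harm_aut.fixes_all[OF _ _ n that] by blast
  then have "\<alpha> x = conj_second_quantization e U x" if "x \<in> harmonic_ops" for x
    using that Ad_inverse[OF e U(1) V(1,2)] by metis
  then have "\<alpha> = restrict (conj_second_quantization e U) (Hinf e)"
    using \<alpha>'(2) by (auto simp: Hinf_eq[OF e] fun_eq_iff extensional_def)
  with U(1) that show thesis by blast
qed

lemma conj_second_quantization_iso:
  assumes n: "CARD('n) > 1"
  shows "(\<lambda>U. restrict (conj_second_quantization e U) (Hinf e))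
      \<in> iso unitary_group ((Aut_Hinf e)\<lparr>carrier := creation_stabilizer e\<rparr>)"
proof (rule isoI)
  let ?h = "\<lambda>U. restrict (conj_second_quantization e U) (Hinf e)"
  show "?h \<in> hom unitary_group ((Aut_Hinf e)\<lparr>carrier := creation_stabilizer e\<rparr>)"
  proof (rule homI)
    fix U V :: "'h \<Rightarrow>\<^sub>L 'h"
    assume "U \<in> carrier unitary_group" "V \<in> carrier unitary_group"
    then have UV: "U \<in> unitaries" "V \<in> unitaries" by (simp_all add: unitary_group_def)
    have "?h U \<otimes>\<^bsub>(Aut_Hinf e)\<lparr>carrier := creation_stabilizer e\<rparr>\<^esub> ?h V = compose harmonic_ops (?h U) (?h V)"
      using mult_BijGroup_aut[of "?h U" "?h V"] restrict_Ad_stabilizer[OF UV(1)] restrict_Ad_stabilizer[OF UV(2)]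
      by (simp add: Aut_Hinf_def creation_stabilizer_def)
    also have "\<dots> = ?h (U o\<^sub>L V)"
      by (auto simp: fun_eq_iff compose_def Hinf_eq[OF e] Ad_harm[OF e] Ad_compose[OF e] UV)
    finally show "?h (U \<otimes>\<^bsub>unitary_group\<^esub> V) = ?h U \<otimes>\<^bsub>(Aut_Hinf e)\<lparr>carrier := creation_stabilizer e\<rparr>\<^esub> ?h V"
      by (simp add: unitary_group_def)
  qed (simp add: unitary_group_def restrict_Ad_stabilizer)
  show "bij_betw ?h (carrier unitary_group) (carrier ((Aut_Hinf e)\<lparr>carrier := creation_stabilizer e\<rparr>))"
    unfolding bij_betw_def
  proof
    show "inj_on ?h (carrier unitary_group)"
    proof (rule inj_onI, rule blinfun_eqI)
      fix U V :: "'h \<Rightarrow>\<^sub>L 'h" and \<xi>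
      assume "U \<in> carrier unitary_group" "V \<in> carrier unitary_group" and eq: "?h U = ?h V"
      then have UV: "U \<in> unitaries" "V \<in> unitaries" by (simp_all add: unitary_group_def)
      have "?h U (right_creation e \<xi>) = ?h V (right_creation e \<xi>)" by (simp only: eq)
      then have "right_creation e (blinfun_apply U \<xi>) = right_creation e (blinfun_apply V \<xi>)"
        by (simp add: Hinf_eq[OF e] right_creation_harm[OF e] Ad_right_creation[OF e] UV)
      then show "blinfun_apply U \<xi> = blinfun_apply V \<xi>" by (rule right_creation_inj[OF e])
    qed
    show "?h ` carrier unitary_group = carrier ((Aut_Hinf e)\<lparr>carrier := creation_stabilizer e\<rparr>)"
    proof
      show "?h ` carrier unitary_group \<subseteq> carrier ((Aut_Hinf e)\<lparr>carrier := creation_stabilizer e\<rparr>)"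
        by (auto simp: unitary_group_def restrict_Ad_stabilizer)
      show "carrier ((Aut_Hinf e)\<lparr>carrier := creation_stabilizer e\<rparr>) \<subseteq> ?h ` carrier unitary_group"
      proof
        fix \<alpha> assume "\<alpha> \<in> carrier ((Aut_Hinf e)\<lparr>carrier := creation_stabilizer e\<rparr>)"
        then have "\<alpha> \<in> creation_stabilizer e" by simp
        then obtain U where "U \<in> unitaries" "\<alpha> = ?h U" using stabilizer_eq_Ad[OF n] by blast
        then show "\<alpha> \<in> ?h ` carrier unitary_group" by (simp add: unitary_group_def)
      qed
    qed
  qed
qed

end

theorem mainTheorem4:
  fixes e :: "'n::finite \<Rightarrow> 'h::complex_hilbert"
  assumes "orthonormal_basis e"
    and "CARD('n) > 1"
  shows "group (Aut_Hinf e) \<and>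
    subgroup (creation_stabilizer e) (Aut_Hinf e) \<and>
    (\<lambda>U. restrict (conj_second_quantization e U) (Hinf e))
      \<in> iso unitary_group ((Aut_Hinf e)\<lparr>carrier := creation_stabilizer e\<rparr>)"
  using group_Aut_Hinf[OF assms(1)] subgroup_creation_stabilizer[OF assms(1)]
    conj_second_quantization_iso[OF assms] by blast

end
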